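(* Let $0<p,q<\infty$, $n$ a positive integer, $\mathbf{u}=(u_0,\dots,u_n)$ with $u_k\in H(\mathbb{D})$, and $\varphi$ an analytic self-map of $\mathbb{D}$. Then $L_{\mathbf{u},\varphi}^{(n)}:A^p\to A^q$ is bounded (respectively compact) if and only if $W_{u_k,\varphi}^{(k)}:A^p\to A^q$ is bounded (respectively compact) for each $k=0,1,\dots,n$.
   Context: $\mathbb{D}$ is the open unit disc, $H(\mathbb{D})$ the analytic functions on $\mathbb{D}$, $dA=\frac{dx\,dy}{\pi}$, and $A^p=\{f\in H(\mathbb{D}):\int_{\mathbb{D}}|f|^p\,dA<\infty\}$. For $u\in H(\mathbb{D})$ and integer $k\ge0$, the generalized weighted composition operator is $W_{u,\varphi}^{(k)}f=u\cdot(f^{(k)}\circ\varphi)$, and $L_{\mathbf{u},\varphi}^{(n)}=\sum_{k=0}^nW_{u_k,\varphi}^{(k)}$. *)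

theory Defs
  imports "HOL-Analysis.Analysis"
begin

abbreviation unit_disc :: "complex set" where
  "unit_disc \<equiv> ball 0 1"

definition bergman_integral :: "real \<Rightarrow> (complex \<Rightarrow> complex) \<Rightarrow> ennreal" where
  "bergman_integral p f =
     ennreal (1 / pi) * (\<integral>\<^sup>+ z. indicator unit_disc z * ennreal (norm (f z) powr p) \<partial>lborel)"

definition bergman_space :: "real \<Rightarrow> (complex \<Rightarrow> complex) set" where
  "bergman_space p = {f. f holomorphic_on unit_disc \<and> bergman_integral p f < \<infinity>}"

definition bergman_norm :: "real \<Rightarrow> (complex \<Rightarrow> complex) \<Rightarrow> real" where
  "bergman_norm p f = enn2real (bergman_integral p f) powr (1 / p)"

definition gen_wcomp :: "(complex \<Rightarrow> complex) \<Rightarrow> (complex \<Rightarrow> complex) \<Rightarrow> nat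
    \<Rightarrow> (complex \<Rightarrow> complex) \<Rightarrow> (complex \<Rightarrow> complex)" where
  "gen_wcomp u \<phi> k f = (\<lambda>z. u z * (deriv ^^ k) f (\<phi> z))"

definition L_op :: "(nat \<Rightarrow> complex \<Rightarrow> complex) \<Rightarrow> (complex \<Rightarrow> complex) \<Rightarrow> nat
    \<Rightarrow> (complex \<Rightarrow> complex) \<Rightarrow> (complex \<Rightarrow> complex)" where
  "L_op us \<phi> n f = (\<lambda>z. \<Sum>k\<le>n. gen_wcomp (us k) \<phi> k f z)"

definition bounded_op :: "real \<Rightarrow> real \<Rightarrow> ((complex \<Rightarrow> complex) \<Rightarrow> (complex \<Rightarrow> complex)) \<Rightarrow> bool" where
  "bounded_op p q T \<longleftrightarrow>
     (\<forall>f\<in>bergman_space p. T f \<in> bergman_space q) \<and>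
     (\<exists>C. \<forall>f\<in>bergman_space p. bergman_norm q (T f) \<le> C * bergman_norm p f)"

definition compact_op :: "real \<Rightarrow> real \<Rightarrow> ((complex \<Rightarrow> complex) \<Rightarrow> (complex \<Rightarrow> complex)) \<Rightarrow> bool" where
  "compact_op p q T \<longleftrightarrow>
     (\<forall>f\<in>bergman_space p. T f \<in> bergman_space q) \<and>
     (\<forall>fs :: nat \<Rightarrow> complex \<Rightarrow> complex.
        (\<forall>j. fs j \<in> bergman_space p) \<and> (\<exists>M. \<forall>j. bergman_norm p (fs j) \<le> M) \<longrightarrow>
        (\<exists>r g. strict_mono r \<and> g \<in> bergman_space q \<and>
           (\<lambda>j. bergman_norm q (\<lambda>z. T (fs (r j)) z - g z)) \<longlonglongrightarrow> 0))"

end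

theory Submission
  imports Defs "HOL-Complex_Analysis.Complex_Analysis"
begin

text \<open>
  The same argument serves all exponents \<open>p\<close>, \<open>q\<close>. Given \<open>f\<close> in the Bergman space, choose a
  hyperbolically separated finite set \<open>S\<close> in the disc and replace \<open>f\<close> by the sums
  \<open>F\<^sub>m\<^sub>,\<^sub>A = \<Sum>a\<in>A. c a * ((1 - |a|) / (1 - cnj a * z)) ^ (N + m)\<close> for \<open>A \<subseteq> S\<close>, \<open>m \<le> n\<close>, where \<open>c a\<close> is
  an \<open>L\<^sup>p\<close> mean of \<open>f\<close> near \<open>a\<close>. Their norms are controlled by the norm of \<open>f\<close>, and averaging
  \<open>|L F\<^sub>m\<^sub>,\<^sub>A|\<^sup>q\<close> over all subsets \<open>A\<close> dominates each single term \<open>|c a * L (atom a)|\<^sup>q\<close>.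
  When \<open>\<phi> z\<close> is close to \<open>a\<close>, the values of \<open>L\<close> at the \<open>n + 1\<close> atoms with exponents \<open>N, \<dots>, N + n\<close>
  determine the coefficients: up to scaling they are given by the fixed invertible matrix of the Pochhammer
  symbols \<open>(N + m)\<^sub>k\<close>. So \<open>|u\<^sub>k z| (1 - |a|)\<^sup>-\<^sup>k\<close> is bounded by the values of \<open>L\<close> at the atoms, while
  \<open>(1 - |a|)\<^sup>k |f\<^sup>(\<^sup>k\<^sup>) (\<phi> z)|\<close> is at most a multiple of \<open>c a\<close>. Compactness follows in the same way: if
  \<open>f\<close> runs through a bounded sequence tending to zero locally uniformly, so do the sums \<open>F\<^sub>m\<^sub>,\<^sub>A\<close>.
\<close>

text \<open>The main obstacle is cancellation: a bound on the sum \<open>L f\<close> says nothing by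
  itself about its summands. Test functions that look alike near \<open>a\<close> but carry
  different exponents break it, because differentiation couples the exponent and the order of the
  derivative only through a Pochhammer symbol. A second obstacle is the range q < p: testing on one
  atom at a time gives only a supremum condition, which is too weak there; hence sums of atoms whose
  coefficients are taken from \<open>f\<close> itself. Exponents below 1 rule out duality, so
  everything is phrased with integrals of p-th and q-th powers. The set \<open>S\<close> is finite
  and therefore serves only points with |phi z| at most some rho < 1; no constant depends on
  \<open>S\<close> or rho, and monotone convergence lets rho tend to 1. Points with |phi z| at most
  3/4 are treated apart, since a factor |a|^k degenerates for \<open>a\<close> near 0; there Cauchy
  estimates and the membership of each coefficient in A^q suffice. For compactness the subset and
  rho may change along the sequence, so the decay of the sums must be uniform in
  \<open>A\<close>.\<close>

lemma pochhammer_shift_diff: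
  fixes x :: "'a::comm_ring_1"
  shows "pochhammer (x + 1) (Suc k) - pochhammer x (Suc k) = of_nat (Suc k) * pochhammer (x + 1) k"
  unfolding pochhammer_rec[of x k] pochhammer_Suc[of "x + 1" k] by (simp add: algebra_simps)

text \<open>Quantitative invertibility of the matrix of Pochhammer symbols (s + m)_j. Differencing
  in m removes \<open>y 0\<close> and turns (x)_(j+1) into (j + 1) (x + 1)_j, which is the same
  problem of size \<open>n\<close> with base \<open>Suc s\<close>; this is why \<open>s\<close> is
  generalised in the induction. Then \<open>y 0\<close> is read off from the row m = 0.\<close>

lemma pochhammer_interpolation_bound:
  "\<exists>C\<ge>0. \<forall>y :: nat \<Rightarrow> complex. \<forall>k\<le>n.
     norm (y k) \<le> C * (\<Sum>m\<le>n. norm (\<Sum>j\<le>n. pochhammer (of_nat (s + m)) j * y j))"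
proof (induction n arbitrary: s)
  case 0
  show ?case by (intro exI[of _ 1]) auto
next
  case (Suc n)
  from Suc[of "Suc s"] obtain C where C: "C \<ge> 0"
    "\<And>y :: nat \<Rightarrow> complex. \<And>k. k \<le> n \<Longrightarrow>
       norm (y k) \<le> C * (\<Sum>m\<le>n. norm (\<Sum>j\<le>n. pochhammer (of_nat (Suc s + m)) j * y j))"
    by blast
  \<comment> \<open>The constant for \<open>y 0\<close>: the summand 1 comes from |P 0| at most
    \<open>T\<close>, the rest from the bound 2 C T on the other unknowns, weighted by the entries
    of the row m = 0.\<close>
  define D where "D = 1 + (\<Sum>k\<le>Suc n. norm (pochhammer (of_nat s :: complex) k)) * (2 * C)"
  have D: "D \<ge> 1" unfolding D_def using C(1) by (simp add: sum_nonneg del: sum.atMost_Suc)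
  show ?case
  proof (intro exI[of _ "D + 2 * C"] conjI allI impI)
    show "0 \<le> D + 2 * C" using D C by simp
    fix y :: "nat \<Rightarrow> complex" and k :: nat assume k: "k \<le> Suc n"
    define P where "P m = (\<Sum>j\<le>Suc n. pochhammer (of_nat (s + m) :: complex) j * y j)" for m
    define T where "T = (\<Sum>m\<le>Suc n. norm (P m))"
    have T0: "T \<ge> 0" unfolding T_def by (intro sum_nonneg) auto
    have diff: "(\<Sum>j\<le>n. pochhammer (of_nat (Suc s + m)) j * (of_nat (Suc j) * y (Suc j))) = P (Suc m) - P m" for m
    proof -
      have "P (Suc m) - P m = (\<Sum>j\<le>Suc n. (pochhammer (of_nat (s + m) + 1) j - pochhammer (of_nat (s + m)) j) * y j)"
        unfolding P_def by (simp add: sum_subtractf[symmetric] algebra_simps del: sum.atMost_Suc)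
      also have "\<dots> = (\<Sum>j\<le>n. (pochhammer (of_nat (s + m) + 1) (Suc j) - pochhammer (of_nat (s + m)) (Suc j)) * y (Suc j))"
        by (subst sum.atMost_Suc_shift) simp
      finally show ?thesis unfolding pochhammer_shift_diff by (simp add: algebra_simps)
    qed
    have tail: "norm (y (Suc j)) \<le> 2 * C * T" if "j \<le> n" for j
    proof -
      have "norm (y (Suc j)) \<le> norm (of_nat (Suc j) * y (Suc j))"
        by (simp add: norm_mult mult_le_cancel_right1 del: of_nat_Suc)
      also have "\<dots> \<le> C * (\<Sum>m\<le>n. norm (P (Suc m) - P m))"
        using C(2)[OF that, of "\<lambda>j. of_nat (Suc j) * y (Suc j)"] unfolding diff .
      also have "(\<Sum>m\<le>n. norm (P (Suc m) - P m)) \<le> 2 * T"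
      proof -
        have "(\<Sum>m\<le>n. norm (P (Suc m) - P m)) \<le> (\<Sum>m\<le>n. norm (P (Suc m))) + (\<Sum>m\<le>n. norm (P m))"
          unfolding sum.distrib[symmetric] by (intro sum_mono norm_triangle_ineq4)
        moreover have "(\<Sum>m\<le>n. norm (P (Suc m))) \<le> T" unfolding T_def by (subst sum.atMost_Suc_shift) simp
        moreover have "(\<Sum>m\<le>n. norm (P m)) \<le> T" unfolding T_def by simp
        ultimately show ?thesis by simp
      qed
      finally show ?thesis using C(1) by (simp add: mult_left_mono)
    qed
    have "y 0 = P 0 - (\<Sum>j\<le>n. pochhammer (of_nat s) (Suc j) * y (Suc j))"
      unfolding P_def by (subst sum.atMost_Suc_shift) simp
    then have "norm (y 0) \<le> norm (P 0) + norm (\<Sum>j\<le>n. pochhammer (of_nat s) (Suc j) * y (Suc j))"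
      by (simp only: norm_triangle_ineq4)
    also have "norm (\<Sum>j\<le>n. pochhammer (of_nat s) (Suc j) * y (Suc j)) \<le> (\<Sum>j\<le>n. norm (pochhammer (of_nat s :: complex) (Suc j)) * norm (y (Suc j)))"
      unfolding norm_mult[symmetric] by (rule norm_sum)
    also have "norm (P 0) \<le> T" unfolding T_def by (rule member_le_sum) auto
    also have "(\<Sum>j\<le>n. norm (pochhammer (of_nat s :: complex) (Suc j)) * norm (y (Suc j)))
        \<le> (\<Sum>j\<le>n. norm (pochhammer (of_nat s :: complex) (Suc j)) * (2 * C * T))"
      by (intro sum_mono mult_left_mono tail) auto
    also have "\<dots> = (\<Sum>j\<le>n. norm (pochhammer (of_nat s :: complex) (Suc j))) * (2 * C * T)"
      by (simp add: sum_distrib_right)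
    also have "\<dots> \<le> (\<Sum>j\<le>Suc n. norm (pochhammer (of_nat s :: complex) j)) * (2 * C * T)"
      using C(1) T0 by (intro mult_right_mono) (subst sum.atMost_Suc_shift, auto)
    finally have zero: "norm (y 0) \<le> D * T" unfolding D_def by (simp add: algebra_simps)
    have "norm (y k) \<le> (D + 2 * C) * T"
    proof (cases k)
      case 0
      have "0 \<le> 2 * C * T" using C T0 by simp
      then show ?thesis using zero 0 by (simp add: algebra_simps)
    next
      case (Suc j)
      have "0 \<le> D * T" using D T0 by simp
      then show ?thesis using tail[of j] Suc k by (simp add: algebra_simps)
    qed
    then show "norm (y k) \<le> (D + 2 * C) * (\<Sum>m\<le>Suc n. norm (\<Sum>j\<le>Suc n. pochhammer (of_nat (s + m)) j * y j))"
      unfolding T_def P_def .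
  qed
qed

section \<open>Elementary inequalities for real powers and finite sums\<close>

lemma powr_add_le:
  fixes a b q :: real
  assumes "0 \<le> a" "0 \<le> b" "0 < q"
  shows "(a + b) powr q \<le> 2 powr q * (a powr q + b powr q)"
proof -
  have "(a + b) powr q \<le> (2 * max a b) powr q" using assms by (intro powr_mono2) auto
  also have "\<dots> = 2 powr q * (max a b) powr q" using assms by (simp add: powr_mult)
  also have "(max a b) powr q \<le> a powr q + b powr q" by (auto simp: max_def)
  finally show ?thesis by simp
qed

text \<open>Comparison of every term with the largest one works for all positive exponents, convex
  or not; the crude constant depends on nothing but the number of terms.\<close>

lemma powr_sum_le:
  fixes x :: "'a \<Rightarrow> real"
  assumes "finite I" "\<And>i. i \<in> I \<Longrightarrow> 0 \<le> x i" "0 < q"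
  shows "(\<Sum>i\<in>I. x i) powr q \<le> real (card I) powr q * (\<Sum>i\<in>I. x i powr q)"
proof (cases "I = {}")
  case False
  have "Max (x ` I) \<in> x ` I" using False assms(1) by (intro Max_in) auto
  then obtain j where "j \<in> I" "Max (x ` I) = x j" by blast
  moreover have "x i \<le> Max (x ` I)" if "i \<in> I" for i using that assms(1) by (intro Max_ge) auto
  ultimately have j: "j \<in> I" "\<And>i. i \<in> I \<Longrightarrow> x i \<le> x j" by auto
  have "(\<Sum>i\<in>I. x i) powr q \<le> (real (card I) * x j) powr q"
    using assms j by (intro powr_mono2 sum_nonneg) (auto intro: sum_bounded_above)
  also have "\<dots> = real (card I) powr q * x j powr q" using assms j by (simp add: powr_mult)
  also have "x j powr q \<le> (\<Sum>i\<in>I. x i powr q)" using j assms by (intro member_le_sum) auto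
  finally show ?thesis by (simp add: mult_left_mono)
qed simp

text \<open>After division by the total every term lies in [0, 1], where a power with exponent at
  most 1 only increases it.\<close>

lemma powr_sum_le_sum_powr:
  fixes x :: "'a \<Rightarrow> real"
  assumes "finite I" "\<And>i. i \<in> I \<Longrightarrow> 0 \<le> x i" "0 < p" "p \<le> 1"
  shows "(\<Sum>i\<in>I. x i) powr p \<le> (\<Sum>i\<in>I. x i powr p)"
proof (cases "(\<Sum>i\<in>I. x i) = 0")
  case True
  then show ?thesis by (simp add: sum_nonneg)
next
  case False
  define s where "s = (\<Sum>i\<in>I. x i)"
  have s: "s > 0" using False assms unfolding s_def by (simp add: sum_nonneg order_less_le)
  have "x i / s \<le> (x i / s) powr p" if "i \<in> I" for i
  proof (cases "x i = 0")
    case False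
    have "x i / s \<le> 1" using member_le_sum[OF that _ assms(1), of x] assms(2) s unfolding s_def by (auto simp: divide_le_eq)
    then have "(x i / s) powr 1 \<le> (x i / s) powr p" using assms s that by (intro powr_mono') auto
    then show ?thesis using False assms(2)[OF that] s by simp
  qed (use assms in auto)
  then have "(\<Sum>i\<in>I. x i / s) \<le> (\<Sum>i\<in>I. (x i / s) powr p)" by (intro sum_mono)
  also have "(\<Sum>i\<in>I. x i / s) = 1" using s by (simp add: sum_divide_distrib[symmetric] s_def)
  also have "(\<Sum>i\<in>I. (x i / s) powr p) = (\<Sum>i\<in>I. x i powr p) / s powr p"
    using assms s by (simp add: sum_divide_distrib powr_divide)
  finally show ?thesis using s by (simp add: s_def field_simps)
qed

text \<open>The endpoint 0 is included because coefficients of atoms may vanish; there the claim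
  reduces to s^p being at most s for s in (0, 1).\<close>

lemma powr_convex_ge0:
  assumes "p \<ge> 1"
  shows "convex_on {0..} (\<lambda>x::real. x powr p)"
proof (rule convex_onI)
  fix t x y :: real assume t: "0 < t" "t < 1" and xy: "x \<in> {0..}" "y \<in> {0..}"
  have *: "(s * z) powr p \<le> s * z powr p" if "0 < s" "s < 1" "z \<ge> 0" for s z :: real
  proof -
    have "s powr p \<le> s powr 1" using that assms by (intro powr_mono') auto
    then show ?thesis using that by (simp add: powr_mult mult_right_mono)
  qed
  consider "x = 0" | "y = 0" | "x > 0" "y > 0" using xy by fastforce
  then show "((1 - t) *\<^sub>R x + t *\<^sub>R y) powr p \<le> (1 - t) * x powr p + t * y powr p"
  proof cases
    case 3
    then show ?thesis using convex_onD[OF powr_convex[OF assms], of t x y] t by simp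
  qed (use * t xy assms in auto)
qed simp

text \<open>Jensen's inequality for the probability weights K w / s at the points c / w, where s is
  the sum of all K w. This is the weighted Hoelder step of Schur's test, with \<open>w\<close> as
  the free weight.\<close>

lemma weighted_power_mean:
  fixes c K w :: "'a \<Rightarrow> real"
  assumes "finite I" "\<And>i. i \<in> I \<Longrightarrow> 0 \<le> c i" "\<And>i. i \<in> I \<Longrightarrow> 0 < K i" "\<And>i. i \<in> I \<Longrightarrow> 0 < w i" "1 \<le> p"
  shows "(\<Sum>i\<in>I. c i * K i) powr p
    \<le> (\<Sum>i\<in>I. K i * w i) powr (p - 1) * (\<Sum>i\<in>I. c i powr p * K i * w i powr (1 - p))"
proof (cases "I = {}")
  case False
  define s where "s = (\<Sum>i\<in>I. K i * w i)"
  have s: "s > 0" unfolding s_def using False assms by (intro sum_pos) auto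
  have 1: "(\<Sum>i\<in>I. (K i * w i / s) * (c i / w i)) = (\<Sum>i\<in>I. c i * K i) / s"
    using assms(4) by (force simp: sum_divide_distrib intro!: sum.cong)
  have "(\<Sum>i\<in>I. (K i * w i / s) *\<^sub>R (c i / w i)) powr p \<le> (\<Sum>i\<in>I. (K i * w i / s) * (c i / w i) powr p)"
    by (rule convex_on_sum[OF assms(1) False powr_convex_ge0[OF assms(5)]])
      (use s assms in \<open>auto simp: sum_divide_distrib[symmetric] s_def intro!: divide_nonneg_pos mult_nonneg_nonneg intro: less_imp_le\<close>)
  also have "\<dots> = (\<Sum>i\<in>I. c i powr p * K i * w i powr (1 - p)) / s"
    unfolding sum_divide_distrib
  proof (rule sum.cong)
    fix i assume i: "i \<in> I"
    have "(c i / w i) powr p = c i powr p / w i powr p" using assms i by (simp add: powr_divide less_imp_le)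
    moreover have "w i powr (1 - p) = w i / w i powr p" using assms(4)[OF i] by (simp add: powr_diff)
    ultimately show "K i * w i / s * (c i / w i) powr p = c i powr p * K i * w i powr (1 - p) / s" by (simp add: mult_ac)
  qed simp
  finally have "((\<Sum>i\<in>I. c i * K i) / s) powr p \<le> (\<Sum>i\<in>I. c i powr p * K i * w i powr (1 - p)) / s"
    using 1 by simp
  then have "(\<Sum>i\<in>I. c i * K i) powr p * (s / s powr p) \<le> (\<Sum>i\<in>I. c i powr p * K i * w i powr (1 - p))"
    using s unfolding powr_divide by (simp only: pos_le_divide_eq times_divide_eq_right times_divide_eq_left)
  then show ?thesis using s
    by (simp only: s_def[symmetric] powr_diff) (simp add: field_simps)
qed simp

text \<open>Averaging over all subsets replaces Khinchine's inequality: pairing \<open>A\<close> with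
  \<open>insert i A\<close> isolates the \<open>i\<close>-th term.\<close>

lemma powr_le_sum_Pow:
  fixes x :: "'a \<Rightarrow> 'b::real_normed_vector"
  assumes S: "finite S" "i \<in> S" and "0 < q"
  shows "2 ^ card S * norm (x i) powr q \<le> 2 * 2 powr q * (\<Sum>A\<in>Pow S. norm (sum x A) powr q)"
proof -
  define R where "R = S - {i}"
  have R: "finite R" "i \<notin> R" "S = insert i R" using S unfolding R_def by auto
  have "norm (x i) powr q \<le> 2 powr q * (norm (sum x (insert i A)) powr q + norm (sum x A) powr q)"
    if "A \<in> Pow R" for A
  proof -
    have A: "finite A" "i \<notin> A" using that R finite_subset by auto
    have "norm (x i) = norm (sum x (insert i A) - sum x A)" using A by simp
    also have "\<dots> \<le> norm (sum x (insert i A)) + norm (sum x A)" by (rule norm_triangle_ineq4)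
    finally have "norm (x i) powr q \<le> (norm (sum x (insert i A)) + norm (sum x A)) powr q"
      using assms by (intro powr_mono2) auto
    also have "\<dots> \<le> 2 powr q * (norm (sum x (insert i A)) powr q + norm (sum x A) powr q)"
      using assms by (intro powr_add_le) auto
    finally show ?thesis .
  qed
  then have "(\<Sum>A\<in>Pow R. norm (x i) powr q)
      \<le> (\<Sum>A\<in>Pow R. 2 powr q * (norm (sum x (insert i A)) powr q + norm (sum x A) powr q))"
    by (rule sum_mono)
  also have "\<dots> = 2 powr q * (\<Sum>A\<in>Pow S. norm (sum x A) powr q)"
  proof -
    have "Pow R \<inter> insert i ` Pow R = {}" "inj_on (insert i) (Pow R)"
      using R(2) by (auto simp: inj_on_def)
    then have "(\<Sum>A\<in>Pow S. norm (sum x A) powr q)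
        = (\<Sum>A\<in>Pow R. norm (sum x A) powr q) + (\<Sum>A\<in>Pow R. norm (sum x (insert i A)) powr q)"
      unfolding R(3) Pow_insert using R(1) by (subst sum.union_disjoint) (auto simp: sum.reindex)
    then show ?thesis by (simp add: sum.distrib sum_distrib_left algebra_simps)
  qed
  finally show ?thesis using R by (simp add: card_Pow)
qed

section \<open>Polar coordinates in the unit disc\<close>

text \<open>Bridge to \<open>real^2\<close>, where invariance of Lebesgue measure under orthogonal
  maps is at hand.\<close>

lemma lborel_complex_eq_distr:
  "distr lborel borel (\<lambda>v :: real^2. Complex (v $ 1) (v $ 2)) = (lborel :: complex measure)"
proof (rule sym, rule lborel_eqI)
  let ?T = "\<lambda>v :: real^2. Complex (v $ 1) (v $ 2)"
  have T [measurable]: "?T \<in> borel_measurable borel"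
    unfolding Complex_eq by (intro borel_measurable_continuous_onI continuous_intros)
  fix l u :: complex assume lu: "\<And>b. b \<in> Basis \<Longrightarrow> l \<bullet> b \<le> u \<bullet> b"
  let ?l = "vector [Re l, Im l] :: real^2" and ?u = "vector [Re u, Im u] :: real^2"
  have le: "Re l \<le> Re u" "Im l \<le> Im u" using lu[of 1] lu[of \<i>] by (auto simp: Basis_complex_def)
  have "?T -` box l u = box ?l ?u"
    by (auto simp: in_box_complex_iff mem_box_cart forall_2 vector_2)
  moreover have "emeasure lborel (box ?l ?u) = ennreal (measure lborel (cbox ?l ?u))"
    by (simp add: emeasure_lborel_box_eq measure_lborel_cbox_eq)
  moreover have "measure lborel (cbox ?l ?u) = (Re u - Re l) * (Im u - Im l)"
  proof -
    have "?l $ i \<le> ?u $ i" for i using le exhaust_2[of i] by (auto simp: vector_2)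
    then have "cbox ?l ?u \<noteq> {}" by (simp add: interval_ne_empty_cart)
    then show ?thesis by (simp add: content_cbox_cart UNIV_2 vector_2)
  qed
  moreover have "(\<Prod>b\<in>Basis. (u - l) \<bullet> b) = (Re u - Re l) * (Im u - Im l)"
    by (simp add: Basis_complex_def)
  ultimately show "emeasure (distr lborel borel ?T) (box l u) = (\<Prod>b\<in>Basis. (u - l) \<bullet> b)"
    by (simp add: emeasure_distr)
qed simp

text \<open>Multiplication by a unimodular number is an orthogonal map of the plane. It is enough to
  compare both measures on boxes, and these are moved to \<open>real^2\<close> to use orthogonal
  invariance there.\<close>

lemma lborel_distr_rotation:
  fixes c :: complex
  assumes c: "norm c = 1"
  shows "distr lborel borel ((*) c) = (lborel :: complex measure)"
proof (rule sym, rule lborel_eqI)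
  let ?T = "\<lambda>v :: real^2. Complex (v $ 1) (v $ 2)"
  let ?U = "\<lambda>z :: complex. vector [Re z, Im z] :: real^2"
  \<comment> \<open>Multiplication by \<open>cnj c\<close>, the inverse rotation, in real
    coordinates: the preimage of a box under multiplication by \<open>c\<close> becomes the image of
    that box under \<open>R\<close>.\<close>
  define R where "R v = ?U (cnj c * ?T v)" for v
  have T [measurable]: "?T \<in> borel_measurable borel"
    unfolding Complex_eq by (intro borel_measurable_continuous_onI continuous_intros)
  have m: "(*) c \<in> borel_measurable borel" by simp
  have UT: "?U (?T v) = v" for v by (simp add: vec_eq_iff forall_2 vector_2)
  have TU: "?T (?U z) = z" for z by (simp add: vector_2 complex_eq_iff)
  have "c * cnj c = of_real ((norm c)\<^sup>2)" by (rule complex_norm_square[symmetric])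
  then have cc: "c * cnj c = 1" "cnj c * c = 1" using c by (simp_all add: mult.commute)
  have orth: "orthogonal_transformation R"
    unfolding orthogonal_transformation
  proof
    show "linear R"
      unfolding R_def by (rule linearI) (auto simp: vec_eq_iff forall_2 vector_2 algebra_simps)
    have "norm (?U z) = norm z" for z by (simp add: norm_vec_def L2_set_def UNIV_2 vector_2 cmod_def)
    moreover have "norm (?T v) = norm v" for v by (simp add: norm_vec_def L2_set_def UNIV_2 cmod_def)
    ultimately have "norm (R v) = norm v" for v using c unfolding R_def by (simp only: norm_mult complex_mod_cnj mult_1)
    then show "\<forall>v. norm (R v) = norm v" by blast
  qed
  fix l u :: complex assume lu: "\<And>b. b \<in> Basis \<Longrightarrow> l \<bullet> b \<le> u \<bullet> b"
  define B where "B = ?T -` box l u"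
  have B: "B = box (?U l) (?U u)"
    unfolding B_def by (auto simp: in_box_complex_iff mem_box_cart forall_2 vector_2)
  have RB: "?T -` ((*) c -` box l u) = R ` B"
  proof (intro set_eqI iffI)
    fix v assume "v \<in> ?T -` ((*) c -` box l u)"
    then have "?U (c * ?T v) \<in> B" unfolding B_def by (simp only: vimage_eq TU)
    moreover have "R (?U (c * ?T v)) = v"
      unfolding R_def TU mult.assoc[symmetric] cc mult_1 by (rule UT)
    ultimately show "v \<in> R ` B" by force
  next
    fix v assume "v \<in> R ` B"
    then obtain x where x: "x \<in> B" "v = R x" by auto
    have "c * ?T v = ?T x" unfolding x(2) R_def TU by (simp add: mult.assoc[symmetric] cc)
    then show "v \<in> ?T -` ((*) c -` box l u)" using x(1) unfolding B_def by simp
  qed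
  have Bm: "B \<in> lmeasurable" unfolding B by simp
  have RBm: "R ` B \<in> lmeasurable" and RBe: "measure lebesgue (R ` B) = measure lebesgue B"
    using measurable_orthogonal_image[OF orth Bm] measure_orthogonal_image[OF orth Bm] by auto
  have bor: "(*) c -` box l u \<in> sets borel" using measurable_sets[OF m, of "box l u"] by simp
  have RBb: "R ` B \<in> sets borel"
    using measurable_sets[OF T, of "(*) c -` box l u"] bor unfolding RB[symmetric] by simp
  have "emeasure (distr lborel borel ((*) c)) (box l u) = emeasure (lborel :: complex measure) ((*) c -` box l u)"
    by (simp add: emeasure_distr)
  also have "\<dots> = emeasure (distr lborel borel ?T) ((*) c -` box l u)"
    by (simp only: lborel_complex_eq_distr)
  also have "\<dots> = emeasure lborel (R ` B)" using bor by (simp add: emeasure_distr RB)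
  also have "\<dots> = emeasure lebesgue (R ` B)" using RBb by simp
  also have "\<dots> = measure lebesgue (R ` B)" using RBm by (rule emeasure_eq_measure2)
  also have "\<dots> = emeasure lebesgue B" unfolding RBe using Bm by (rule emeasure_eq_measure2[symmetric])
  also have "\<dots> = emeasure lborel B" by (simp add: B)
  also have "\<dots> = emeasure (distr lborel borel ?T) (box l u)" by (simp add: emeasure_distr B_def)
  also have "\<dots> = emeasure lborel (box l u)" by (simp only: lborel_complex_eq_distr)
  also have "\<dots> = (\<Prod>b\<in>Basis. (u - l) \<bullet> b)" using lu by simp
  finally show "emeasure (distr lborel borel ((*) c)) (box l u) = (\<Prod>b\<in>Basis. (u - l) \<bullet> b)" .
qed simp

text \<open>Rotation invariance for each fixed angle, integrated over the angle by Tonelli. It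
  supplies the angular half of polar coordinates: estimates on circles can be inserted under an area
  integral.\<close>

lemma nn_integral_average_rotation:
  fixes G :: "complex \<Rightarrow> ennreal"
  assumes [measurable]: "G \<in> borel_measurable borel"
  shows "(\<integral>\<^sup>+z. G z \<partial>lborel)
    = (\<integral>\<^sup>+z. (\<integral>\<^sup>+t. G (cis (2 * pi * t) * z) * indicator {0..1::real} t \<partial>lborel) \<partial>lborel)"
proof -
  have [measurable]: "(\<lambda>t :: real. cis (2 * pi * t)) \<in> borel_measurable borel"
    by (intro borel_measurable_continuous_onI continuous_intros)
  have rot: "(\<integral>\<^sup>+z. G (c * z) \<partial>lborel) = (\<integral>\<^sup>+z. G z \<partial>lborel)" if "norm c = 1" for c
  proof -
    have "(\<integral>\<^sup>+z. G z \<partial>lborel) = (\<integral>\<^sup>+z. G z \<partial>distr lborel borel ((*) c))"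
      using lborel_distr_rotation[OF that] by simp
    then show ?thesis by (simp add: nn_integral_distr)
  qed
  have "(\<integral>\<^sup>+z. (\<integral>\<^sup>+t. G (cis (2 * pi * t) * z) * indicator {0..1::real} t \<partial>lborel) \<partial>lborel)
    = (\<integral>\<^sup>+t. (\<integral>\<^sup>+z. G (cis (2 * pi * t) * z) * indicator {0..1::real} t \<partial>lborel) \<partial>lborel)"
    by (rule lborel_pair.Fubini') measurable
  also have "\<dots> = (\<integral>\<^sup>+t. (\<integral>\<^sup>+z. G z \<partial>lborel) * indicator {0..1::real} t \<partial>lborel)"
    by (simp add: nn_integral_multc rot)
  also have "\<dots> = (\<integral>\<^sup>+z. G z \<partial>lborel)" by (simp add: nn_integral_cmult_indicator)
  finally show ?thesis by simp
qed

lemma emeasure_ball_complex: "r \<ge> 0 \<Longrightarrow> emeasure lborel (ball (c :: complex) r) = ennreal (pi * r\<^sup>2)"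
  by (simp add: emeasure_ball unit_ball_vol_2)

lemma emeasure_cball_complex: "r \<ge> 0 \<Longrightarrow> emeasure lborel (cball (c :: complex) r) = ennreal (pi * r\<^sup>2)"
  by (simp add: emeasure_cball unit_ball_vol_2)

text \<open>The radial half of polar coordinates. Both measures are determined by their values on
  open half-lines, which are areas of annuli on one side and an elementary integral on the
  other.\<close>

lemma distr_norm_unit_ball:
  "distr (density lborel (indicator (ball (0::complex) 1))) borel norm
   = density lborel (\<lambda>r. ennreal (2 * pi * r) * indicator {0..1} r)"
  (is "?M = ?N")
proof (rule measure_eqI_lessThan)
  define area where "area x = (if x < 1 then pi - pi * (max x 0)\<^sup>2 else 0)" for x :: real
  have M: "emeasure ?M {x<..} = ennreal (area x)" for x
  proof -
    have "emeasure ?M {x<..} = emeasure lborel (ball (0::complex) 1 \<inter> {z. x < norm z})"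
    proof -
      have "emeasure ?M {x<..} = emeasure (density lborel (indicator (ball (0::complex) 1))) {z. x < norm z}"
        by (subst emeasure_distr) (auto simp: vimage_def)
      also have "\<dots> = (\<integral>\<^sup>+z. indicator (ball (0::complex) 1) z * indicator {z. x < norm z} z \<partial>lborel)"
        by (subst emeasure_density) (auto intro!: borel_measurable_indicator)
      also have "\<dots> = (\<integral>\<^sup>+z. indicator (ball (0::complex) 1 \<inter> {z. x < norm z}) z \<partial>lborel)"
        by (simp only: indicator_inter_arith)
      finally show ?thesis by simp
    qed
    also have "\<dots> = ennreal (area x)"
    proof (cases "x \<ge> 1")
      case True
      then have "ball (0::complex) 1 \<inter> {z. x < norm z} = {}" by auto
      then show ?thesis using True by (simp add: area_def)
    next
      case x1: False
      show ?thesis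
      proof (cases "x < 0")
        case True
        then have "ball (0::complex) 1 \<inter> {z. x < norm z} = ball 0 1" by (auto intro: less_le_trans)
        then show ?thesis using True by (simp add: area_def emeasure_ball_complex)
      next
        case False
        then have "ball (0::complex) 1 \<inter> {z. x < norm z} = ball 0 1 - cball 0 x" by auto
        moreover have "emeasure lborel (ball (0::complex) 1 - cball 0 x)
            = emeasure lborel (ball (0::complex) 1) - emeasure lborel (cball (0::complex) x)"
          using False x1 by (intro emeasure_Diff) (auto simp: emeasure_cball_complex)
        ultimately show ?thesis using False x1
          by (simp add: area_def emeasure_ball_complex emeasure_cball_complex ennreal_minus)
      qed
    qed
    finally show ?thesis .
  qed
  have N: "emeasure ?N {x<..} = ennreal (area x)" for x
  proof -
    have "emeasure ?N {x<..} = (\<integral>\<^sup>+r. ennreal (2 * pi * r) * indicator {0..1} r * indicator {x<..} r \<partial>lborel)"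
      by (simp add: emeasure_density)
    also have "\<dots> = (\<integral>\<^sup>+r. ennreal (2 * pi * r) * indicator {max x 0..max 1 x} r \<partial>lborel)"
    proof (rule nn_integral_cong_AE)
      have "AE r in lborel. r \<noteq> x \<and> r \<noteq> max 1 x" using AE_lborel_singleton[of x] AE_lborel_singleton[of "max 1 x"] by eventually_elim auto
      then show "AE r in lborel. ennreal (2 * pi * r) * indicator {0..1} r * indicator {x<..} r
          = ennreal (2 * pi * r) * indicator {max x 0..max 1 x} r"
        by eventually_elim (auto simp: indicator_def max_def split: if_splits)
    qed
    also have "\<dots> = ennreal (pi * (max 1 x)\<^sup>2 - pi * (max x 0)\<^sup>2)"
      by (rule nn_integral_FTC_Icc) (auto intro!: derivative_eq_intros)
    also have "\<dots> = ennreal (area x)" by (auto simp: area_def max_def)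
    finally show ?thesis .
  qed
  show "emeasure ?M {x<..} < \<infinity>" for x by (simp add: M)
  show "emeasure ?M {x<..} = emeasure ?N {x<..}" for x by (simp only: M N)
qed simp_all

lemma nn_integral_radial:
  fixes g :: "real \<Rightarrow> ennreal"
  assumes [measurable]: "g \<in> borel_measurable borel"
  shows "(\<integral>\<^sup>+z. indicator (ball (0::complex) 1) z * g (norm z) \<partial>lborel)
    = (\<integral>\<^sup>+r. ennreal (2 * pi * r) * indicator {0..1} r * g r \<partial>lborel)"
proof -
  have "(\<integral>\<^sup>+z. indicator (ball (0::complex) 1) z * g (norm z) \<partial>lborel)
      = (\<integral>\<^sup>+r. g r \<partial>distr (density lborel (indicator (ball (0::complex) 1))) borel norm)"
    by (subst nn_integral_distr, simp, simp, subst nn_integral_density) (auto intro!: borel_measurable_indicator)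
  then show ?thesis unfolding distr_norm_unit_ball by (simp add: nn_integral_density)
qed

text \<open>Splitting at \<open>h\<close> leaves two pure powers, whose integrals give the two
  fractions in the constant. It serves twice: \<open>max h x\<close> models the distance from 1
  along a circle (with \<open>t\<close> equal to 0), and then the quantity 1 - |a| |z| along a
  radius.\<close>

lemma nn_integral_powr_max_le:
  fixes h t M :: real
  assumes h: "h > 0" and t: "t > - 1" and M: "M > t + 1"
  shows "(\<integral>\<^sup>+x. ennreal (x powr t * (max h x) powr - M) * indicator {0..} x \<partial>lborel)
     \<le> ennreal ((1 / (t + 1) + 1 / (M - t - 1)) * h powr (t + 1 - M))"
proof -
  let ?A = "\<integral>\<^sup>+x. ennreal (h powr - M) * (ennreal (x powr t) * indicator {0..h} x) \<partial>lborel"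
  let ?B = "\<integral>\<^sup>+x. ennreal (x powr (t - M)) * indicator {h..} x \<partial>lborel"
  have "(\<integral>\<^sup>+x. ennreal (x powr t * (max h x) powr - M) * indicator {0..} x \<partial>lborel)
     \<le> (\<integral>\<^sup>+x. ennreal (h powr - M) * (ennreal (x powr t) * indicator {0..h} x)
              + ennreal (x powr (t - M)) * indicator {h..} x \<partial>lborel)"
  proof (rule nn_integral_mono)
    fix x :: real
    show "ennreal (x powr t * (max h x) powr - M) * indicator {0..} x
      \<le> ennreal (h powr - M) * (ennreal (x powr t) * indicator {0..h} x) + ennreal (x powr (t - M)) * indicator {h..} x"
      using h by (cases "x \<le> h"; cases "x \<ge> 0")
        (auto simp: indicator_def max_def ennreal_mult[symmetric] mult.commute powr_add[symmetric] intro: add_increasing2)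
  qed
  also have "\<dots> = ?A + ?B" by (rule nn_integral_add) auto
  also have "?A = ennreal (h powr - M) * ennreal (h powr (t + 1) / (t + 1))"
    using nn_integral_has_integral_lebesgue'[OF _ has_integral_powr_from_0[OF t, of h]] h
    by (subst nn_integral_cmult) auto
  also have "\<dots> = ennreal (h powr (t + 1 - M) / (t + 1))"
    using t by (subst ennreal_mult[symmetric]) (auto simp: powr_add[symmetric] algebra_simps)
  also have "?B = ennreal (h powr (t + 1 - M) / (M - t - 1))"
    using nn_integral_has_integral_lebesgue'[OF _ has_integral_powr_to_inf[of "t - M" h]] h M
    by (simp add: field_simps minus_divide_left[symmetric] minus_divide_right)
  finally show ?thesis using t M
    by (simp add: ennreal_plus[symmetric] algebra_simps del: ennreal_plus)
qed

lemma sin_ge_quarter: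
  fixes x :: real
  assumes "0 \<le> x" "x \<le> pi / 2"
  shows "x / 4 \<le> sin x"
proof (cases "x \<le> pi / 3")
  case True
  have "\<exists>z. z > 0 \<and> z < x \<and> sin x - sin 0 = (x - 0) * cos z" if "x > 0"
    using that by (intro MVT2) (auto intro!: derivative_eq_intros)
  moreover have "cos z \<ge> 1 / 2" if "0 < z" "z < x" for z
    using cos_monotone_0_pi_le[of z "pi / 3"] that True pi_gt_zero by (auto simp: cos_60)
  ultimately show ?thesis using assms
    by (cases "x = 0") (force intro: order_trans[OF _ mult_left_mono[of "1/2" _ x]])+
next
  case False
  have "sin (pi / 6) \<le> sin x" using assms False by (intro sin_monotone_2pi_le) auto
  then show ?thesis using assms pi_less_4 by (simp add: sin_30)
qed

text \<open>For \<rho> at least 1/2 the squared modulus is at least 1 - cos (2 pi s) = 2 sin (pi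
  s)^2, and the linear lower bound for the sine leaves pi^2 s^2 / 8, where pi^2 is at least 9. For
  smaller \<rho> the triangle inequality already gives more than 1/2.\<close>

lemma norm_one_minus_cis_ge:
  fixes s :: real
  assumes "0 \<le> \<rho>" "\<rho> \<le> 1" "\<bar>s\<bar> \<le> 1 / 2"
  shows "\<bar>s\<bar> \<le> norm (1 - of_real \<rho> * cis (2 * pi * s))"
proof (cases "\<rho> \<ge> 1 / 2")
  case True
  define t where "t = pi * \<bar>s\<bar>"
  have t: "0 \<le> t" "t \<le> pi / 2" using assms unfolding t_def by auto
  have c: "cos (2 * pi * s) = 1 - 2 * (sin t)\<^sup>2"
    unfolding t_def by (cases "s \<ge> 0") (auto simp: cos_double_sin[symmetric] mult.assoc)
  have "(norm (1 - of_real \<rho> * cis (2 * pi * s)))\<^sup>2 = (1 - \<rho>)\<^sup>2 + 2 * \<rho> * (1 - cos (2 * pi * s))"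
    using sin_cos_squared_add[of "2 * pi * s"]
    unfolding cmod_power2 by (simp add: power2_eq_square) algebra
  moreover have "2 * \<rho> * (1 - cos (2 * pi * s)) \<ge> 1 * (1 - cos (2 * pi * s))"
    using True by (intro mult_right_mono) auto
  moreover have "2 * (sin t)\<^sup>2 \<ge> 2 * (t / 4)\<^sup>2" using sin_ge_quarter[OF t] t by (simp add: power_mono)
  moreover have "2 * (t / 4)\<^sup>2 \<ge> \<bar>s\<bar>\<^sup>2"
  proof -
    have "9 \<le> pi\<^sup>2" using pi_gt3 by (simp add: power2_eq_square) (rule order_trans[OF _ mult_mono[of 3 pi 3 pi]], auto)
    then have "8 * s\<^sup>2 \<le> pi\<^sup>2 * s\<^sup>2" by (intro mult_right_mono) auto
    then show ?thesis unfolding t_def by (simp add: power_mult_distrib power_divide)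
  qed
  ultimately have "\<bar>s\<bar>\<^sup>2 \<le> (norm (1 - of_real \<rho> * cis (2 * pi * s)))\<^sup>2"
    using c by (smt (verit) zero_le_power2)
  then show ?thesis by (rule power2_le_imp_le) simp
next
  case False
  have "1 - norm (of_real \<rho> * cis (2 * pi * s)) \<le> norm (1 - of_real \<rho> * cis (2 * pi * s))"
    by (metis norm_one norm_triangle_ineq2)
  then show ?thesis using False assms by (simp add: norm_mult)
qed

section \<open>Kernel integrals and sub-mean value inequalities\<close>

abbreviation powr_integral :: "complex set \<Rightarrow> real \<Rightarrow> (complex \<Rightarrow> complex) \<Rightarrow> ennreal" where
  "powr_integral A p f \<equiv> \<integral>\<^sup>+z. indicator A z * ennreal (norm (f z) powr p) \<partial>lborel"

text \<open>The kernel is dominated by \<open>max h \<bar>s\<bar>\<close> to the power -N, with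
  \<open>s\<close> the angular distance to the peak in full turns. Unwinding the angle costs three
  translates, each made of two half-lines, which accounts for the factor 6.\<close>

lemma nn_integral_circle_kernel_le:
  fixes w :: complex
  assumes w: "norm w < 1" and N: "N > 1"
  shows "(\<integral>\<^sup>+t. ennreal (norm (1 - w * cis (2 * pi * t)) powr - N) * indicator {0..1::real} t \<partial>lborel)
    \<le> ennreal (6 * (1 + 1 / (N - 1)) * (1 - norm w) powr (1 - N))"
proof -
  define h where "h = 1 - norm w"
  have h: "h > 0" using w by (simp add: h_def)
  define m where "m x = ennreal ((max h \<bar>x\<bar>) powr - N)" for x :: real
  have [measurable]: "m \<in> borel_measurable borel" unfolding m_def by measurable
  define \<alpha> where "\<alpha> = Arg2pi w / (2 * pi)"
  have \<alpha>: "0 \<le> \<alpha>" "\<alpha> < 1" using Arg2pi_ge_0[of w] Arg2pi_lt_2pi[of w] by (auto simp: \<alpha>_def)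
  have weq: "w = of_real (norm w) * cis (2 * pi * \<alpha>)"
    using Arg2pi_eq[of w] by (simp add: \<alpha>_def cis_conv_exp)
  have ptw: "ennreal (norm (1 - w * cis (2 * pi * t)) powr - N) * indicator {0..1} t
     \<le> m (\<alpha> + 1 * t) + m (\<alpha> - 1 + 1 * t) + m (\<alpha> - 2 + 1 * t)" for t :: real
  proof (cases "t \<in> {0..1}")
    case True
    \<comment> \<open>The shifted angle \<open>\<alpha> + t\<close> lies in [0, 2), so its nearest
      integer is 0, 1 or 2: one translate of \<open>m\<close> for each.\<close>
    define k where "k = round (\<alpha> + t)"
    define s where "s = \<alpha> + t - of_int k"
    have s: "\<bar>s\<bar> \<le> 1 / 2" unfolding s_def k_def using of_int_round_abs_le[of "\<alpha> + t"] by (simp add: abs_minus_commute)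
    have t01: "0 \<le> t" "t \<le> 1" using True by auto
    have "real_of_int k > - 1" "real_of_int k < 3" using s t01 \<alpha> unfolding s_def abs_le_iff by linarith+
    then have "-1 < k" "k < 3" by linarith+
    then have k: "k = 0 \<or> k = 1 \<or> k = 2" by linarith
    have "2 * pi * (\<alpha> + t) = 2 * pi * s + 2 * pi * of_int k" by (simp add: s_def algebra_simps)
    then have "cis (2 * pi * (\<alpha> + t)) = cis (2 * pi * s) * cis (2 * pi * of_int k)" by (simp only: cis_mult)
    then have "cis (2 * pi * (\<alpha> + t)) = cis (2 * pi * s)" by (simp only: cis_multiple_2pi Ints_of_int mult_1_right)
    then have "w * cis (2 * pi * t) = of_real (norm w) * cis (2 * pi * s)"
      by (subst weq) (simp add: mult.assoc cis_mult distrib_left)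
    then have "\<bar>s\<bar> \<le> norm (1 - w * cis (2 * pi * t))"
      using norm_one_minus_cis_ge[of "norm w" s] s w by simp
    moreover have "h \<le> norm (1 - w * cis (2 * pi * t))"
      unfolding h_def using norm_triangle_ineq2[of 1 "w * cis (2 * pi * t)"] by (simp add: norm_mult)
    ultimately have "norm (1 - w * cis (2 * pi * t)) powr - N \<le> (max h \<bar>s\<bar>) powr - N"
      using h N by (intro powr_mono2') auto
    then have "ennreal (norm (1 - w * cis (2 * pi * t)) powr - N) \<le> m s" unfolding m_def by (rule ennreal_leI)
    also have "m s \<le> m (\<alpha> + 1 * t) + m (\<alpha> - 1 + 1 * t) + m (\<alpha> - 2 + 1 * t)"
      using k unfolding s_def
      by (auto simp: algebra_simps intro: add_increasing add_increasing2)
    finally show ?thesis using True by simp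
  qed simp
  have tr: "(\<integral>\<^sup>+t. m (c + 1 * t) \<partial>lborel) = (\<integral>\<^sup>+t. m t \<partial>lborel)" for c
    using nn_integral_real_affine[of m 1 c] by simp
  define J where "J = (\<integral>\<^sup>+x. ennreal (x powr 0 * (max h x) powr - N) * indicator {0..} x \<partial>lborel)"
  have J: "J \<le> ennreal ((1 + 1 / (N - 1)) * h powr (1 - N))"
    unfolding J_def using nn_integral_powr_max_le[OF h, of 0 N] N by simp
  have "(\<integral>\<^sup>+t. m t \<partial>lborel) \<le> (\<integral>\<^sup>+x. ennreal (x powr 0 * (max h x) powr - N) * indicator {0..} x
        + ennreal ((0 + - 1 * x) powr 0 * (max h (0 + - 1 * x)) powr - N) * indicator {0..} (0 + - 1 * x) \<partial>lborel)"
  proof (rule nn_integral_mono_AE)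
    \<comment> \<open>The origin has to be left out, because \<open>0 powr 0\<close> is 0 and the
      right-hand side vanishes there.\<close>
    show "AE x in lborel. m x \<le> ennreal (x powr 0 * (max h x) powr - N) * indicator {0..} x
        + ennreal ((0 + - 1 * x) powr 0 * (max h (0 + - 1 * x)) powr - N) * indicator {0..} (0 + - 1 * x)"
      using AE_lborel_singleton[of 0] by eventually_elim (auto simp: m_def indicator_def)
  qed
  also have "\<dots> = J + J"
    unfolding J_def using nn_integral_real_affine[of "\<lambda>x. ennreal (x powr 0 * (max h x) powr - N) * indicator {0..} x" "-1" 0]
    by (subst nn_integral_add) auto
  finally have mJ: "(\<integral>\<^sup>+t. m t \<partial>lborel) \<le> J + J" .
  have "(\<integral>\<^sup>+t. ennreal (norm (1 - w * cis (2 * pi * t)) powr - N) * indicator {0..1::real} t \<partial>lborel)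
     \<le> (\<integral>\<^sup>+t. m (\<alpha> + 1 * t) + m (\<alpha> - 1 + 1 * t) + m (\<alpha> - 2 + 1 * t) \<partial>lborel)"
    by (intro nn_integral_mono ptw)
  also have "\<dots> = (\<integral>\<^sup>+t. m t \<partial>lborel) + (\<integral>\<^sup>+t. m t \<partial>lborel) + (\<integral>\<^sup>+t. m t \<partial>lborel)"
    by (subst nn_integral_add, simp, simp, subst nn_integral_add, simp, simp) (simp only: tr)
  also have "\<dots> \<le> (J + J) + (J + J) + (J + J)" by (intro add_mono mJ)
  also have "\<dots> = (1 + 1 + (1 + 1) + (1 + 1)) * J" by (simp only: distrib_right mult_1)
  also have "\<dots> = 6 * J" by simp
  also have "\<dots> \<le> 6 * ennreal ((1 + 1 / (N - 1)) * h powr (1 - N))" by (intro mult_left_mono J) auto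
  also have "\<dots> = ennreal (6 * (1 + 1 / (N - 1)) * h powr (1 - N))"
    using N by (subst ennreal_numeral[symmetric], subst ennreal_mult[symmetric]) (auto simp: mult.assoc)
  finally show ?thesis unfolding h_def .
qed

text \<open>The Forelli-Rudin estimate. Averaging over circles leaves 1 - |a| |z| to the power 1 -
  N; since 1 - |a| |z| dominates both 1 - |a| and 1 - |z|, the radial integral in x = 1 - |z| is
  again of the model form.\<close>

lemma nn_integral_disc_kernel_le:
  fixes t N :: real
  assumes t: "t > - 1" and N: "N > 2 + t"
  shows "\<exists>C>0. \<forall>a. norm a < 1 \<longrightarrow>
    (\<integral>\<^sup>+z. indicator (ball 0 1) z * ennreal ((1 - norm z) powr t * norm (1 - cnj a * z) powr - N) \<partial>lborel)
      \<le> ennreal (C * (1 - norm a) powr (2 + t - N))"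
proof -
  define C1 where "C1 = 6 * (1 + 1 / (N - 1))"
  have C1: "C1 > 0" using t N unfolding C1_def by (simp add: add_pos_pos)
  define C2 where "C2 = 1 / (t + 1) + 1 / ((N - 1) - t - 1)"
  have C2: "C2 > 0" using t N unfolding C2_def by (simp add: add_pos_pos)
  show ?thesis
  proof (intro exI[of _ "2 * pi * C1 * C2"] conjI allI impI)
    show "2 * pi * C1 * C2 > 0" using C1 C2 by simp
    fix a :: complex assume a: "norm a < 1"
    define d where "d = 1 - norm a"
    have d: "d > 0" using a by (simp add: d_def)
    define g where "g r = ennreal ((1 - r) powr t * (C1 * max d (1 - r) powr (1 - N)))" for r
    have [measurable]: "g \<in> borel_measurable borel" unfolding g_def by measurable
    let ?G = "\<lambda>z. indicator (ball 0 1) z * ennreal ((1 - norm z) powr t * norm (1 - cnj a * z) powr - N)"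
    have [measurable]: "ball (0::complex) 1 \<in> sets borel" by simp
    have "continuous_on UNIV (\<lambda>z::complex. 1 - cnj a * z)" by (intro continuous_intros)
    then have [measurable]: "(\<lambda>z::complex. 1 - cnj a * z) \<in> borel_measurable borel" by (rule borel_measurable_continuous_onI)
    have [measurable]: "?G \<in> borel_measurable borel" by measurable
    have "(\<integral>\<^sup>+z. ?G z \<partial>lborel)
      = (\<integral>\<^sup>+z. (\<integral>\<^sup>+s. ?G (cis (2 * pi * s) * z) * indicator {0..1::real} s \<partial>lborel) \<partial>lborel)"
      by (rule nn_integral_average_rotation) measurable
    also have "\<dots> \<le> (\<integral>\<^sup>+z. indicator (ball (0::complex) 1) z * g (norm z) \<partial>lborel)"
    proof (rule nn_integral_mono)
      fix z :: complex
      show "(\<integral>\<^sup>+s. ?G (cis (2 * pi * s) * z) * indicator {0..1::real} s \<partial>lborel)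
          \<le> indicator (ball 0 1) z * g (norm z)"
      proof (cases "norm z < 1")
        case True
        have az: "norm (cnj a * z) < 1" using a True mult_less_le_imp_less[of "norm a" 1 "norm z" 1]
          by (cases "z = 0") (auto simp: norm_mult)
        have "(\<integral>\<^sup>+s. ?G (cis (2 * pi * s) * z) * indicator {0..1::real} s \<partial>lborel)
          = (\<integral>\<^sup>+s. ennreal ((1 - norm z) powr t) *
               (ennreal (norm (1 - (cnj a * z) * cis (2 * pi * s)) powr - N) * indicator {0..1::real} s) \<partial>lborel)"
          using True by (intro nn_integral_cong)
            (auto simp: norm_mult ennreal_mult mult_ac)
        also have "\<dots> = ennreal ((1 - norm z) powr t) *
            (\<integral>\<^sup>+s. ennreal (norm (1 - (cnj a * z) * cis (2 * pi * s)) powr - N) * indicator {0..1::real} s \<partial>lborel)"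
        proof (rule nn_integral_cmult)
          have "(\<lambda>s::real. cis (2 * pi * s)) \<in> borel_measurable borel"
            by (intro borel_measurable_continuous_onI continuous_intros)
          note [measurable] = this
          show "(\<lambda>s. ennreal (norm (1 - (cnj a * z) * cis (2 * pi * s)) powr - N) * indicator {0..1::real} s)
              \<in> borel_measurable lborel" by measurable
        qed
        also have "\<dots> \<le> ennreal ((1 - norm z) powr t) * ennreal (C1 * (1 - norm (cnj a * z)) powr (1 - N))"
          unfolding C1_def using az t N by (intro mult_left_mono nn_integral_circle_kernel_le) auto
        also have "\<dots> \<le> ennreal ((1 - norm z) powr t) * ennreal (C1 * max d (1 - norm z) powr (1 - N))"
        proof (intro mult_left_mono ennreal_leI powr_mono2')
          have "norm a * norm z \<le> 1 * norm z" "norm a * norm z \<le> norm a * 1"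
            using a True by (intro mult_right_mono mult_left_mono; simp)+
          then show "max d (1 - norm z) \<le> 1 - norm (cnj a * z)" by (auto simp: d_def norm_mult)
        qed (use C1 d t N in auto)
        also have "\<dots> = g (norm z)" unfolding g_def by (simp add: ennreal_mult')
        finally show ?thesis using True by simp
      qed (simp add: norm_mult)
    qed
    also have "\<dots> = (\<integral>\<^sup>+r. ennreal (2 * pi * r) * indicator {0..1} r * g r \<partial>lborel)"
      by (rule nn_integral_radial) measurable
    also have "\<dots> = (\<integral>\<^sup>+x. ennreal (2 * pi * (1 + - 1 * x)) * indicator {0..1} (1 + - 1 * x) * g (1 + - 1 * x) \<partial>lborel)"
      using nn_integral_real_affine[of "\<lambda>r. ennreal (2 * pi * r) * indicator {0..1} r * g r" "-1" 1] by simp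
    also have "\<dots> \<le> (\<integral>\<^sup>+x. ennreal (2 * pi * C1) * (ennreal (x powr t * (max d x) powr - (N - 1)) * indicator {0..} x) \<partial>lborel)"
    proof (rule nn_integral_mono)
      fix x :: real
      show "ennreal (2 * pi * (1 + - 1 * x)) * indicator {0..1} (1 + - 1 * x) * g (1 + - 1 * x)
        \<le> ennreal (2 * pi * C1) * (ennreal (x powr t * (max d x) powr - (N - 1)) * indicator {0..} x)"
      proof (cases "x \<in> {0..1}")
        case True
        have "2 * pi * (1 - x) * (x powr t * (C1 * max d x powr (1 - N)))
           \<le> 2 * pi * 1 * (x powr t * (C1 * max d x powr (1 - N)))"
          using True C1 by (intro mult_right_mono mult_left_mono) auto
        then show ?thesis using True C1 unfolding g_def
          by (auto simp: ennreal_mult[symmetric] mult_ac intro!: ennreal_leI)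
      qed (auto simp: indicator_def)
    qed
    also have "\<dots> = ennreal (2 * pi * C1) * (\<integral>\<^sup>+x. ennreal (x powr t * (max d x) powr - (N - 1)) * indicator {0..} x \<partial>lborel)"
      by (rule nn_integral_cmult) measurable
    also have "\<dots> \<le> ennreal (2 * pi * C1) * ennreal (C2 * d powr (t + 1 - (N - 1)))"
      unfolding C2_def using t N d by (intro mult_left_mono nn_integral_powr_max_le) auto
    also have "\<dots> = ennreal (2 * pi * C1 * C2 * (1 - norm a) powr (2 + t - N))"
      using C1 C2 by (simp add: ennreal_mult[symmetric] d_def algebra_simps)
    finally show "(\<integral>\<^sup>+z. ?G z \<partial>lborel) \<le> ennreal (2 * pi * C1 * C2 * (1 - norm a) powr (2 + t - N))" .
  qed
qed

lemma borel_measurable_indicator_continuous: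
  fixes g :: "complex \<Rightarrow> real"
  assumes "continuous_on S g" "A \<in> sets borel" "S \<in> sets borel" "A \<subseteq> S"
  shows "(\<lambda>z. indicator A z * ennreal (g z)) \<in> borel_measurable borel"
proof -
  have "(\<lambda>z. indicator A z *\<^sub>R g z) \<in> borel_measurable borel"
    using assms by (intro borel_measurable_continuous_on_indicator continuous_on_subset[OF assms(1)]) auto
  then have "(\<lambda>z. ennreal (indicator A z *\<^sub>R g z)) \<in> borel_measurable borel" by measurable
  also have "(\<lambda>z. ennreal (indicator A z *\<^sub>R g z)) = (\<lambda>z. indicator A z * ennreal (g z))"
    by (auto simp: indicator_def)
  finally show ?thesis .
qed

lemma borel_measurable_holomorphic_powr:
  fixes f :: "complex \<Rightarrow> complex"
  assumes "f holomorphic_on S" "open S" "A \<in> sets borel" "A \<subseteq> S" "p > 0"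
  shows "(\<lambda>z. indicator A z * ennreal (norm (f z) powr p)) \<in> borel_measurable borel"
proof (rule borel_measurable_indicator_continuous)
  show "continuous_on S (\<lambda>z. norm (f z) powr p)"
    by (rule continuous_on_powr')
      (use assms in \<open>auto intro!: continuous_on_norm holomorphic_on_imp_continuous_on\<close>)
qed (use assms in auto)

text \<open>By Cauchy's formula on the unit circle, for each fixed \<open>z\<close> the mean of f (w
  + u z) over unimodular u is f w. Integrating this over the ball and undoing the rotation average
  gives the area version.\<close>

lemma area_mean_value:
  fixes f :: "complex \<Rightarrow> complex"
  assumes f: "f holomorphic_on ball w R" and R: "R > 0"
  shows "ennreal (pi * R\<^sup>2 * norm (f w)) \<le> (\<integral>\<^sup>+z. indicator (ball w R) z * ennreal (norm (f z)) \<partial>lborel)"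
proof -
  define G where "G z = indicator (ball 0 R) z * ennreal (norm (f (w + z)))" for z
  have cont: "continuous_on (ball 0 R) (\<lambda>z. norm (f (w + z)))"
    by (intro continuous_intros continuous_on_compose2[OF holomorphic_on_imp_continuous_on[OF f]]) auto
  have [measurable]: "G \<in> borel_measurable borel"
    unfolding G_def by (rule borel_measurable_indicator_continuous[OF cont]) auto
  have inner: "indicator (ball 0 R) z * ennreal (norm (f w))
      \<le> (\<integral>\<^sup>+t. G (cis (2 * pi * t) * z) * indicator {0..1::real} t \<partial>lborel)" for z
  proof (cases "z \<in> ball 0 R")
    case True
    define h where "h u = f (w + z * u)" for u
    have h: "h holomorphic_on {u. w + z * u \<in> ball w R}"
      unfolding h_def by (intro holomorphic_on_compose_gen[OF _ f, unfolded o_def] holomorphic_intros) auto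
    have sub: "cball 0 1 \<subseteq> {u. w + z * u \<in> ball w R}"
    proof
      fix u :: complex assume "u \<in> cball 0 1"
      then have "norm z * norm u \<le> norm z * 1" by (intro mult_left_mono) auto
      then show "u \<in> {u. w + z * u \<in> ball w R}" using True by (simp add: dist_norm norm_mult)
    qed
    have cis_eq: "exp (2 * of_real pi * \<i> * of_real t) = cis (2 * pi * t)" for t
      by (simp add: cis_conv_exp mult_ac)
    have "((\<lambda>u. h u / (u - 0)) has_contour_integral (2 * of_real pi * \<i> * h 0)) (circlepath 0 1)"
      by (rule Cauchy_integral_circlepath_simple[of h 0 1 0])
        (auto intro: holomorphic_on_subset[OF h sub])
    then have "((\<lambda>t. h (circlepath 0 1 t) / circlepath 0 1 t * vector_derivative (circlepath 0 1) (at t within {0..1}))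
        has_integral (2 * of_real pi * \<i> * h 0)) {0..1}"
      by (simp add: has_contour_integral_def)
    then have "((\<lambda>t. 2 * of_real pi * \<i> * h (cis (2 * pi * t))) has_integral (2 * of_real pi * \<i> * h 0)) {0..1}"
      by (rule has_integral_eq[rotated], subst vector_derivative_circlepath01) (auto simp: circlepath cis_eq)
    then have "((\<lambda>t. (1 / (2 * of_real pi * \<i>)) * (2 * of_real pi * \<i> * h (cis (2 * pi * t)))) has_integral
        ((1 / (2 * of_real pi * \<i>)) * (2 * of_real pi * \<i> * h 0))) {0..1}"
      by (rule has_integral_mult_right)
    then have hi: "((\<lambda>t. h (cis (2 * pi * t))) has_integral h 0) {0..1}" by simp
    have hc: "continuous_on {0..1} (\<lambda>t. h (cis (2 * pi * t)))"
      by (intro continuous_on_compose2[OF holomorphic_on_imp_continuous_on[OF holomorphic_on_subset[OF h sub]]] continuous_intros) auto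
    have ni: "((\<lambda>t. norm (h (cis (2 * pi * t)))) has_integral integral {0..1} (\<lambda>t. norm (h (cis (2 * pi * t))))) {0..1}"
      by (intro integrable_integral integrable_continuous_real continuous_intros hc)
    have "norm (h 0) \<le> integral {0..1} (\<lambda>t. norm (h (cis (2 * pi * t))))"
      using integral_norm_bound_integral[OF has_integral_integrable[OF hi] has_integral_integrable[OF ni]]
      by (simp add: integral_unique[OF hi])
    then have "ennreal (norm (h 0)) \<le> ennreal (integral {0..1} (\<lambda>t. norm (h (cis (2 * pi * t)))))"
      by (rule ennreal_leI)
    also have "\<dots> = (\<integral>\<^sup>+t. ennreal (norm (h (cis (2 * pi * t)))) * indicator {0..1} t \<partial>lborel)"
      using nn_integral_has_integral_lebesgue'[OF _ ni] by simp
    also have "\<dots> = (\<integral>\<^sup>+t. G (cis (2 * pi * t) * z) * indicator {0..1::real} t \<partial>lborel)"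
      using True by (intro nn_integral_cong) (simp add: G_def h_def norm_mult mult.commute)
    finally show ?thesis using True by (simp add: h_def)
  qed simp
  have "ennreal (pi * R\<^sup>2 * norm (f w)) = (\<integral>\<^sup>+z. ennreal (norm (f w)) * indicator (ball (0::complex) R) z \<partial>lborel)"
    using R by (subst nn_integral_cmult_indicator) (auto simp: emeasure_ball_complex ennreal_mult[symmetric] mult.commute)
  also have "\<dots> \<le> (\<integral>\<^sup>+z. (\<integral>\<^sup>+t. G (cis (2 * pi * t) * z) * indicator {0..1::real} t \<partial>lborel) \<partial>lborel)"
    by (intro nn_integral_mono) (use inner in \<open>simp add: mult.commute\<close>)
  also have "\<dots> = (\<integral>\<^sup>+z. G z \<partial>lborel)" by (rule nn_integral_average_rotation[symmetric]) measurable
  also have "\<dots> = (\<integral>\<^sup>+z. indicator (ball w R) z * ennreal (norm (f z)) \<partial>lborel)"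
  proof -
    have "(\<lambda>z. indicator (ball w R) z * ennreal (norm (f z))) \<in> borel_measurable borel"
      by (rule borel_measurable_indicator_continuous[of "ball w R"])
        (auto intro!: continuous_intros holomorphic_on_imp_continuous_on[OF f])
    note [measurable] = this
    have "(\<integral>\<^sup>+z. indicator (ball w R) z * ennreal (norm (f z)) \<partial>lborel)
      = (\<integral>\<^sup>+z. indicator (ball w R) z * ennreal (norm (f z)) \<partial>distr lborel borel ((+) w))"
      by (simp only: lborel_distr_plus)
    also have "\<dots> = (\<integral>\<^sup>+z. G z \<partial>lborel)"
      by (subst nn_integral_distr, simp, measurable)
        (auto simp: G_def dist_norm indicator_def intro!: nn_integral_cong)
    finally show ?thesis ..
  qed
  finally show ?thesis .
qed

text \<open>For \<open>p < 1\<close> maximise \<open>(R / 2 - dist w z) powr (2 / p) * norm (f z)\<close> over the ball of radius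
  \<open>R / 2\<close> and apply the area mean value inequality around the maximum point.\<close>

lemma sub_mean_value_le_1:
  fixes f :: "complex \<Rightarrow> complex"
  assumes f: "f holomorphic_on ball w R" and R: "R > 0" and p: "0 < p" "p \<le> 1"
  shows "ennreal (R\<^sup>2 * norm (f w) powr p)
    \<le> ennreal (4 * 2 powr (2 / p)) * powr_integral (ball w R) p f"
    (is "_ \<le> _ * ?J")
proof (cases "f w = 0")
  case False
  define H where "H z = (R / 2 - dist w z) powr (2 / p) * norm (f z)" for z
  have "compact (cball w (R / 2))" "cball w (R / 2) \<noteq> {}" using R by auto
  moreover have "continuous_on (cball w (R / 2)) H"
    unfolding H_def using p R
    by (intro continuous_intros continuous_on_powr' holomorphic_on_imp_continuous_on[OF holomorphic_on_subset[OF f]]) auto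
  ultimately obtain z0 where z0: "z0 \<in> cball w (R / 2)" "\<And>z. z \<in> cball w (R / 2) \<Longrightarrow> H z \<le> H z0"
    using continuous_attains_sup[of "cball w (R / 2)" H] by blast
  define S where "S = H z0"
  have "H w > 0" using False R by (simp add: H_def)
  then have S: "S > 0" using z0(2)[of w] R by (simp add: S_def)
  \<comment> \<open>Half of the distance from the maximum point to the boundary of the half ball. On
    \<open>ball z0 d\<close> the weight is therefore still at least \<open>d powr (2 / p)\<close>,
    which bounds \<open>f\<close> there by a fixed multiple of its value at
    \<open>z0\<close>.\<close>
  define d where "d = (R / 2 - dist w z0) / 2"
  have d: "d > 0" using S z0(1) p by (cases "R / 2 - dist w z0 = 0") (auto simp: S_def H_def d_def)
  have sub: "ball z0 d \<subseteq> cball w (R / 2)" "cball w (R / 2) \<subseteq> ball w R"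
  proof -
    show "ball z0 d \<subseteq> cball w (R / 2)"
    proof
      fix z assume "z \<in> ball z0 d"
      then show "z \<in> cball w (R / 2)" using dist_triangle[of w z z0] d by (simp add: d_def)
    qed
  qed (use R in auto)
  have bd: "norm (f z) \<le> S * d powr - (2 / p)" if "z \<in> ball z0 d" for z
  proof -
    have "d \<le> R / 2 - dist w z" using that dist_triangle[of w z z0] by (simp add: d_def field_simps)
    then have "d powr (2 / p) * norm (f z) \<le> H z" unfolding H_def using d p by (intro mult_right_mono powr_mono2) auto
    also have "\<dots> \<le> S" unfolding S_def using z0(2) sub that by auto
    finally show ?thesis using d by (simp add: powr_minus field_simps)
  qed
  define B where "B = S * d powr - (2 / p)"
  have B: "B > 0" using S d by (simp add: B_def)
  have z0v: "norm (f z0) = S * (2 * d) powr - (2 / p)"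
  proof -
    have "R / 2 - dist w z0 = 2 * d" by (simp add: d_def)
    then have "S = (2 * d) powr (2 / p) * norm (f z0)" unfolding S_def H_def by simp
    then show ?thesis using d by (simp add: powr_minus)
  qed
  have "ennreal (pi * d\<^sup>2 * norm (f z0)) \<le> (\<integral>\<^sup>+z. indicator (ball z0 d) z * ennreal (norm (f z)) \<partial>lborel)"
    using sub d by (intro area_mean_value holomorphic_on_subset[OF f]) auto
  also have "\<dots> \<le> (\<integral>\<^sup>+z. ennreal (B powr (1 - p)) * (indicator (ball w R) z * ennreal (norm (f z) powr p)) \<partial>lborel)"
  proof (rule nn_integral_mono)
    fix z
    show "indicator (ball z0 d) z * ennreal (norm (f z))
        \<le> ennreal (B powr (1 - p)) * (indicator (ball w R) z * ennreal (norm (f z) powr p))"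
    proof (cases "z \<in> ball z0 d")
      case True
      \<comment> \<open>The missing power 1 - p is nonnegative and is paid for with the bound
        \<open>B\<close>; this exchanges the first power in the mean value inequality for the p-th
        power.\<close>
      have "norm (f z) = norm (f z) powr (1 - p) * norm (f z) powr p"
        by (cases "f z = 0") (auto simp: powr_add[symmetric])
      also have "\<dots> \<le> B powr (1 - p) * norm (f z) powr p"
        using bd[OF True] p by (intro mult_right_mono powr_mono2) (auto simp: B_def)
      finally have "ennreal (norm (f z)) \<le> ennreal (B powr (1 - p)) * ennreal (norm (f z) powr p)"
        by (simp add: ennreal_mult[symmetric] ennreal_leI)
      moreover have "z \<in> ball w R" using True sub by blast
      ultimately show ?thesis using True by simp
    qed simp
  qed
  also have "\<dots> = ennreal (B powr (1 - p)) * ?J"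
    using borel_measurable_holomorphic_powr[OF f, of "ball w R" p] p by (intro nn_integral_cmult) simp
  finally have main: "ennreal (pi * d\<^sup>2 * norm (f z0)) \<le> ennreal (B powr (1 - p)) * ?J" .
  \<comment> \<open>The weight exponent 2 / p was chosen for this identity: the p-th power of the
    weight has the dimension of an area and cancels the area of the small ball.\<close>
  have Bp: "B powr p * d\<^sup>2 = S powr p"
  proof -
    have "B powr p = S powr p * (d powr - (2 / p)) powr p" unfolding B_def by (rule powr_mult)
    also have "(d powr - (2 / p)) powr p = d powr (- (2 / p) * p)" by (rule powr_powr)
    also have "- (2 / p) * p = - 2" using p by simp
    also have "d powr - 2 = 1 / d\<^sup>2" using d by (simp add: powr_minus_divide)
    finally show ?thesis using d by simp
  qed
  have fz0: "norm (f z0) = B * 2 powr - (2 / p)"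
    unfolding z0v B_def using d by (simp add: powr_mult)
  have "(R / 2) powr (2 / p) * norm (f w) \<le> S" using z0(2)[of w] R by (simp add: S_def H_def)
  then have "((R / 2) powr (2 / p) * norm (f w)) powr p \<le> S powr p" using p by (intro powr_mono2) auto
  then have "(R / 2)\<^sup>2 * norm (f w) powr p \<le> B powr p * d\<^sup>2"
    using R p unfolding Bp by (simp add: powr_mult powr_powr)
  then have "R\<^sup>2 * norm (f w) powr p \<le> 4 * B powr p * d\<^sup>2" by (simp add: power_divide)
  also have "\<dots> \<le> 4 * 2 powr (2 / p) * B powr (p - 1) * (pi * d\<^sup>2 * norm (f z0))"
  proof -
    have "B powr p = B powr (p - 1) * B" using B by (simp add: powr_diff)
    moreover have "2 powr (2 / p) * 2 powr - (2 / p) = (1 :: real)" by (simp add: powr_add[symmetric])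
    ultimately have eq: "4 * 2 powr (2 / p) * B powr (p - 1) * (pi * d\<^sup>2 * norm (f z0)) = pi * (4 * B powr p * d\<^sup>2)"
      unfolding fz0 by (simp add: algebra_simps)
    have "1 * (4 * B powr p * d\<^sup>2) \<le> pi * (4 * B powr p * d\<^sup>2)"
      using pi_gt3 by (intro mult_right_mono) auto
    then show ?thesis unfolding eq by (simp only: mult_1)
  qed
  finally have "ennreal (R\<^sup>2 * norm (f w) powr p)
      \<le> ennreal (4 * 2 powr (2 / p) * B powr (p - 1) * (pi * d\<^sup>2 * norm (f z0)))" by (rule ennreal_leI)
  also have "\<dots> = ennreal (4 * 2 powr (2 / p) * B powr (p - 1)) * ennreal (pi * d\<^sup>2 * norm (f z0))"
    by (rule ennreal_mult) auto
  also have "\<dots> \<le> ennreal (4 * 2 powr (2 / p) * B powr (p - 1)) * (ennreal (B powr (1 - p)) * ?J)"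
    by (intro mult_left_mono main) auto
  also have "\<dots> = ennreal (4 * 2 powr (2 / p) * (B powr (p - 1) * B powr (1 - p))) * ?J"
    by (simp add: mult.assoc[symmetric] ennreal_mult[symmetric])
  also have "B powr (p - 1) * B powr (1 - p) = 1" using B by (simp add: powr_add[symmetric])
  finally show ?thesis by simp
qed simp

text \<open>With t = |f w| / 2 one has |f| at most t + t^(1 - p) |f|^p pointwise. The constant part
  integrates to half of the left side of the area mean value inequality and is absorbed
  there.\<close>

lemma sub_mean_value_ge_1:
  fixes f :: "complex \<Rightarrow> complex"
  assumes f: "f holomorphic_on ball w R" and R: "R > 0" and p: "1 \<le> p"
  shows "ennreal (R\<^sup>2 * norm (f w) powr p)
    \<le> ennreal (2 powr p) * powr_integral (ball w R) p f"
    (is "_ \<le> _ * ?J")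
proof (cases "f w = 0")
  case False
  define t where "t = norm (f w) / 2"
  have t: "t > 0" using False by (simp add: t_def)
  have [measurable]: "ball w R \<in> sets borel" by simp
  have [measurable]: "(\<lambda>z. indicator (ball w R) z * ennreal (norm (f z) powr p)) \<in> borel_measurable borel"
    using p by (intro borel_measurable_holomorphic_powr[OF f]) auto
  have "ennreal (pi * R\<^sup>2 * norm (f w)) \<le> (\<integral>\<^sup>+z. indicator (ball w R) z * ennreal (norm (f z)) \<partial>lborel)"
    by (rule area_mean_value[OF f R])
  also have "\<dots> \<le> (\<integral>\<^sup>+z. ennreal t * indicator (ball w R) z
      + ennreal (t powr (1 - p)) * (indicator (ball w R) z * ennreal (norm (f z) powr p)) \<partial>lborel)"
  proof (rule nn_integral_mono)
    fix z
    have "norm (f z) \<le> t + t powr (1 - p) * norm (f z) powr p"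
    proof (cases "norm (f z) \<le> t")
      case True
      then show ?thesis by (intro order_trans[OF True]) simp
    next
      case False
      then have "1 * 1 \<le> (norm (f z) / t) powr (p - 1)" using t p by (simp add: ge_one_powr_ge_zero)
      also have "\<dots> = norm (f z) powr (p - 1) * t powr (1 - p)"
        using t by (simp add: powr_divide powr_diff)
      finally have "norm (f z) * 1 \<le> norm (f z) * (norm (f z) powr (p - 1) * t powr (1 - p))"
        by (intro mult_left_mono) auto
      also have "\<dots> = t powr (1 - p) * norm (f z) powr p" using False t by (simp add: powr_diff)
      finally show ?thesis using t by simp
    qed
    then have "ennreal (norm (f z)) \<le> ennreal t + ennreal (t powr (1 - p)) * ennreal (norm (f z) powr p)"
      using t by (simp add: ennreal_mult[symmetric] ennreal_plus[symmetric] ennreal_leI del: ennreal_plus)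
    then show "indicator (ball w R) z * ennreal (norm (f z)) \<le> ennreal t * indicator (ball w R) z
      + ennreal (t powr (1 - p)) * (indicator (ball w R) z * ennreal (norm (f z) powr p))"
      by (auto simp: indicator_def)
  qed
  also have "\<dots> = ennreal (pi * R\<^sup>2 * t) + ennreal (t powr (1 - p)) * ?J"
    using R t by (subst nn_integral_add, measurable)
      (auto simp: nn_integral_cmult nn_integral_cmult_indicator emeasure_ball_complex ennreal_mult[symmetric] mult.commute)
  finally have "ennreal (pi * R\<^sup>2 * t) + ennreal (pi * R\<^sup>2 * t) \<le> ennreal (pi * R\<^sup>2 * t) + ennreal (t powr (1 - p)) * ?J"
    using t by (simp add: ennreal_plus[symmetric] t_def field_simps del: ennreal_plus)
  then have main: "ennreal (pi * R\<^sup>2 * t) \<le> ennreal (t powr (1 - p)) * ?J" by (simp add: ennreal_add_left_cancel_le)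
  have "R\<^sup>2 * norm (f w) powr p = 2 powr p * (R\<^sup>2 * t powr p)" unfolding t_def by (simp add: powr_divide)
  also have "\<dots> = 2 powr p * t powr (p - 1) * (R\<^sup>2 * t)" using t by (simp add: powr_diff)
  also have "\<dots> \<le> 2 powr p * t powr (p - 1) * (pi * R\<^sup>2 * t)"
  proof -
    have "1 * (R\<^sup>2 * t) \<le> pi * (R\<^sup>2 * t)" using pi_gt3 t by (intro mult_right_mono) auto
    then show ?thesis by (intro mult_left_mono) (auto simp: mult.assoc)
  qed
  finally have "ennreal (R\<^sup>2 * norm (f w) powr p) \<le> ennreal (2 powr p * t powr (p - 1)) * ennreal (pi * R\<^sup>2 * t)"
    using t by (simp add: ennreal_mult[symmetric] ennreal_leI)
  also have "\<dots> \<le> ennreal (2 powr p * t powr (p - 1)) * (ennreal (t powr (1 - p)) * ?J)"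
    by (intro mult_left_mono main) auto
  also have "\<dots> = ennreal (2 powr p * (t powr (p - 1) * t powr (1 - p))) * ?J"
    by (simp add: mult.assoc[symmetric] ennreal_mult[symmetric])
  also have "t powr (p - 1) * t powr (1 - p) = 1" using t by (simp add: powr_add[symmetric])
  finally show ?thesis by simp
qed simp

section \<open>Separated sets\<close>

text \<open>Balls of radius R / 2 about points of the circle of radius R / 2 stay inside
  \<open>ball w R\<close>, so the sub-mean value inequality bounds \<open>f\<close> on that circle
  and Cauchy's inequality passes to the derivative. The power \<open>R ^ k\<close> makes the
  estimate invariant under scaling.\<close>

lemma deriv_sub_mean_value:
  fixes p :: real
  assumes p: "p > 0"
  shows "\<exists>C>0. \<forall>f w R. f holomorphic_on ball w R \<longrightarrow> R > 0 \<longrightarrow>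
    ennreal (R\<^sup>2 * (R ^ k * norm ((deriv ^^ k) f w)) powr p)
      \<le> ennreal C * powr_integral (ball w R) p f"
proof -
  obtain C0 where C0: "C0 > 0" and smv: "\<And>f w R. f holomorphic_on ball w R \<Longrightarrow> R > 0 \<Longrightarrow>
    ennreal (R\<^sup>2 * norm (f w) powr p)
      \<le> ennreal C0 * powr_integral (ball w R) p f"
  proof (cases "p \<le> 1")
    case True
    show ?thesis by (rule that[of "4 * 2 powr (2 / p)"]) (use True p sub_mean_value_le_1 in auto)
  next
    case False
    show ?thesis by (rule that[of "2 powr p"]) (use False p sub_mean_value_ge_1 in auto)
  qed
  define K where "K = (fact k * 2 ^ k :: real)"
  have K: "K > 0" by (simp add: K_def)
  show ?thesis
  proof (intro exI[of _ "4 * C0 * K powr p"] conjI allI impI)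
    show "4 * C0 * K powr p > 0" using C0 K by simp
    fix f w and R :: real assume f: "f holomorphic_on ball w R" and R: "R > 0"
    let ?J = "powr_integral (ball w R) p f"
    show "ennreal (R\<^sup>2 * (R ^ k * norm ((deriv ^^ k) f w)) powr p) \<le> ennreal (4 * C0 * K powr p) * ?J"
    proof (cases ?J)
      case (real j)
      \<comment> \<open>The bound for |f| obtained by solving the sub-mean value inequality of
        radius R / 2, where the square of R / 2 produces the factor 4.\<close>
      define B where "B = (4 * C0 * j / R\<^sup>2) powr (1 / p)"
      have bd: "norm (f \<zeta>) \<le> B" if "\<zeta> \<in> cball w (R / 2)" for \<zeta>
      proof -
        have sub: "ball \<zeta> (R / 2) \<subseteq> ball w R"
        proof
          fix z assume "z \<in> ball \<zeta> (R / 2)"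
          then show "z \<in> ball w R" using that dist_triangle[of w z \<zeta>] by simp
        qed
        have "ennreal ((R / 2)\<^sup>2 * norm (f \<zeta>) powr p)
          \<le> ennreal C0 * powr_integral (ball \<zeta> (R / 2)) p f"
          using R by (intro smv holomorphic_on_subset[OF f sub]) auto
        also have "\<dots> \<le> ennreal C0 * ?J"
          using sub by (intro mult_left_mono nn_integral_mono) (auto simp: indicator_def)
        also have "\<dots> = ennreal (C0 * j)" using real C0 by (simp add: ennreal_mult)
        finally have "(R / 2)\<^sup>2 * norm (f \<zeta>) powr p \<le> C0 * j" using real C0 by simp
        then have "norm (f \<zeta>) powr p \<le> 4 * C0 * j / R\<^sup>2" using R by (simp add: power_divide field_simps)
        then have "(norm (f \<zeta>) powr p) powr (1 / p) \<le> B" unfolding B_def using p by (intro powr_mono2) auto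
        then show ?thesis using p by (simp add: powr_powr)
      qed
      have "norm ((deriv ^^ k) f w) \<le> fact k * B / (R / 2) ^ k"
      proof (rule Cauchy_inequality)
        show "f holomorphic_on ball w (R / 2)" using R by (intro holomorphic_on_subset[OF f]) auto
        show "continuous_on (cball w (R / 2)) f"
          using R by (intro holomorphic_on_imp_continuous_on holomorphic_on_subset[OF f]) auto
        show "norm (f x) \<le> B" if "norm (w - x) = R / 2" for x using that by (intro bd) (simp add: dist_norm)
      qed (use R in simp)
      then have "R ^ k * norm ((deriv ^^ k) f w) \<le> K * B"
        using R by (simp add: K_def power_divide field_simps)
      then have "(R ^ k * norm ((deriv ^^ k) f w)) powr p \<le> (K * B) powr p"
        using R p by (intro powr_mono2) auto
      also have "\<dots> = K powr p * (4 * C0 * j / R\<^sup>2)"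
        using K p C0 real by (simp add: B_def powr_mult powr_powr)
      finally have "R\<^sup>2 * (R ^ k * norm ((deriv ^^ k) f w)) powr p \<le> 4 * C0 * K powr p * j"
        using R by (simp add: field_simps)
      then show ?thesis using real C0 by (simp add: ennreal_mult[symmetric] ennreal_leI)
    next
      case top
      then show ?thesis using C0 K by (simp add: ennreal_mult_top)
    qed
  qed
qed

text \<open>Distances are measured relative to the distance to the unit circle, as in the hyperbolic
  metric. The factor 1/4 makes the balls of radius (1 - |a|) / 8 disjoint and still allows a
  covering by balls of radius (1 - |a|) / 3. Finiteness keeps every sum of atoms finite and the
  family of subsets finite.\<close>

definition separated :: "complex set \<Rightarrow> bool" where
  "separated S \<longleftrightarrow> finite S \<and> S \<subseteq> ball 0 1 \<and>
     (\<forall>a\<in>S. \<forall>b\<in>S. a \<noteq> b \<longrightarrow> max (1 - norm a) (1 - norm b) / 4 \<le> dist a b)"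

lemma separated_finite: "separated S \<Longrightarrow> finite S"
  and separated_norm_less: "separated S \<Longrightarrow> a \<in> S \<Longrightarrow> norm a < 1"
  unfolding separated_def by auto

lemma separated_subset: "separated S \<Longrightarrow> T \<subseteq> S \<Longrightarrow> separated T"
  unfolding separated_def by (auto intro: finite_subset)

text \<open>The small balls are disjoint: half the sum of 1 - |a| and 1 - |b| is at most their
  maximum. So at each point at most one summand survives.\<close>

lemma separated_sum_integral_le:
  fixes g :: "complex \<Rightarrow> ennreal"
  assumes S: "separated S" and Y: "\<And>a. a \<in> S \<Longrightarrow> ball a ((1 - norm a) / 8) \<subseteq> Y"
    and meas: "\<And>a. a \<in> S \<Longrightarrow> (\<lambda>z. indicator (ball a ((1 - norm a) / 8)) z * g z) \<in> borel_measurable borel"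
  shows "(\<Sum>a\<in>S. \<integral>\<^sup>+z. indicator (ball a ((1 - norm a) / 8)) z * g z \<partial>lborel) \<le> (\<integral>\<^sup>+z. indicator Y z * g z \<partial>lborel)"
proof -
  have "(\<Sum>a\<in>S. \<integral>\<^sup>+z. indicator (ball a ((1 - norm a) / 8)) z * g z \<partial>lborel)
    = (\<integral>\<^sup>+z. (\<Sum>a\<in>S. indicator (ball a ((1 - norm a) / 8)) z * g z) \<partial>lborel)"
    by (rule nn_integral_sum[symmetric]) (use meas in simp)
  also have "\<dots> \<le> (\<integral>\<^sup>+z. indicator Y z * g z \<partial>lborel)"
  proof (rule nn_integral_mono)
    fix z
    show "(\<Sum>a\<in>S. indicator (ball a ((1 - norm a) / 8)) z * g z) \<le> indicator Y z * g z"
    proof (cases "\<exists>b\<in>S. z \<in> ball b ((1 - norm b) / 8)")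
      case True
      then obtain b where b: "b \<in> S" "z \<in> ball b ((1 - norm b) / 8)" by auto
      have "z \<notin> ball a ((1 - norm a) / 8)" if a: "a \<in> S" "a \<noteq> b" for a
      proof
        assume "z \<in> ball a ((1 - norm a) / 8)"
        then have "dist a b < (1 - norm a) / 8 + (1 - norm b) / 8"
          using b dist_triangle[of a b z] unfolding mem_ball dist_commute[of b z] by linarith
        moreover have "max (1 - norm a) (1 - norm b) / 4 \<le> dist a b" using S a b(1) unfolding separated_def by simp
        moreover have "max (1 - norm a) (1 - norm b) \<ge> (1 - norm a + (1 - norm b)) / 2" by (simp add: max_def field_simps)
        ultimately show False by (simp add: field_simps)
      qed
      then have "(\<Sum>a\<in>S. indicator (ball a ((1 - norm a) / 8)) z * g z)
          = (\<Sum>a\<in>{b}. indicator (ball a ((1 - norm a) / 8)) z * g z)"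
        using b separated_finite[OF S] by (intro sum.mono_neutral_right) auto
      also have "\<dots> \<le> indicator Y z * g z" using Y[OF b(1)] b by (auto simp: indicator_def)
      finally show ?thesis .
    qed simp
  qed
  finally show ?thesis .
qed

text \<open>Comparison of areas of disjoint balls; the factor 64 is the square of 8.\<close>

lemma separated_packing:
  assumes S: "separated S" and Y: "\<And>a. a \<in> S \<Longrightarrow> ball a ((1 - norm a) / 8) \<subseteq> ball w r" and r: "r \<ge> 0"
  shows "(\<Sum>a\<in>S. (1 - norm a)\<^sup>2) \<le> 64 * r\<^sup>2"
proof -
  have "(\<Sum>a\<in>S. \<integral>\<^sup>+z. indicator (ball a ((1 - norm a) / 8)) z * 1 \<partial>lborel) \<le> (\<integral>\<^sup>+z. indicator (ball w r) z * 1 \<partial>lborel)"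
    using S Y by (rule separated_sum_integral_le) (auto intro: borel_measurable_indicator)
  moreover have "(\<integral>\<^sup>+z. indicator (ball a ((1 - norm a) / 8)) z * 1 \<partial>lborel) = ennreal (pi * ((1 - norm a) / 8)\<^sup>2)"
    if "a \<in> S" for a
    using separated_norm_less[OF S that] by (simp add: emeasure_ball_complex)
  ultimately have "(\<Sum>a\<in>S. ennreal (pi * ((1 - norm a) / 8)\<^sup>2)) \<le> ennreal (pi * r\<^sup>2)"
    using r by (simp add: emeasure_ball_complex)
  then have "(\<Sum>a\<in>S. pi * ((1 - norm a) / 8)\<^sup>2) \<le> pi * r\<^sup>2"
    by (simp add: sum_ennreal)
  then show ?thesis
    by (simp add: power_divide sum_distrib_left[symmetric] sum_divide_distrib[symmetric])
qed

lemma separated_sum_square_le: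
  assumes "separated S"
  shows "(\<Sum>a\<in>S. (1 - norm a)\<^sup>2) \<le> 64"
proof -
  have "ball a ((1 - norm a) / 8) \<subseteq> ball 0 1" if "a \<in> S" for a
  proof
    fix z assume "z \<in> ball a ((1 - norm a) / 8)"
    then show "z \<in> ball 0 1" using separated_norm_less[OF assms that] norm_triangle_sub[of z a]
      by (simp add: dist_norm norm_minus_commute)
  qed
  from separated_packing[OF assms this] show ?thesis by simp
qed

text \<open>With d = 1 - |w|, every such \<open>a\<close> has 1 - |a| between 2 d / 3 and 2 d, so
  its small ball lies in the ball of radius 5 d / 4 about \<open>w\<close>. Packing gives
  cardinality times 4/9 at most 100, that is 225.\<close>

lemma separated_overlap:
  assumes S: "separated S"
  shows "card {a \<in> S. w \<in> ball a ((1 - norm a) / 2)} \<le> 225"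
proof (cases "{a \<in> S. w \<in> ball a ((1 - norm a) / 2)} = {}")
  case False
  define X where "X = {a \<in> S. w \<in> ball a ((1 - norm a) / 2)}"
  define d where "d = 1 - norm w"
  have X: "separated X" using S unfolding X_def by (rule separated_subset) auto
  have comp: "2 / 3 * d \<le> 1 - norm a" "1 - norm a \<le> 2 * d" "norm a < 1" if "a \<in> X" for a
  proof -
    have "\<bar>norm w - norm a\<bar> \<le> dist a w" by (simp add: dist_norm norm_minus_commute[of a w] norm_triangle_ineq3)
    moreover have "dist a w < (1 - norm a) / 2" using that by (simp add: X_def)
    ultimately show "2 / 3 * d \<le> 1 - norm a" "1 - norm a \<le> 2 * d" by (auto simp: d_def abs_le_iff)
    show "norm a < 1" by (rule separated_norm_less[OF X that])
  qed
  obtain a0 where "a0 \<in> X" using False by (auto simp: X_def)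
  then have d: "d > 0" using comp[of a0] by auto
  have "ball a ((1 - norm a) / 8) \<subseteq> ball w (5 / 4 * d)" if "a \<in> X" for a
  proof
    fix z assume "z \<in> ball a ((1 - norm a) / 8)"
    moreover have "dist a w < (1 - norm a) / 2" using that by (simp add: X_def)
    ultimately show "z \<in> ball w (5 / 4 * d)"
      using dist_triangle[of w z a] comp[OF that] by (simp add: dist_commute)
  qed
  then have "(\<Sum>a\<in>X. (1 - norm a)\<^sup>2) \<le> 64 * (5 / 4 * d)\<^sup>2" using d by (intro separated_packing[OF X]) auto
  moreover have "(\<Sum>a\<in>X. (2 / 3 * d)\<^sup>2) \<le> (\<Sum>a\<in>X. (1 - norm a)\<^sup>2)"
    using comp d by (intro sum_mono power_mono) auto
  ultimately have "real (card X) * (4 / 9 * d\<^sup>2) \<le> 100 * d\<^sup>2" by (simp add: power_mult_distrib power_divide)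
  then have "real (card X) * (4 / 9) \<le> 100" using d by (simp add: mult.assoc[symmetric])
  then show ?thesis by (simp add: X_def)
next
  case True
  show ?thesis unfolding True by simp
qed

lemma separated_sum_integral_half_le:
  fixes g :: "complex \<Rightarrow> ennreal"
  assumes S: "separated S"
    and meas: "\<And>a. a \<in> S \<Longrightarrow> (\<lambda>z. indicator (ball a ((1 - norm a) / 2)) z * g z) \<in> borel_measurable borel"
    and meas': "(\<lambda>z. indicator (ball 0 1) z * g z) \<in> borel_measurable borel"
  shows "(\<Sum>a\<in>S. \<integral>\<^sup>+z. indicator (ball a ((1 - norm a) / 2)) z * g z \<partial>lborel)
    \<le> 225 * (\<integral>\<^sup>+z. indicator (ball 0 1) z * g z \<partial>lborel)"
proof -
  have "(\<Sum>a\<in>S. \<integral>\<^sup>+z. indicator (ball a ((1 - norm a) / 2)) z * g z \<partial>lborel)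
    = (\<integral>\<^sup>+z. (\<Sum>a\<in>S. indicator (ball a ((1 - norm a) / 2)) z * g z) \<partial>lborel)"
    by (rule nn_integral_sum[symmetric]) (use meas in simp)
  also have "\<dots> \<le> (\<integral>\<^sup>+z. 225 * (indicator (ball 0 1) z * g z) \<partial>lborel)"
  proof (rule nn_integral_mono)
    fix z
    define X where "X = {a \<in> S. z \<in> ball a ((1 - norm a) / 2)}"
    have "(\<Sum>a\<in>S. indicator (ball a ((1 - norm a) / 2)) z * g z) = (\<Sum>a\<in>X. g z)"
      unfolding X_def using separated_finite[OF S]
      by (intro sum.mono_neutral_cong_right) (auto simp: indicator_def)
    also have "\<dots> = of_nat (card X) * g z" by simp
    also have "\<dots> \<le> 225 * (indicator (ball 0 1) z * g z)"
    proof (cases "X = {}")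
      case False
      then obtain a where a: "a \<in> S" "dist a z < (1 - norm a) / 2" by (auto simp: X_def)
      then have "norm z < 1" using separated_norm_less[OF S a(1)] norm_triangle_sub[of z a]
        by (simp add: dist_norm norm_minus_commute)
      moreover have "(of_nat (card X) :: ennreal) \<le> of_nat 225"
        using separated_overlap[OF S, of z] unfolding X_def by (simp only: of_nat_le_iff)
      ultimately show ?thesis by (auto intro: mult_right_mono)
    qed simp
    finally show "(\<Sum>a\<in>S. indicator (ball a ((1 - norm a) / 2)) z * g z) \<le> 225 * (indicator (ball 0 1) z * g z)" .
  qed
  also have "\<dots> = 225 * (\<integral>\<^sup>+z. indicator (ball 0 1) z * g z \<partial>lborel)"
    using meas' by (intro nn_integral_cmult) simp
  finally show ?thesis .
qed

text \<open>A separated set of maximal cardinality in the closed disc of radius \<rho> covers it,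
  because an uncovered point could be added. A maximum exists since 1 - |a| is at least 1 - \<rho>
  there, which bounds the cardinality through the packing inequality.\<close>

lemma separated_covering:
  assumes \<rho>: "\<rho> < 1"
  shows "\<exists>S. separated S \<and> (\<forall>w. norm w \<le> \<rho> \<longrightarrow> (\<exists>a\<in>S. dist a w \<le> (1 - norm a) / 3))"
proof -
  define P where "P S \<longleftrightarrow> separated S \<and> S \<subseteq> cball 0 \<rho>" for S
  have bound: "card S \<le> nat \<lceil>64 / (1 - \<rho>)\<^sup>2\<rceil>" if "P S" for S
  proof -
    have "(\<Sum>a\<in>S. (1 - \<rho>)\<^sup>2) \<le> (\<Sum>a\<in>S. (1 - norm a)\<^sup>2)"
      using that \<rho> by (intro sum_mono power_mono) (auto simp: P_def)
    also have "\<dots> \<le> 64" using that by (intro separated_sum_square_le) (simp add: P_def)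
    finally have "real (card S) \<le> 64 / (1 - \<rho>)\<^sup>2" using \<rho> by (simp add: field_simps)
    then show ?thesis by linarith
  qed
  have "P {}" by (simp add: P_def separated_def)
  then obtain S where S: "P S" and max: "\<And>T. P T \<Longrightarrow> card T \<le> card S"
    using ex_has_greatest_nat[of P "{}" card "Suc (nat \<lceil>64 / (1 - \<rho>)\<^sup>2\<rceil>)"] bound by (auto simp: le_imp_less_Suc)
  have "\<exists>a\<in>S. dist a w \<le> (1 - norm a) / 3" if w: "norm w \<le> \<rho>" for w
  proof (rule ccontr)
    assume neg: "\<not> (\<exists>a\<in>S. dist a w \<le> (1 - norm a) / 3)"
    \<comment> \<open>This is where 1/3 meets 1/4: if the distance exceeds (1 - |a|) / 3, then 1 -
      |w| is at most 1 - |a| plus the distance, hence below four times the distance.\<close>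
    have far: "max (1 - norm a) (1 - norm w) / 4 \<le> dist a w" if a: "a \<in> S" for a
    proof -
      have "dist a w > (1 - norm a) / 3" using neg a by (meson not_le)
      moreover have "norm a - norm w \<le> dist a w" by (simp add: dist_norm norm_triangle_ineq2)
      moreover have "norm a < 1" using S a by (auto simp: P_def separated_def)
      ultimately show ?thesis by (auto simp: max_def)
    qed
    have wS: "w \<notin> S" using neg w \<rho> by force
    have "P (insert w S)"
      using S w \<rho> far unfolding P_def separated_def
      by (auto simp: max.commute dist_commute)
    then have "card (insert w S) \<le> card S" by (rule max)
    then show False using wS S by (simp add: P_def separated_def)
  qed
  then show ?thesis using S by (auto simp: P_def)
qed

section \<open>Sums of kernels over separated sets\<close>

lemma one_minus_norm_le_kernel:
  fixes a z :: complex
  assumes "norm a \<le> 1" "norm z \<le> 1"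
  shows "1 - norm a \<le> norm (1 - cnj a * z)" "1 - norm z \<le> norm (1 - cnj a * z)"
proof -
  have "norm a * norm z \<le> norm a * 1" "norm a * norm z \<le> 1 * norm z"
    using assms by (intro mult_left_mono mult_right_mono; simp)+
  moreover have "1 - norm a * norm z \<le> norm (1 - cnj a * z)"
    using norm_triangle_ineq2[of 1 "cnj a * z"] by (simp add: norm_mult)
  ultimately show "1 - norm a \<le> norm (1 - cnj a * z)" "1 - norm z \<le> norm (1 - cnj a * z)" by linarith+
qed

lemma kernel_pos:
  fixes a z :: complex
  assumes "norm a < 1" "norm z \<le> 1"
  shows "norm (1 - cnj a * z) > 0"
  using one_minus_norm_le_kernel(1)[of a z] assms by linarith

lemma borel_measurable_kernel:
  "(\<lambda>z. indicator (ball 0 1) z * ennreal ((1 - norm z) powr t * norm (1 - cnj a * z) powr s))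
    \<in> borel_measurable borel"
proof -
  have [measurable]: "ball (0::complex) 1 \<in> sets borel" by simp
  have "continuous_on UNIV (\<lambda>z::complex. 1 - cnj a * z)" by (intro continuous_intros)
  then have [measurable]: "(\<lambda>z::complex. 1 - cnj a * z) \<in> borel_measurable borel" by (rule borel_measurable_continuous_onI)
  show ?thesis by measurable
qed

text \<open>The sum is a Riemann sum of an area integral. On the ball of radius (1 - |a|) / 8 the
  kernel base changes by a factor of at most 9/8, these balls are disjoint, and by the symmetry of
  |1 - cnj a z| in a and z the disc estimate applies with pole \<open>z\<close>.\<close>

lemma separated_kernel_sum_le:
  assumes \<delta>: "\<delta> > 0"
  shows "\<exists>C>0. \<forall>S z. separated S \<longrightarrow> norm z < 1 \<longrightarrow>
    (\<Sum>a\<in>S. (1 - norm a)\<^sup>2 * norm (1 - cnj a * z) powr - (2 + \<delta>)) \<le> C * (1 - norm z) powr - \<delta>"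
proof -
  obtain C0 where C0: "C0 > 0" "\<And>a. norm a < 1 \<Longrightarrow>
    (\<integral>\<^sup>+z. indicator (ball 0 1) z * ennreal ((1 - norm z) powr 0 * norm (1 - cnj a * z) powr - (2 + \<delta>)) \<partial>lborel)
      \<le> ennreal (C0 * (1 - norm a) powr (2 + 0 - (2 + \<delta>)))"
    using nn_integral_disc_kernel_le[of 0 "2 + \<delta>"] \<delta> by auto
  \<comment> \<open>The factor 64 / pi converts the area of a small ball into (1 - |a|)^2; the power
    of 9/8 pays for the variation of the kernel on that ball.\<close>
  define A where "A = (64 / pi) * (9 / 8) powr (2 + \<delta>)"
  have A: "A > 0" by (simp add: A_def)
  show ?thesis
  proof (intro exI[of _ "A * C0"] conjI allI impI)
    show "A * C0 > 0" using A C0 by simp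
    fix S and z :: complex assume S: "separated S" and z: "norm z < 1"
    define g where "g b = ennreal ((1 - norm b) powr 0 * norm (1 - cnj z * b) powr - (2 + \<delta>))" for b
    have sub: "ball a ((1 - norm a) / 8) \<subseteq> ball 0 1" if "a \<in> S" for a
    proof
      fix b assume "b \<in> ball a ((1 - norm a) / 8)"
      then show "b \<in> ball 0 1" using separated_norm_less[OF S that] norm_triangle_sub[of b a]
        by (simp add: dist_norm norm_minus_commute)
    qed
    have meas: "(\<lambda>b. indicator (ball a ((1 - norm a) / 8)) b * g b) \<in> borel_measurable borel" if "a \<in> S" for a
    proof -
      have "(\<lambda>b. indicator (ball a ((1 - norm a) / 8)) b * (indicator (ball 0 1) b * g b)) \<in> borel_measurable borel"
        unfolding g_def by (intro borel_measurable_times_ennreal borel_measurable_indicator borel_measurable_kernel) auto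
      also have "(\<lambda>b. indicator (ball a ((1 - norm a) / 8)) b * (indicator (ball 0 1) b * g b))
          = (\<lambda>b. indicator (ball a ((1 - norm a) / 8)) b * g b)"
        using sub[OF that] by (auto simp: indicator_def fun_eq_iff)
      finally show ?thesis .
    qed
    have "ennreal ((1 - norm a)\<^sup>2 * norm (1 - cnj a * z) powr - (2 + \<delta>))
        \<le> ennreal A * (\<integral>\<^sup>+b. indicator (ball a ((1 - norm a) / 8)) b * g b \<partial>lborel)" if a: "a \<in> S" for a
    proof -
      have na: "norm a < 1" using separated_norm_less[OF S a] .
      have pos: "norm (1 - cnj a * z) > 0" using kernel_pos[of a z] na z by simp
      define c where "c = (9 / 8 * norm (1 - cnj a * z)) powr - (2 + \<delta>)"
      have c: "c \<ge> 0" by (simp add: c_def)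
      have "ennreal ((1 - norm a)\<^sup>2 * norm (1 - cnj a * z) powr - (2 + \<delta>))
         = ennreal A * ennreal (c * (pi * ((1 - norm a) / 8)\<^sup>2))"
      proof -
        have "c = (9 / 8) powr - (2 + \<delta>) * norm (1 - cnj a * z) powr - (2 + \<delta>)"
          unfolding c_def by (rule powr_mult)
        moreover have "(9 / 8) powr (2 + \<delta>) * (9 / 8) powr - (2 + \<delta>) = (1 :: real)"
          by (simp add: powr_add[symmetric])
        ultimately have "A * (c * (pi * ((1 - norm a) / 8)\<^sup>2)) = (1 - norm a)\<^sup>2 * norm (1 - cnj a * z) powr - (2 + \<delta>)"
          unfolding A_def by (simp add: power_divide)
        then show ?thesis using A c by (simp add: ennreal_mult[symmetric])
      qed
      also have "ennreal (c * (pi * ((1 - norm a) / 8)\<^sup>2))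
          = (\<integral>\<^sup>+b. ennreal c * indicator (ball a ((1 - norm a) / 8)) b \<partial>lborel)"
        using na c by (simp add: nn_integral_cmult_indicator emeasure_ball_complex ennreal_mult)
      also have "\<dots> \<le> (\<integral>\<^sup>+b. indicator (ball a ((1 - norm a) / 8)) b * g b \<partial>lborel)"
      proof (rule nn_integral_mono)
        fix b
        show "ennreal c * indicator (ball a ((1 - norm a) / 8)) b \<le> indicator (ball a ((1 - norm a) / 8)) b * g b"
        proof (cases "b \<in> ball a ((1 - norm a) / 8)")
          case True
          have nb: "norm b < 1" using sub[OF a] True by auto
          have "norm (1 - cnj z * b) \<le> norm (1 - cnj z * a) + norm (cnj z * (a - b))"
            by (rule order_trans[OF _ norm_triangle_ineq]) (simp add: algebra_simps)
          also have "norm (1 - cnj z * a) = norm (1 - cnj a * z)"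
            by (metis complex_cnj_cnj complex_cnj_diff complex_cnj_mult complex_cnj_one complex_mod_cnj mult.commute)
          also have "norm (cnj z * (a - b)) \<le> 1 * ((1 - norm a) / 8)"
            unfolding norm_mult using True z by (intro mult_mono) (auto simp: dist_norm)
          also have "\<dots> \<le> 1 / 8 * norm (1 - cnj a * z)" using one_minus_norm_le_kernel(1)[of a z] na z by simp
          finally have "norm (1 - cnj z * b) \<le> 9 / 8 * norm (1 - cnj a * z)" by simp
          moreover have "norm (1 - cnj z * b) > 0" using kernel_pos[of z b] nb z by simp
          ultimately have "c \<le> norm (1 - cnj z * b) powr - (2 + \<delta>)"
            unfolding c_def using \<delta> by (intro powr_mono2') auto
          then show ?thesis using True nb by (simp add: g_def ennreal_leI)
        qed simp
      qed
      finally show ?thesis by (simp add: mult_left_mono)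
    qed
    then have "(\<Sum>a\<in>S. ennreal ((1 - norm a)\<^sup>2 * norm (1 - cnj a * z) powr - (2 + \<delta>)))
       \<le> (\<Sum>a\<in>S. ennreal A * (\<integral>\<^sup>+b. indicator (ball a ((1 - norm a) / 8)) b * g b \<partial>lborel))"
      by (rule sum_mono)
    also have "\<dots> = ennreal A * (\<Sum>a\<in>S. \<integral>\<^sup>+b. indicator (ball a ((1 - norm a) / 8)) b * g b \<partial>lborel)"
      by (simp add: sum_distrib_left)
    also have "\<dots> \<le> ennreal A * (\<integral>\<^sup>+b. indicator (ball 0 1) b * g b \<partial>lborel)"
      using S sub meas by (intro mult_left_mono separated_sum_integral_le) auto
    also have "\<dots> \<le> ennreal A * ennreal (C0 * (1 - norm z) powr (2 + 0 - (2 + \<delta>)))"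
      unfolding g_def by (intro mult_left_mono C0 z) auto
    also have "\<dots> = ennreal (A * C0 * (1 - norm z) powr - \<delta>)"
      using A C0 by (simp add: ennreal_mult[symmetric] mult.assoc)
    finally have "ennreal (\<Sum>a\<in>S. (1 - norm a)\<^sup>2 * norm (1 - cnj a * z) powr - (2 + \<delta>))
        \<le> ennreal (A * C0 * (1 - norm z) powr - \<delta>)"
      by (simp add: sum_ennreal)
    then show "(\<Sum>a\<in>S. (1 - norm a)\<^sup>2 * norm (1 - cnj a * z) powr - (2 + \<delta>)) \<le> A * C0 * (1 - norm z) powr - \<delta>"
      using A C0 by (subst (asm) ennreal_le_iff) auto
  qed
qed

text \<open>For \<open>p > 1\<close> the sum of the kernels is only logarithmically bounded, so the power mean
  is taken with the weights \<open>(1 - |a|)\<^sup>-\<^sup>\<delta>\<close>, \<open>\<delta> = 1 / (2 (p - 1))\<close>, as in Schur's test.\<close>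

lemma atoms_norm_le:
  fixes p :: real and N :: nat
  assumes p: "p > 0" and N: "N * p > 2" "N \<ge> 2" "p > 1 \<Longrightarrow> N \<ge> 2 + 1 / (2 * (p - 1))"
  shows "\<exists>C>0. \<forall>S c. separated S \<longrightarrow> (\<forall>a\<in>S. 0 \<le> c a) \<longrightarrow>
    (\<integral>\<^sup>+z. indicator (ball 0 1) z * ennreal ((\<Sum>a\<in>S. c a * ((1 - norm a) / norm (1 - cnj a * z)) ^ N) powr p) \<partial>lborel)
      \<le> ennreal (C * (\<Sum>a\<in>S. c a powr p * (1 - norm a)\<^sup>2))"
proof -
  \<comment> \<open>Chosen so that both cases end in the same disc integral. For p at most 1
    subadditivity turns the exponent N into N p without a further weight. For p > 1 Schur's weights
    leave (1 - |z|)^(-1/2), which is integrable, and the kernel keeps the exponent N.\<close>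
  define t M where "t = (if p \<le> 1 then 0 else - 1 / 2 :: real)" and "M = (if p \<le> 1 then N * p else real N)"
  have tM: "t > - 1" "M > 2 + t" using N p by (auto simp: t_def M_def)
  obtain C0 where C0: "C0 > 0" "\<And>a. norm a < 1 \<Longrightarrow>
    (\<integral>\<^sup>+z. indicator (ball 0 1) z * ennreal ((1 - norm z) powr t * norm (1 - cnj a * z) powr - M) \<partial>lborel)
      \<le> ennreal (C0 * (1 - norm a) powr (2 + t - M))"
    using nn_integral_disc_kernel_le[OF tM] by auto
  have "\<exists>C1>0. \<forall>S c z. separated S \<longrightarrow> (\<forall>a\<in>S. 0 \<le> c a) \<longrightarrow> norm z < 1 \<longrightarrow>
    (\<Sum>a\<in>S. c a * ((1 - norm a) / norm (1 - cnj a * z)) ^ N) powr p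
      \<le> C1 * (\<Sum>a\<in>S. c a powr p * (1 - norm a) powr (M - t) * ((1 - norm z) powr t * norm (1 - cnj a * z) powr - M))"
  proof (cases "p \<le> 1")
    case True
    have "(\<Sum>a\<in>S. c a * ((1 - norm a) / norm (1 - cnj a * z)) ^ N) powr p
      \<le> 1 * (\<Sum>a\<in>S. c a powr p * (1 - norm a) powr (M - t) * ((1 - norm z) powr t * norm (1 - cnj a * z) powr - M))"
      if S: "separated S" and c: "\<forall>a\<in>S. 0 \<le> c a" and z: "norm z < 1" for S c z
    proof -
      have "(\<Sum>a\<in>S. c a * ((1 - norm a) / norm (1 - cnj a * z)) ^ N) powr p
        \<le> (\<Sum>a\<in>S. (c a * ((1 - norm a) / norm (1 - cnj a * z)) ^ N) powr p)"
        using separated_finite[OF S] separated_norm_less[OF S] c p True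
        by (intro powr_sum_le_sum_powr) (auto intro!: mult_nonneg_nonneg simp: less_imp_le)
      also have "\<dots> = (\<Sum>a\<in>S. c a powr p * (1 - norm a) powr (M - t) * ((1 - norm z) powr t * norm (1 - cnj a * z) powr - M))"
      proof (rule sum.cong)
        fix a assume a: "a \<in> S"
        have na: "norm a < 1" using separated_norm_less[OF S a] .
        have pos: "norm (1 - cnj a * z) > 0" using kernel_pos[of a z] na z by simp
        have q: "(1 - norm a) / norm (1 - cnj a * z) > 0" using na pos by simp
        have "(c a * ((1 - norm a) / norm (1 - cnj a * z)) ^ N) powr p
           = c a powr p * (((1 - norm a) / norm (1 - cnj a * z)) powr real N) powr p"
          using q by (simp only: powr_mult powr_realpow)
        also have "\<dots> = c a powr p * ((1 - norm a) / norm (1 - cnj a * z)) powr (N * p)"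
          by (simp only: powr_powr)
        also have "\<dots> = c a powr p * (1 - norm a) powr (M - t) * ((1 - norm z) powr t * norm (1 - cnj a * z) powr - M)"
          using True z pos by (simp add: t_def M_def powr_divide powr_minus_divide)
        finally show "(c a * ((1 - norm a) / norm (1 - cnj a * z)) ^ N) powr p = \<dots>" .
      qed simp
      finally show ?thesis by simp
    qed
    then show ?thesis by (intro exI[of _ 1]) auto
  next
    case False
    define \<delta> where "\<delta> = 1 / (2 * (p - 1))"
    have \<delta>: "\<delta> > 0" "\<delta> * (p - 1) = 1 / 2" "2 + \<delta> \<le> N" using False N(3) by (auto simp: \<delta>_def)
    obtain C2 where C2: "C2 > 0" "\<And>S z. separated S \<Longrightarrow> norm z < 1 \<Longrightarrow>
      (\<Sum>a\<in>S. (1 - norm a)\<^sup>2 * norm (1 - cnj a * z) powr - (2 + \<delta>)) \<le> C2 * (1 - norm z) powr - \<delta>"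
      using separated_kernel_sum_le[OF \<delta>(1)] by auto
    have "(\<Sum>a\<in>S. c a * ((1 - norm a) / norm (1 - cnj a * z)) ^ N) powr p
      \<le> C2 powr (p - 1) * (\<Sum>a\<in>S. c a powr p * (1 - norm a) powr (M - t) * ((1 - norm z) powr t * norm (1 - cnj a * z) powr - M))"
      if S: "separated S" and c: "\<forall>a\<in>S. 0 \<le> c a" and z: "norm z < 1" for S c z
    proof -
      define K where "K a = ((1 - norm a) / norm (1 - cnj a * z)) ^ N" for a
      define w where "w a = (1 - norm a) powr - \<delta>" for a :: complex
      have pos: "norm (1 - cnj a * z) > 0" "1 - norm a > 0" "1 - norm a \<le> norm (1 - cnj a * z)" if "a \<in> S" for a
        using one_minus_norm_le_kernel(1)[of a z] kernel_pos[of a z] separated_norm_less[OF S that] z by linarith+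
      have Kpow: "K a = (1 - norm a) powr N * norm (1 - cnj a * z) powr - N" if "a \<in> S" for a
      proof -
        have "(1 - norm a) / norm (1 - cnj a * z) > 0" using pos[OF that] by simp
        then have "K a = ((1 - norm a) / norm (1 - cnj a * z)) powr N" unfolding K_def by (simp only: powr_realpow)
        then show ?thesis by (simp add: powr_divide powr_minus_divide)
      qed
      have Kw: "K a > 0" "w a > 0" if "a \<in> S" for a
      proof -
        show "K a > 0" unfolding K_def using pos[OF that] by (intro zero_less_power divide_pos_pos)
        show "w a > 0" unfolding w_def powr_gt_zero using pos(2)[OF that] by linarith
      qed
      have R0: "0 \<le> (\<Sum>a\<in>S. c a powr p * K a * w a powr (1 - p))"
        using Kw by (intro sum_nonneg mult_nonneg_nonneg) (auto intro: less_imp_le)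
      have "(\<Sum>a\<in>S. c a * K a) powr p
        \<le> (\<Sum>a\<in>S. K a * w a) powr (p - 1) * (\<Sum>a\<in>S. c a powr p * K a * w a powr (1 - p))"
        using separated_finite[OF S] c Kw False by (intro weighted_power_mean) auto
      also have "(\<Sum>a\<in>S. K a * w a) powr (p - 1) \<le> (C2 * (1 - norm z) powr - \<delta>) powr (p - 1)"
      proof (rule powr_mono2)
        have "(\<Sum>a\<in>S. K a * w a) \<le> (\<Sum>a\<in>S. (1 - norm a)\<^sup>2 * norm (1 - cnj a * z) powr - (2 + \<delta>))"
        proof (rule sum_mono)
          fix a assume a: "a \<in> S"
          note q = pos[OF a]
          have "K a * w a = (1 - norm a) powr 2 * ((1 - norm a) powr (real N - 2 - \<delta>) * norm (1 - cnj a * z) powr - N)"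
            unfolding Kpow[OF a] w_def by (simp add: powr_add[symmetric] mult.commute mult.left_commute mult.assoc)
          \<comment> \<open>The surplus exponent \<open>real N - 2 - \<delta>\<close> is
            nonnegative, so 1 - |a| may be replaced by the larger |1 - cnj a z|; what remains is the
            kernel of exponent 2 + \<open>\<delta>\<close>.\<close>
          also have "\<dots> \<le> (1 - norm a) powr 2 * (norm (1 - cnj a * z) powr (real N - 2 - \<delta>) * norm (1 - cnj a * z) powr - N)"
            using q \<delta> by (intro mult_left_mono mult_right_mono powr_mono2) auto
          also have "\<dots> = (1 - norm a)\<^sup>2 * norm (1 - cnj a * z) powr - (2 + \<delta>)"
            using q by (simp add: powr_add[symmetric])
          finally show "K a * w a \<le> (1 - norm a)\<^sup>2 * norm (1 - cnj a * z) powr - (2 + \<delta>)" .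
        qed
        also have "\<dots> \<le> C2 * (1 - norm z) powr - \<delta>" by (rule C2(2)[OF S z])
        finally show "(\<Sum>a\<in>S. K a * w a) \<le> C2 * (1 - norm z) powr - \<delta>" .
        show "0 \<le> (\<Sum>a\<in>S. K a * w a)" using Kw by (intro sum_nonneg mult_nonneg_nonneg) (auto intro: less_imp_le)
      qed (use False in simp)
      also have "(C2 * (1 - norm z) powr - \<delta>) powr (p - 1) = C2 powr (p - 1) * (1 - norm z) powr t"
      proof -
        have "((1 - norm z) powr - \<delta>) powr (p - 1) = (1 - norm z) powr (- \<delta> * (p - 1))" by (rule powr_powr)
        also have "- \<delta> * (p - 1) = t" using \<delta>(2) False by (simp add: t_def)
        finally show ?thesis by (simp add: powr_mult)
      qed
      finally have "(\<Sum>a\<in>S. c a * K a) powr p \<le> C2 powr (p - 1) * (1 - norm z) powr t * (\<Sum>a\<in>S. c a powr p * K a * w a powr (1 - p))"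
        by (simp only: mult_right_mono[OF _ R0])
      also have "(\<Sum>a\<in>S. c a powr p * K a * w a powr (1 - p))
         = (\<Sum>a\<in>S. c a powr p * (1 - norm a) powr (M - t) * norm (1 - cnj a * z) powr - M)"
      proof (rule sum.cong)
        fix a assume a: "a \<in> S"
        have "w a powr (1 - p) = (1 - norm a) powr (- \<delta> * (1 - p))" unfolding w_def by (rule powr_powr)
        also have "- \<delta> * (1 - p) = - t" using \<delta>(2) False by (simp add: t_def algebra_simps)
        finally show "c a powr p * K a * w a powr (1 - p) = c a powr p * (1 - norm a) powr (M - t) * norm (1 - cnj a * z) powr - M"
          using False unfolding Kpow[OF a] by (simp add: M_def powr_add[symmetric] diff_conv_add_uminus del: add_uminus_conv_diff)
      qed simp
      finally show ?thesis unfolding K_def by (simp add: sum_distrib_left mult_ac)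
    qed
    then show ?thesis using C2(1) by (intro exI[of _ "C2 powr (p - 1)"]) auto
  qed
  then obtain C1 where C1: "C1 > 0" "\<And>S c z. separated S \<Longrightarrow> (\<forall>a\<in>S. 0 \<le> c a) \<Longrightarrow> norm z < 1 \<Longrightarrow>
    (\<Sum>a\<in>S. c a * ((1 - norm a) / norm (1 - cnj a * z)) ^ N) powr p
      \<le> C1 * (\<Sum>a\<in>S. c a powr p * (1 - norm a) powr (M - t) * ((1 - norm z) powr t * norm (1 - cnj a * z) powr - M))"
    by blast
  show ?thesis
  proof (intro exI[of _ "C1 * C0"] conjI allI impI)
    show "C1 * C0 > 0" using C0 C1 by simp
    fix S c assume S: "separated S" and c: "\<forall>a\<in>S. (0::real) \<le> c a"
    define k where "k a z = (1 - norm z) powr t * norm (1 - cnj a * z) powr - M" for a z :: complex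
    define e where "e a = C1 * (c a powr p * (1 - norm a) powr (M - t))" for a :: complex
    have km [measurable]: "(\<lambda>z. indicator (ball 0 1) z * ennreal (k a z)) \<in> borel_measurable borel" for a
      unfolding k_def by (rule borel_measurable_kernel)
    have e: "e a \<ge> 0" for a using C1 by (simp add: e_def)
    have "(\<integral>\<^sup>+z. indicator (ball 0 1) z * ennreal ((\<Sum>a\<in>S. c a * ((1 - norm a) / norm (1 - cnj a * z)) ^ N) powr p) \<partial>lborel)
      \<le> (\<integral>\<^sup>+z. (\<Sum>a\<in>S. ennreal (e a) * (indicator (ball 0 1) z * ennreal (k a z))) \<partial>lborel)"
    proof (rule nn_integral_mono)
      fix z :: complex
      show "indicator (ball 0 1) z * ennreal ((\<Sum>a\<in>S. c a * ((1 - norm a) / norm (1 - cnj a * z)) ^ N) powr p)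
        \<le> (\<Sum>a\<in>S. ennreal (e a) * (indicator (ball 0 1) z * ennreal (k a z)))"
      proof (cases "norm z < 1")
        case True
        have "ennreal ((\<Sum>a\<in>S. c a * ((1 - norm a) / norm (1 - cnj a * z)) ^ N) powr p) \<le> ennreal (\<Sum>a\<in>S. e a * k a z)"
          using C1(2)[OF S c True] by (intro ennreal_leI) (simp add: e_def k_def sum_distrib_left mult_ac)
        also have "\<dots> = (\<Sum>a\<in>S. ennreal (e a) * ennreal (k a z))"
          using e by (simp add: sum_ennreal[symmetric] ennreal_mult k_def)
        finally show ?thesis using True by simp
      qed simp
    qed
    also have "\<dots> = (\<Sum>a\<in>S. \<integral>\<^sup>+z. ennreal (e a) * (indicator (ball 0 1) z * ennreal (k a z)) \<partial>lborel)"
      by (intro nn_integral_sum) (intro borel_measurable_times_ennreal[OF borel_measurable_const], simp add: km)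
    also have "\<dots> = (\<Sum>a\<in>S. ennreal (e a) * (\<integral>\<^sup>+z. indicator (ball 0 1) z * ennreal (k a z) \<partial>lborel))"
      using km by (intro sum.cong refl nn_integral_cmult) simp
    also have "\<dots> \<le> (\<Sum>a\<in>S. ennreal (e a) * ennreal (C0 * (1 - norm a) powr (2 + t - M)))"
      unfolding k_def by (intro sum_mono mult_left_mono C0 separated_norm_less[OF S]) auto
    also have "\<dots> = (\<Sum>a\<in>S. ennreal (C1 * C0 * (c a powr p * (1 - norm a)\<^sup>2)))"
    proof (rule sum.cong)
      fix a assume "a \<in> S"
      then have "1 - norm a > 0" using separated_norm_less[OF S] by auto
      then have "(1 - norm a) powr (M - t) * (1 - norm a) powr (2 + t - M) = (1 - norm a)\<^sup>2"
        by (simp add: powr_add[symmetric])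
      moreover have "e a * (C0 * (1 - norm a) powr (2 + t - M))
          = C1 * C0 * (c a powr p * ((1 - norm a) powr (M - t) * (1 - norm a) powr (2 + t - M)))"
        unfolding e_def by (simp only: mult_ac)
      ultimately have eq: "e a * (C0 * (1 - norm a) powr (2 + t - M)) = C1 * C0 * (c a powr p * (1 - norm a)\<^sup>2)"
        by simp
      show "ennreal (e a) * ennreal (C0 * (1 - norm a) powr (2 + t - M)) = ennreal (C1 * C0 * (c a powr p * (1 - norm a)\<^sup>2))"
        unfolding eq[symmetric] using e C0(1) by (intro ennreal_mult[symmetric]) auto
    qed simp
    also have "\<dots> = ennreal (C1 * C0 * (\<Sum>a\<in>S. c a powr p * (1 - norm a)\<^sup>2))"
      using C0 C1 by (simp add: sum_ennreal sum_distrib_left)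
    finally show "(\<integral>\<^sup>+z. indicator (ball 0 1) z * ennreal ((\<Sum>a\<in>S. c a * ((1 - norm a) / norm (1 - cnj a * z)) ^ N) powr p) \<partial>lborel)
      \<le> ennreal (C1 * C0 * (\<Sum>a\<in>S. c a powr p * (1 - norm a)\<^sup>2))" .
  qed
qed

section \<open>Bergman spaces and sums of weighted composition operators\<close>

lemma bergman_integral_mono:
  assumes "\<And>z. z \<in> unit_disc \<Longrightarrow> norm (f z) \<le> norm (g z)" "p > 0"
  shows "bergman_integral p f \<le> bergman_integral p g"
proof -
  have "indicator unit_disc z * ennreal (norm (f z) powr p) \<le> indicator unit_disc z * ennreal (norm (g z) powr p)" for z
    using assms by (cases "z \<in> unit_disc") (auto intro!: ennreal_leI powr_mono2)
  then show ?thesis unfolding bergman_integral_def by (rule mult_left_mono[OF nn_integral_mono]) simp_all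
qed

lemma bergman_integral_cong:
  assumes "\<And>z. z \<in> unit_disc \<Longrightarrow> f z = g z"
  shows "bergman_integral p f = bergman_integral p g"
proof -
  have "indicator unit_disc z * ennreal (norm (f z) powr p) = indicator unit_disc z * ennreal (norm (g z) powr p)" for z
    using assms by (cases "z \<in> unit_disc") auto
  then show ?thesis unfolding bergman_integral_def by simp
qed

lemma measurable_bergman:
  assumes "f holomorphic_on unit_disc" "p > 0"
  shows "(\<lambda>z. indicator unit_disc z * ennreal (norm (f z) powr p)) \<in> borel_measurable borel"
  using assms by (intro borel_measurable_holomorphic_powr) auto

lemma disc_integral_eq_bergman_integral:
  "powr_integral unit_disc p f = ennreal pi * bergman_integral p f"
  unfolding bergman_integral_def by (simp add: mult.assoc[symmetric] ennreal_mult[symmetric])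

lemma bergman_integral_add_le:
  assumes f: "f holomorphic_on unit_disc" and g: "g holomorphic_on unit_disc" and p: "p > 0"
  shows "bergman_integral p (\<lambda>z. f z + g z) \<le> ennreal (2 powr p) * (bergman_integral p f + bergman_integral p g)"
proof -
  note [measurable] = measurable_bergman[OF f p] measurable_bergman[OF g p]
  have "(\<integral>\<^sup>+z. indicator unit_disc z * ennreal (norm (f z + g z) powr p) \<partial>lborel)
    \<le> (\<integral>\<^sup>+z. ennreal (2 powr p) * (indicator unit_disc z * ennreal (norm (f z) powr p)
          + indicator unit_disc z * ennreal (norm (g z) powr p)) \<partial>lborel)"
  proof (rule nn_integral_mono)
    fix z
    have "norm (f z + g z) powr p \<le> (norm (f z) + norm (g z)) powr p"
      using p by (intro powr_mono2 norm_triangle_ineq) auto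
    also have "\<dots> \<le> 2 powr p * (norm (f z) powr p + norm (g z) powr p)" using p by (intro powr_add_le) auto
    finally show "indicator unit_disc z * ennreal (norm (f z + g z) powr p)
      \<le> ennreal (2 powr p) * (indicator unit_disc z * ennreal (norm (f z) powr p)
          + indicator unit_disc z * ennreal (norm (g z) powr p))"
      by (auto simp: indicator_def ennreal_mult[symmetric] ennreal_plus[symmetric] ennreal_leI simp del: ennreal_plus)
  qed
  also have "\<dots> = ennreal (2 powr p) * (powr_integral unit_disc p f
       + (powr_integral unit_disc p g))"
    by (subst nn_integral_cmult, measurable, subst nn_integral_add) measurable
  finally have "ennreal (1 / pi) * (\<integral>\<^sup>+z. indicator unit_disc z * ennreal (norm (f z + g z) powr p) \<partial>lborel)
      \<le> ennreal (1 / pi) * (ennreal (2 powr p) * (powr_integral unit_disc p f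
        + (powr_integral unit_disc p g)))"
    by (rule mult_left_mono) simp
  also have "\<dots> = ennreal (2 powr p) * (bergman_integral p f + bergman_integral p g)"
    unfolding bergman_integral_def distrib_left[symmetric] by (rule mult.left_commute)
  finally show ?thesis unfolding bergman_integral_def .
qed

lemma bergman_integral_sum_le:
  assumes f: "\<And>i. i \<in> I \<Longrightarrow> f i holomorphic_on unit_disc" and I: "finite I" and p: "p > 0"
  shows "bergman_integral p (\<lambda>z. \<Sum>i\<in>I. f i z) \<le> ennreal (real (card I) powr p) * (\<Sum>i\<in>I. bergman_integral p (f i))"
proof -
  have m: "(\<lambda>z. indicator unit_disc z * ennreal (norm (f i z) powr p)) \<in> borel_measurable lborel" if "i \<in> I" for i
    using measurable_bergman[OF f[OF that] p] by simp
  have "(\<integral>\<^sup>+z. indicator unit_disc z * ennreal (norm (\<Sum>i\<in>I. f i z) powr p) \<partial>lborel)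
    \<le> (\<integral>\<^sup>+z. ennreal (real (card I) powr p) * (\<Sum>i\<in>I. indicator unit_disc z * ennreal (norm (f i z) powr p)) \<partial>lborel)"
  proof (rule nn_integral_mono)
    fix z
    have "norm (\<Sum>i\<in>I. f i z) powr p \<le> (\<Sum>i\<in>I. norm (f i z)) powr p"
      using p by (intro powr_mono2 norm_sum) auto
    also have "\<dots> \<le> real (card I) powr p * (\<Sum>i\<in>I. norm (f i z) powr p)" using p I by (intro powr_sum_le) auto
    finally show "indicator unit_disc z * ennreal (norm (\<Sum>i\<in>I. f i z) powr p)
      \<le> ennreal (real (card I) powr p) * (\<Sum>i\<in>I. indicator unit_disc z * ennreal (norm (f i z) powr p))"
      by (auto simp: indicator_def ennreal_mult[symmetric] sum_ennreal sum_nonneg ennreal_leI)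
  qed
  also have "\<dots> = ennreal (real (card I) powr p) * (\<Sum>i\<in>I. powr_integral unit_disc p (f i))"
    using m by (subst nn_integral_cmult, intro borel_measurable_sum, simp, subst nn_integral_sum) auto
  finally have "ennreal (1 / pi) * (\<integral>\<^sup>+z. indicator unit_disc z * ennreal (norm (\<Sum>i\<in>I. f i z) powr p) \<partial>lborel)
      \<le> ennreal (1 / pi) * (ennreal (real (card I) powr p) *
          (\<Sum>i\<in>I. powr_integral unit_disc p (f i)))"
    by (rule mult_left_mono) simp
  also have "\<dots> = ennreal (real (card I) powr p) * (\<Sum>i\<in>I. bergman_integral p (f i))"
    unfolding bergman_integral_def sum_distrib_left[symmetric] by (rule mult.left_commute)
  finally show ?thesis unfolding bergman_integral_def .
qed

lemma bergman_integral_cmult: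
  assumes f: "f holomorphic_on unit_disc" and p: "p > 0"
  shows "bergman_integral p (\<lambda>z. c * f z) = ennreal (norm c powr p) * bergman_integral p f"
proof -
  have "(\<integral>\<^sup>+z. indicator unit_disc z * ennreal (norm (c * f z) powr p) \<partial>lborel)
    = (\<integral>\<^sup>+z. ennreal (norm c powr p) * (indicator unit_disc z * ennreal (norm (f z) powr p)) \<partial>lborel)"
    by (intro nn_integral_cong) (auto simp: norm_mult powr_mult ennreal_mult indicator_def)
  also have "\<dots> = ennreal (norm c powr p) * powr_integral unit_disc p f"
    using measurable_bergman[OF f p] by (intro nn_integral_cmult) simp
  finally show ?thesis unfolding bergman_integral_def by (simp add: mult.left_commute)
qed

lemma bergman_norm_cmult:
  assumes "f holomorphic_on unit_disc" "p > 0"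
  shows "bergman_norm p (\<lambda>z. c * f z) = norm c * bergman_norm p f"
  using assms(2) by (simp add: bergman_norm_def bergman_integral_cmult[OF assms] enn2real_mult powr_mult powr_powr)

lemma bergman_integral_uminus: "bergman_integral p (\<lambda>z. - f z) = bergman_integral p f"
  by (simp add: bergman_integral_def)

lemma bergman_integral_diff_le:
  assumes "f holomorphic_on unit_disc" "g holomorphic_on unit_disc" "p > 0"
  shows "bergman_integral p (\<lambda>z. f z - g z) \<le> ennreal (2 powr p) * (bergman_integral p f + bergman_integral p g)"
  using bergman_integral_add_le[of f "\<lambda>z. - g z" p] assms
  by (simp add: bergman_integral_uminus holomorphic_on_minus)

lemma bergman_space_diff:
  assumes "f \<in> bergman_space p" "g \<in> bergman_space p" "p > 0"
  shows "(\<lambda>z. f z - g z) \<in> bergman_space p"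
proof -
  have fg: "f holomorphic_on unit_disc" "g holomorphic_on unit_disc" and
    fin: "bergman_integral p f < \<infinity>" "bergman_integral p g < \<infinity>" using assms by (auto simp: bergman_space_def)
  have "bergman_integral p (\<lambda>z. f z - g z) \<le> ennreal (2 powr p) * (bergman_integral p f + bergman_integral p g)"
    using fg assms(3) by (rule bergman_integral_diff_le)
  also have "\<dots> < \<infinity>" using fin by (simp add: ennreal_mult_less_top)
  finally show ?thesis using fg by (auto simp: bergman_space_def intro: holomorphic_on_diff)
qed

text \<open>Finiteness matters because \<open>enn2real\<close> sends infinity to 0: a vanishing
  \<open>bergman_norm\<close> may also mean an infinite integral. For this reason the estimates
  below are stated for \<open>bergman_integral\<close>.\<close>

lemma bergman_integral_eq_norm:
  assumes "bergman_integral p f < \<infinity>" "p > 0"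
  shows "bergman_integral p f = ennreal (bergman_norm p f powr p)"
  using assms by (simp add: bergman_norm_def powr_powr ennreal_enn2real_if)

lemma bergman_norm_le:
  assumes "bergman_integral p f \<le> ennreal (M powr p)" "p > 0" "M \<ge> 0"
  shows "bergman_norm p f \<le> M"
proof -
  have "enn2real (bergman_integral p f) \<le> M powr p" using assms(1) by (simp add: enn2real_leI)
  then have "bergman_norm p f \<le> (M powr p) powr (1 / p)"
    unfolding bergman_norm_def using assms by (intro powr_mono2) auto
  then show ?thesis using assms by (simp add: powr_powr)
qed

lemma bergman_norm_nonneg: "bergman_norm p f \<ge> 0"
  by (simp add: bergman_norm_def)

lemma bergman_norm_tendsto_0_iff:
  assumes "\<And>i. bergman_integral p (h i) < \<infinity>" "p > 0"
  shows "(\<lambda>i. bergman_norm p (h i)) \<longlonglongrightarrow> 0 \<longleftrightarrow> (\<lambda>i. bergman_integral p (h i)) \<longlonglongrightarrow> 0"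
proof
  assume "(\<lambda>i. bergman_norm p (h i)) \<longlonglongrightarrow> 0"
  then have "(\<lambda>i. bergman_norm p (h i) powr p) \<longlonglongrightarrow> 0 powr p"
    using assms(2) bergman_norm_nonneg by (intro tendsto_powr2) auto
  then have "(\<lambda>i. ennreal (bergman_norm p (h i) powr p)) \<longlonglongrightarrow> ennreal 0"
    using assms(2) by (intro tendsto_ennrealI) simp
  then show "(\<lambda>i. bergman_integral p (h i)) \<longlonglongrightarrow> 0" using bergman_integral_eq_norm[OF assms] by simp
next
  assume "(\<lambda>i. bergman_integral p (h i)) \<longlonglongrightarrow> 0"
  then have "(\<lambda>i. enn2real (bergman_integral p (h i))) \<longlonglongrightarrow> enn2real 0"
    by (intro tendsto_enn2real) auto
  then have "(\<lambda>i. enn2real (bergman_integral p (h i)) powr (1 / p)) \<longlonglongrightarrow> 0 powr (1 / p)"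
    using assms(2) by (intro tendsto_powr2) auto
  then show "(\<lambda>i. bergman_norm p (h i)) \<longlonglongrightarrow> 0" using assms(2) by (simp add: bergman_norm_def)
qed

text \<open>Fatou's lemma. It identifies limits of sequences that are known to converge only
  pointwise on the disc.\<close>

lemma bergman_integral_liminf:
  assumes F: "\<And>i. F i holomorphic_on unit_disc" and p: "p > 0"
    and lim: "\<And>z. z \<in> unit_disc \<Longrightarrow> (\<lambda>i::nat. F i z) \<longlonglongrightarrow> g z"
  shows "bergman_integral p g \<le> liminf (\<lambda>i. bergman_integral p (F i))"
proof -
  define G where "G i z = indicator unit_disc z * ennreal (norm (F i z) powr p)" for i z
  have [measurable]: "G i \<in> borel_measurable borel" for i
    unfolding G_def by (rule measurable_bergman[OF F p])
  have "powr_integral unit_disc p g = (\<integral>\<^sup>+z. liminf (\<lambda>i. G i z) \<partial>lborel)"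
  proof (rule nn_integral_cong)
    fix z :: complex
    show "indicator unit_disc z * ennreal (norm (g z) powr p) = liminf (\<lambda>i. G i z)"
    proof (cases "z \<in> unit_disc")
      case True
      have "(\<lambda>i. norm (F i z) powr p) \<longlonglongrightarrow> norm (g z) powr p"
        using p by (intro tendsto_powr2 tendsto_norm lim True tendsto_const) auto
      then have "(\<lambda>i. G i z) \<longlonglongrightarrow> ennreal (norm (g z) powr p)"
        using True by (simp add: G_def tendsto_ennrealI)
      then show ?thesis using True by (simp add: lim_imp_Liminf)
    next
      case False
      then show ?thesis by (simp add: G_def Liminf_const)
    qed
  qed
  also have "\<dots> \<le> liminf (\<lambda>i. \<integral>\<^sup>+z. G i z \<partial>lborel)" by (rule nn_integral_liminf) simp
  also have "(\<lambda>i. \<integral>\<^sup>+z. G i z \<partial>lborel) = (\<lambda>i. ennreal pi * bergman_integral p (F i))"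
    unfolding G_def by (simp only: disc_integral_eq_bergman_integral)
  finally have "ennreal (1 / pi) * (ennreal pi * bergman_integral p g) \<le> ennreal (1 / pi) * liminf (\<lambda>i. ennreal pi * bergman_integral p (F i))"
    unfolding disc_integral_eq_bergman_integral by (rule mult_left_mono) simp
  also have "\<dots> = liminf (\<lambda>i. ennreal (1 / pi) * (ennreal pi * bergman_integral p (F i)))"
    by (rule Liminf_compose_continuous_mono[symmetric])
      (auto intro!: ennreal_continuous_on_cmult continuous_on_id monoI mult_left_mono)
  finally show ?thesis by (simp add: mult.assoc[symmetric] ennreal_mult[symmetric])
qed

text \<open>The sub-mean value inequality on the largest disc about \<open>w\<close>, of radius 1 -
  |w|. A free bound \<open>M\<close> in place of the norm keeps roots of extended reals out of later
  estimates.\<close>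

lemma bergman_growth:
  assumes p: "p > 0"
  shows "\<exists>C>0. \<forall>f M w. f holomorphic_on unit_disc \<longrightarrow> 0 \<le> M \<longrightarrow> bergman_integral p f \<le> ennreal (M powr p) \<longrightarrow>
     norm w < 1 \<longrightarrow> norm (f w) \<le> C * M * (1 - norm w) powr - (2 / p)"
proof -
  obtain C where C: "C > 0" "\<And>f w R. f holomorphic_on ball w R \<Longrightarrow> R > 0 \<Longrightarrow>
    ennreal (R\<^sup>2 * (R ^ 0 * norm ((deriv ^^ 0) f w)) powr p)
      \<le> ennreal C * powr_integral (ball w R) p f"
    using deriv_sub_mean_value[OF p, of 0] by blast
  show ?thesis
  proof (intro exI[of _ "(C * pi) powr (1 / p)"] conjI allI impI)
    show "(C * pi) powr (1 / p) > 0" using C by simp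
    fix f M and w :: complex
    assume f: "f holomorphic_on unit_disc" and M: "0 \<le> M" "bergman_integral p f \<le> ennreal (M powr p)" and w: "norm w < 1"
    define R where "R = 1 - norm w"
    have R: "R > 0" using w by (simp add: R_def)
    have sub: "ball w R \<subseteq> unit_disc"
    proof
      fix z assume "z \<in> ball w R"
      then show "z \<in> unit_disc" using norm_triangle_sub[of z w] by (simp add: R_def dist_norm norm_minus_commute)
    qed
    have "ennreal (R\<^sup>2 * norm (f w) powr p) \<le> ennreal C * powr_integral (ball w R) p f"
      using C(2)[OF holomorphic_on_subset[OF f sub] R] by simp
    also have "\<dots> \<le> ennreal C * powr_integral unit_disc p f"
      using sub by (intro mult_left_mono nn_integral_mono) (auto simp: indicator_def)
    also have "\<dots> \<le> ennreal C * (ennreal pi * ennreal (M powr p))"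
      unfolding disc_integral_eq_bergman_integral using M by (intro mult_left_mono) auto
    also have "\<dots> = ennreal (C * pi * M powr p)" using C by (simp add: ennreal_mult[symmetric] mult.assoc)
    finally have "R\<^sup>2 * norm (f w) powr p \<le> C * pi * M powr p" using C by simp
    then have "norm (f w) powr p \<le> C * pi * M powr p * R powr - 2"
      using R by (simp add: powr_minus field_simps)
    then have "(norm (f w) powr p) powr (1 / p) \<le> (C * pi * M powr p * R powr - 2) powr (1 / p)"
      using p by (intro powr_mono2) auto
    also have "\<dots> = (C * pi) powr (1 / p) * (M powr p) powr (1 / p) * (R powr - 2) powr (1 / p)"
      by (simp only: powr_mult)
    also have "\<dots> = (C * pi) powr (1 / p) * M * R powr - (2 / p)" using M p by (simp add: powr_powr)
    finally show "norm (f w) \<le> (C * pi) powr (1 / p) * M * (1 - norm w) powr - (2 / p)"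
      using p by (simp add: powr_powr R_def)
  qed
qed

text \<open>Bounded and locally uniformly convergent to 0. This takes the place of weakly null
  sequences and makes sense for every positive exponent, also where duality is of no use.\<close>

definition null_seq :: "real \<Rightarrow> (nat \<Rightarrow> complex \<Rightarrow> complex) \<Rightarrow> bool" where
  "null_seq p F \<longleftrightarrow> (\<forall>i. F i holomorphic_on unit_disc) \<and> (\<exists>M. \<forall>i. bergman_integral p (F i) \<le> ennreal M) \<and>
     (\<forall>r<1. uniform_limit (cball 0 r) F (\<lambda>_. 0) sequentially)"

lemma Cauchy_bound_unit_disc:
  assumes f: "f holomorphic_on unit_disc" and r: "norm w \<le> r" "r < s" "s < 1" and B: "\<And>z. norm z \<le> s \<Longrightarrow> norm (f z) \<le> B"
  shows "norm ((deriv ^^ k) f w) \<le> fact k / (s - r) ^ k * B"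
proof -
  have sub: "cball w (s - r) \<subseteq> cball 0 s"
  proof
    fix z assume "z \<in> cball w (s - r)"
    then show "z \<in> cball 0 s" using norm_triangle_sub[of z w] r by (simp add: dist_norm norm_minus_commute)
  qed
  have "cball 0 s \<subseteq> unit_disc" using r by auto
  then have hol: "f holomorphic_on cball w (s - r)" using sub f by (meson holomorphic_on_subset)
  have "norm ((deriv ^^ k) f w) \<le> fact k * B / (s - r) ^ k"
  proof (rule Cauchy_inequality)
    show "f holomorphic_on ball w (s - r)" using hol by (rule holomorphic_on_subset) auto
    show "continuous_on (cball w (s - r)) f" using hol by (rule holomorphic_on_imp_continuous_on)
    show "norm (f x) \<le> B" if "norm (w - x) = s - r" for x
    proof -
      have "x \<in> cball w (s - r)" using that by (simp add: dist_norm)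
      then have "x \<in> cball 0 s" using sub by blast
      then show ?thesis by (intro B) simp
    qed
  qed (use r in simp)
  then show ?thesis by simp
qed

text \<open>A single summand is itself such a sum, with all other coefficients zero. Hence the
  criteria for boundedness and compactness proved here apply both to \<open>L\<close> and to each of
  its terms.\<close>

locale weighted_sum =
  fixes us :: "nat \<Rightarrow> complex \<Rightarrow> complex" and \<phi> :: "complex \<Rightarrow> complex" and n :: nat
  assumes us_hol: "\<And>k. k \<le> n \<Longrightarrow> us k holomorphic_on unit_disc"
    and phi_hol: "\<phi> holomorphic_on unit_disc" and phi_into: "\<phi> ` unit_disc \<subseteq> unit_disc"
begin

abbreviation L where "L \<equiv> L_op us \<phi> n"

lemma phi_in: "z \<in> unit_disc \<Longrightarrow> \<phi> z \<in> unit_disc"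
  using phi_into by blast

lemma L_eq: "L f z = (\<Sum>k\<le>n. us k z * (deriv ^^ k) f (\<phi> z))"
  by (simp add: L_op_def gen_wcomp_def)

lemma term_holomorphic:
  assumes "f holomorphic_on unit_disc" "k \<le> n"
  shows "gen_wcomp (us k) \<phi> k f holomorphic_on unit_disc"
proof -
  have "(deriv ^^ k) f \<circ> \<phi> holomorphic_on unit_disc"
    by (rule holomorphic_on_compose_gen[OF phi_hol holomorphic_higher_deriv[OF assms(1) open_ball] phi_into])
  then show ?thesis unfolding gen_wcomp_def using us_hol[OF assms(2)]
    by (intro holomorphic_on_mult) (auto simp: o_def)
qed

lemma L_holomorphic: "f holomorphic_on unit_disc \<Longrightarrow> L f holomorphic_on unit_disc"
  unfolding L_op_def by (intro holomorphic_on_sum term_holomorphic) auto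

lemma L_cmult:
  assumes "f holomorphic_on unit_disc" "z \<in> unit_disc"
  shows "L (\<lambda>w. c * f w) z = c * L f z"
  unfolding L_eq by (simp add: higher_deriv_cmult[OF assms(1) phi_in[OF assms(2)] open_ball] sum_distrib_left mult_ac)

lemma L_add:
  assumes "f holomorphic_on unit_disc" "g holomorphic_on unit_disc" "z \<in> unit_disc"
  shows "L (\<lambda>w. f w + g w) z = L f z + L g z"
  unfolding L_eq
  by (simp add: higher_deriv_add[OF assms(1,2) open_ball phi_in[OF assms(3)]] sum.distrib[symmetric] algebra_simps)

lemma L_diff:
  assumes "f holomorphic_on unit_disc" "g holomorphic_on unit_disc" "z \<in> unit_disc"
  shows "L (\<lambda>w. f w - g w) z = L f z - L g z"
  unfolding L_eq
  by (simp add: higher_deriv_diff[OF assms(1,2) open_ball phi_in[OF assms(3)]] sum_subtractf[symmetric] algebra_simps)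

lemma L_sum:
  assumes "finite A" "\<And>i. i \<in> A \<Longrightarrow> f i holomorphic_on unit_disc" "z \<in> unit_disc"
  shows "L (\<lambda>w. \<Sum>i\<in>A. c i * f i w) z = (\<Sum>i\<in>A. c i * L (f i) z)"
  using assms(1,2)
proof (induction A rule: finite_induct)
  case empty
  show ?case using L_cmult[of "\<lambda>_. 0" z 0] assms(3) by simp
next
  case (insert i A)
  have "L (\<lambda>w. c i * f i w + (\<Sum>j\<in>A. c j * f j w)) z = L (\<lambda>w. c i * f i w) z + L (\<lambda>w. \<Sum>j\<in>A. c j * f j w) z"
    using insert assms(3) by (intro L_add holomorphic_on_sum holomorphic_on_mult) auto
  then show ?case using insert assms(3) by (simp add: L_cmult)
qed

lemma L_mapsI:
  assumes "f \<in> bergman_space p" "bergman_integral q (L f) \<le> ennreal K"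
  shows "L f \<in> bergman_space q"
  using assms L_holomorphic by (auto simp: bergman_space_def intro: le_less_trans)

text \<open>Boundedness as an inequality between integrals that presupposes no finiteness of the
  image. An arbitrary bound M > 0 replaces the norm, so the case of norm zero needs no separate
  treatment.\<close>

lemma bounded_op_iff:
  assumes p: "p > 0" and q: "q > 0"
  shows "bounded_op p q L \<longleftrightarrow> (\<exists>K>0. \<forall>f M. f holomorphic_on unit_disc \<longrightarrow> M > 0 \<longrightarrow>
    bergman_integral p f \<le> ennreal (M powr p) \<longrightarrow> bergman_integral q (L f) \<le> ennreal (K * M powr q))"
proof
  assume bd: "bounded_op p q L"
  then obtain C where C: "\<And>f. f \<in> bergman_space p \<Longrightarrow> bergman_norm q (L f) \<le> C * bergman_norm p f"
    and maps: "\<And>f. f \<in> bergman_space p \<Longrightarrow> L f \<in> bergman_space q" by (auto simp: bounded_op_def)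
  define C' where "C' = max C 1"
  show "\<exists>K>0. \<forall>f M. f holomorphic_on unit_disc \<longrightarrow> M > 0 \<longrightarrow>
    bergman_integral p f \<le> ennreal (M powr p) \<longrightarrow> bergman_integral q (L f) \<le> ennreal (K * M powr q)"
  proof (intro exI[of _ "C' powr q"] conjI allI impI)
    show "C' powr q > 0" by (simp add: C'_def)
    fix f M assume f: "f holomorphic_on unit_disc" and M: "M > 0" "bergman_integral p f \<le> ennreal (M powr p)"
    have fp: "f \<in> bergman_space p" using f M by (auto simp: bergman_space_def intro: le_less_trans)
    have "bergman_norm q (L f) \<le> C * bergman_norm p f" by (rule C[OF fp])
    also have "\<dots> \<le> C' * bergman_norm p f" by (intro mult_right_mono bergman_norm_nonneg) (simp add: C'_def)
    also have "\<dots> \<le> C' * M" using M p by (intro mult_left_mono bergman_norm_le) (auto simp: C'_def)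
    finally have "bergman_norm q (L f) powr q \<le> (C' * M) powr q"
      using q bergman_norm_nonneg by (intro powr_mono2) auto
    then have "ennreal (bergman_norm q (L f) powr q) \<le> ennreal (C' powr q * M powr q)"
      by (intro ennreal_leI) (simp add: powr_mult)
    then show "bergman_integral q (L f) \<le> ennreal (C' powr q * M powr q)"
      using maps[OF fp] q bergman_integral_eq_norm[of q "L f"] by (simp add: bergman_space_def)
  qed
next
  assume "\<exists>K>0. \<forall>f M. f holomorphic_on unit_disc \<longrightarrow> M > 0 \<longrightarrow>
    bergman_integral p f \<le> ennreal (M powr p) \<longrightarrow> bergman_integral q (L f) \<le> ennreal (K * M powr q)"
  then obtain K where K: "K > 0" "\<And>f M. f holomorphic_on unit_disc \<Longrightarrow> M > 0 \<Longrightarrow>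
    bergman_integral p f \<le> ennreal (M powr p) \<Longrightarrow> bergman_integral q (L f) \<le> ennreal (K * M powr q)" by blast
  have M: "bergman_integral q (L f) \<le> ennreal (K * M powr q)" if f: "f \<in> bergman_space p" and M: "M > bergman_norm p f" for f M
  proof (rule K(2))
    show "f holomorphic_on unit_disc" using f by (simp add: bergman_space_def)
    show "M > 0" using M bergman_norm_nonneg[of p f] by linarith
    have "bergman_norm p f powr p \<le> M powr p" using M p bergman_norm_nonneg[of p f] by (intro powr_mono2) auto
    then show "bergman_integral p f \<le> ennreal (M powr p)"
      using f p bergman_integral_eq_norm[of p f] by (simp add: bergman_space_def ennreal_leI)
  qed
  show "bounded_op p q L"
    unfolding bounded_op_def
  proof (intro conjI ballI exI[of _ "K powr (1 / q)"])
    fix f assume f: "f \<in> bergman_space p"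
    show "L f \<in> bergman_space q" by (rule L_mapsI[OF f M[OF f, of "bergman_norm p f + 1"]]) simp
    \<comment> \<open>The criterion needs a positive bound, while the norm of \<open>f\<close> may
      be 0; so it is applied slightly above the norm and the surplus is sent to 0.\<close>
    show "bergman_norm q (L f) \<le> K powr (1 / q) * bergman_norm p f"
    proof (rule field_le_epsilon)
      fix e :: real assume e: "e > 0"
      define d where "d = e / K powr (1 / q)"
      have d: "d > 0" using e K by (simp add: d_def)
      define s where "s = bergman_norm p f + d"
      have s: "s > 0" "s > bergman_norm p f" using d bergman_norm_nonneg[of p f] by (auto simp: s_def)
      have "bergman_norm q (L f) \<le> K powr (1 / q) * s"
      proof (rule bergman_norm_le)
        have "(K powr (1 / q) * s) powr q = K * s powr q" using K q by (simp add: powr_mult powr_powr)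
        then show "bergman_integral q (L f) \<le> ennreal ((K powr (1 / q) * s) powr q)" using M[OF f s(2)] by simp
      qed (use q s in auto)
      also have "\<dots> = K powr (1 / q) * bergman_norm p f + e" using K by (simp add: s_def d_def distrib_left)
      finally show "bergman_norm q (L f) \<le> K powr (1 / q) * bergman_norm p f + e" .
    qed
  qed
qed

text \<open>Cauchy estimates on a disc strictly between the point \<phi> z and the unit circle carry
  the uniform convergence over to all derivatives.\<close>

lemma L_pointwise_null:
  assumes F: "null_seq p F" and z: "z \<in> unit_disc"
  shows "(\<lambda>i. L (F i) z) \<longlonglongrightarrow> 0"
proof -
  have hol: "F i holomorphic_on unit_disc" for i using F by (simp add: null_seq_def)
  have "(\<lambda>i. (deriv ^^ k) (F i) (\<phi> z)) \<longlonglongrightarrow> 0" for k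
  proof -
    define r where "r = norm (\<phi> z)"
    have r: "r < 1" using phi_in[OF z] by (simp add: r_def)
    define s where "s = (1 + r) / 2"
    have s: "r < s" "s < 1" using r by (auto simp: s_def)
    define D where "D = fact k / (s - r) ^ k"
    have D: "D > 0" using s by (simp add: D_def)
    have "uniform_limit (cball 0 s) F (\<lambda>_. 0) sequentially" using F s by (simp add: null_seq_def)
    show ?thesis
    proof (rule tendstoI)
      fix e :: real assume e: "e > 0"
      have "eventually (\<lambda>i. \<forall>x\<in>cball 0 s. dist (F i x) 0 < e / (2 * D)) sequentially"
        using \<open>uniform_limit (cball 0 s) F (\<lambda>_. 0) sequentially\<close> e D by (auto simp: uniform_limit_iff)
      then show "eventually (\<lambda>i. dist ((deriv ^^ k) (F i) (\<phi> z)) 0 < e) sequentially"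
      proof eventually_elim
        case (elim i)
        have "norm ((deriv ^^ k) (F i) (\<phi> z)) \<le> fact k / (s - r) ^ k * (e / (2 * D))"
          using elim s by (intro Cauchy_bound_unit_disc hol) (auto simp: r_def less_imp_le)
        also have "\<dots> = e / 2" using D by (simp add: D_def[symmetric])
        finally show ?case using e by simp
      qed
    qed
  qed
  then have "(\<lambda>i. \<Sum>k\<le>n. us k z * (deriv ^^ k) (F i) (\<phi> z)) \<longlonglongrightarrow> (\<Sum>k\<le>n. us k z * 0)"
    by (intro tendsto_sum tendsto_mult tendsto_const)
  then show ?thesis by (simp add: L_eq)
qed

lemma null_seq_subseq: "null_seq p F \<Longrightarrow> strict_mono s \<Longrightarrow> null_seq p (\<lambda>i. F (s i))"
  unfolding null_seq_def
proof (elim conjE exE, intro conjI allI impI)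
  fix r :: real assume "\<forall>r<1. uniform_limit (cball 0 r) F (\<lambda>_. 0) sequentially" "r < 1" "strict_mono s"
  then show "uniform_limit (cball 0 r) (\<lambda>i. F (s i)) (\<lambda>_. 0) sequentially"
    using filterlim_compose[OF _ filterlim_subseq, of "F" _ s] by (auto simp: o_def)
qed auto

lemma null_seq_bergman_space: "null_seq p F \<Longrightarrow> F i \<in> bergman_space p"
  unfolding null_seq_def bergman_space_def by (auto intro: le_less_trans[OF _ ennreal_less_top])

text \<open>Otherwise some subsequence stays away from 0. Compactness gives a further subsequence
  whose images converge in the norm of A^q, and since the images tend to 0 pointwise that limit has
  integral 0, a contradiction.\<close>

lemma compact_op_null:
  assumes cpt: "compact_op p q L" and F: "null_seq p F" and p: "p > 0" and q: "q > 0"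
  shows "(\<lambda>i. bergman_integral q (L (F i))) \<longlonglongrightarrow> 0"
proof (rule ccontr)
  assume "\<not> (\<lambda>i. bergman_integral q (L (F i))) \<longlonglongrightarrow> 0"
  then obtain \<eta> where \<eta>: "\<eta> > 0" "\<not> eventually (\<lambda>i. bergman_integral q (L (F i)) < \<eta>) sequentially"
    by (auto simp: order_tendsto_iff)
  then have "infinite {i. \<eta> \<le> bergman_integral q (L (F i))}"
    unfolding cofinite_eq_sequentially[symmetric] by (simp add: eventually_cofinite not_less)
  then obtain s :: "nat \<Rightarrow> nat" where s: "strict_mono s" "\<And>i. \<eta> \<le> bergman_integral q (L (F (s i)))"
    using infinite_enumerate by blast
  have Fs: "null_seq p (\<lambda>i. F (s i))" by (rule null_seq_subseq[OF F s(1)])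
  have hol: "F (s i) holomorphic_on unit_disc" for i using Fs by (simp add: null_seq_def)
  obtain M where M: "\<And>i. bergman_integral p (F (s i)) \<le> ennreal M" using Fs by (auto simp: null_seq_def)
  have "bergman_norm p (F (s i)) \<le> (max M 0) powr (1 / p)" for i
    using M[of i] p by (intro bergman_norm_le) (auto simp: powr_powr intro: order_trans ennreal_leI)
  then have "\<exists>r g. strict_mono r \<and> g \<in> bergman_space q \<and>
           (\<lambda>j. bergman_norm q (\<lambda>z. L (F (s (r j))) z - g z)) \<longlonglongrightarrow> 0"
    using cpt null_seq_bergman_space[OF Fs] unfolding compact_op_def by (auto dest!: spec[of _ "\<lambda>i. F (s i)"])
  then obtain r :: "nat \<Rightarrow> nat" and g where r: "strict_mono r" "g \<in> bergman_space q"
    "(\<lambda>j. bergman_norm q (\<lambda>z. L (F (s (r j))) z - g z)) \<longlonglongrightarrow> 0" by blast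
  have g: "g holomorphic_on unit_disc" using r by (simp add: bergman_space_def)
  have maps: "L (F (s i)) \<in> bergman_space q" for i
    using cpt null_seq_bergman_space[OF Fs, of i] by (auto simp: compact_op_def)
  have "bergman_integral q (\<lambda>z. L (F (s (r j))) z - g z) < \<infinity>" for j
    using bergman_space_diff[OF maps r(2) q] by (simp add: bergman_space_def)
  then have lim: "(\<lambda>j. bergman_integral q (\<lambda>z. L (F (s (r j))) z - g z)) \<longlonglongrightarrow> 0"
    using r(3) q by (subst (asm) bergman_norm_tendsto_0_iff) auto
  \<comment> \<open>Fatou compares the two modes of convergence: the differences tend to -g
    pointwise, while their integrals tend to 0.\<close>
  have "bergman_integral q (\<lambda>z. 0 - g z) \<le> liminf (\<lambda>j. bergman_integral q (\<lambda>z. L (F (s (r j))) z - g z))"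
  proof (rule bergman_integral_liminf)
    show "(\<lambda>j. L (F (s (r j))) z - g z) \<longlonglongrightarrow> 0 - g z" if "z \<in> unit_disc" for z
      by (intro tendsto_diff tendsto_const L_pointwise_null[OF null_seq_subseq[OF Fs r(1)] that])
  qed (auto intro: holomorphic_on_diff L_holomorphic hol g q)
  also have "\<dots> = 0" by (rule lim_imp_Liminf[OF _ lim]) simp
  finally have g0: "bergman_integral q g = 0" by (simp add: bergman_integral_uminus)
  have "\<eta> \<le> ennreal (2 powr q) * bergman_integral q (\<lambda>z. L (F (s (r j))) z - g z)" for j
  proof -
    have "\<eta> \<le> bergman_integral q (\<lambda>z. (L (F (s (r j))) z - g z) + g z)" using s(2) by simp
    also have "\<dots> \<le> ennreal (2 powr q) * (bergman_integral q (\<lambda>z. L (F (s (r j))) z - g z) + bergman_integral q g)"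
      by (intro bergman_integral_add_le holomorphic_on_diff L_holomorphic hol g q)
    finally show ?thesis using g0 by simp
  qed
  moreover have "(\<lambda>j. ennreal (2 powr q) * bergman_integral q (\<lambda>z. L (F (s (r j))) z - g z)) \<longlonglongrightarrow> ennreal (2 powr q) * 0"
    by (intro ennreal_tendsto_cmult lim) simp
  ultimately have "\<eta> \<le> ennreal (2 powr q) * 0" by (intro LIMSEQ_le_const) auto
  then show False using \<eta>(1) by simp
qed

text \<open>An unbounded operator has images of functions in the unit ball with arbitrarily large
  norm, whereas a subsequence of these images would converge and hence stay bounded.\<close>

lemma compact_op_imp_bounded_op:
  assumes cpt: "compact_op p q L" and p: "p > 0" and q: "q > 0"
  shows "bounded_op p q L"
proof (rule ccontr)
  assume nb: "\<not> bounded_op p q L"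
  have maps: "L f \<in> bergman_space q" if "f \<in> bergman_space p" for f using cpt that by (auto simp: compact_op_def)
  have "\<exists>f. f \<in> bergman_space p \<and> bergman_norm p f \<le> 1 \<and> bergman_norm q (L f) > real j" for j :: nat
  proof -
    have "\<not> (\<forall>f\<in>bergman_space p. bergman_norm q (L f) \<le> (real j + 1) * bergman_norm p f)"
      using nb maps unfolding bounded_op_def by blast
    then obtain f where f: "f \<in> bergman_space p" "bergman_norm q (L f) > (real j + 1) * bergman_norm p f"
      by (auto simp: not_le)
    have fh: "f holomorphic_on unit_disc" using f by (simp add: bergman_space_def)
    \<comment> \<open>If \<open>f\<close> has norm 0 it cannot be normalised; it can be scaled
      freely instead, here so that its image gets norm j + 1.\<close>
    define c where "c = (if bergman_norm p f = 0 then (real j + 1) / bergman_norm q (L f) else 1 / bergman_norm p f)"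
    have c0: "bergman_norm q (L f) > 0" using f(2) bergman_norm_nonneg[of p f]
      by (smt (verit) mult_nonneg_nonneg of_nat_0_le_iff)
    have c: "c > 0" using c0 bergman_norm_nonneg[of p f] by (auto simp: c_def)
    define h where "h z = of_real c * f z" for z
    have "bergman_norm p h = c * bergman_norm p f" unfolding h_def using bergman_norm_cmult[OF fh p, of "of_real c"] c by simp
    then have h1: "bergman_norm p h \<le> 1" by (simp add: c_def)
    have "bergman_norm q (L h) = bergman_norm q (\<lambda>z. of_real c * L f z)"
      unfolding bergman_norm_def h_def using L_cmult[OF fh]
      by (intro arg_cong2[where f="(powr)"] arg_cong[where f=enn2real] bergman_integral_cong) auto
    also have "\<dots> = c * bergman_norm q (L f)" using bergman_norm_cmult[OF L_holomorphic[OF fh] q, of "of_real c"] c by simp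
    also have "\<dots> > real j"
    proof (cases "bergman_norm p f = 0")
      case False
      then have "bergman_norm p f > 0" using bergman_norm_nonneg[of p f] by simp
      then show ?thesis using f(2) by (simp add: c_def field_simps)
    qed (use c0 in \<open>simp add: c_def\<close>)
    finally have "bergman_norm q (L h) > real j" .
    moreover have "h \<in> bergman_space p"
      using f(1) fh p c unfolding bergman_space_def h_def
      by (auto simp: bergman_integral_cmult ennreal_mult_less_top intro!: holomorphic_intros)
    ultimately show ?thesis using h1 by blast
  qed
  then obtain fs where fs: "\<And>j. fs j \<in> bergman_space p" "\<And>j. bergman_norm p (fs j) \<le> 1" "\<And>j. bergman_norm q (L (fs j)) > real j"
    by metis
  obtain r :: "nat \<Rightarrow> nat" and g where r: "strict_mono r" "g \<in> bergman_space q"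
    "(\<lambda>j. bergman_norm q (\<lambda>z. L (fs (r j)) z - g z)) \<longlonglongrightarrow> 0"
    using cpt fs(1,2) unfolding compact_op_def by meson
  have g: "g holomorphic_on unit_disc" using r by (simp add: bergman_space_def)
  obtain B where B: "\<And>j. bergman_norm q (\<lambda>z. L (fs (r j)) z - g z) \<le> B"
    using convergent_imp_Bseq[OF convergentI[OF r(3)]] unfolding Bseq_def by (metis abs_le_D1 real_norm_def)
  have B0: "B \<ge> 0" using B[of 0] bergman_norm_nonneg order_trans by blast
  define T where "T = 2 powr q * (B powr q + bergman_norm q g powr q)"
  have "bergman_norm q (L (fs (r j))) \<le> T powr (1 / q)" for j
  proof (rule bergman_norm_le)
    have d: "(\<lambda>z. L (fs (r j)) z - g z) \<in> bergman_space q" by (rule bergman_space_diff[OF maps[OF fs(1)] r(2) q])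
    have "bergman_integral q (L (fs (r j))) = bergman_integral q (\<lambda>z. (L (fs (r j)) z - g z) + g z)" by simp
    also have "\<dots> \<le> ennreal (2 powr q) * (bergman_integral q (\<lambda>z. L (fs (r j)) z - g z) + bergman_integral q g)"
      using d g q by (intro bergman_integral_add_le) (auto simp: bergman_space_def)
    also have "\<dots> = ennreal (2 powr q * (bergman_norm q (\<lambda>z. L (fs (r j)) z - g z) powr q + bergman_norm q g powr q))"
      using d r(2) q bergman_integral_eq_norm by (simp add: bergman_space_def ennreal_mult)
    also have "\<dots> \<le> ennreal T"
      unfolding T_def using B bergman_norm_nonneg q by (intro ennreal_leI mult_left_mono add_right_mono powr_mono2) auto
    finally show "bergman_integral q (L (fs (r j))) \<le> ennreal ((T powr (1 / q)) powr q)"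
      using q by (simp add: powr_powr T_def)
  qed (use q in auto)
  moreover obtain j :: nat where "real j > T powr (1 / q)" using reals_Archimedean2 by blast
  moreover have "real (r j) \<ge> real j" using seq_suble[OF r(1)] by simp
  ultimately show False using fs(3)[of "r j"] by (smt (verit))
qed

text \<open>The growth bound makes a bounded sequence a normal family. Montel's theorem gives a
  locally uniform limit, Fatou puts it into A^p, and the differences form a null sequence; the image
  of the limit is the required limit of images.\<close>

lemma compact_opI_null:
  assumes maps: "\<And>f. f \<in> bergman_space p \<Longrightarrow> L f \<in> bergman_space q"
    and null: "\<And>F. null_seq p F \<Longrightarrow> (\<lambda>i. bergman_integral q (L (F i))) \<longlonglongrightarrow> 0"
    and p: "p > 0" and q: "q > 0"
  shows "compact_op p q L"
  unfolding compact_op_def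
proof (intro conjI ballI allI impI)
  fix f assume "f \<in> bergman_space p"
  then show "L f \<in> bergman_space q" by (rule maps)
next
  fix fs :: "nat \<Rightarrow> complex \<Rightarrow> complex"
  assume "(\<forall>j. fs j \<in> bergman_space p) \<and> (\<exists>M. \<forall>j. bergman_norm p (fs j) \<le> M)"
  then obtain M where fs: "\<And>j. fs j \<in> bergman_space p" "\<And>j. bergman_norm p (fs j) \<le> M" by blast
  have M0: "M \<ge> 0" using fs(2)[of 0] bergman_norm_nonneg order_trans by blast
  have bd: "bergman_integral p (fs j) \<le> ennreal (M powr p)" for j
  proof -
    have "bergman_norm p (fs j) powr p \<le> M powr p" using fs(2)[of j] p bergman_norm_nonneg by (intro powr_mono2) auto
    then show ?thesis using fs(1)[of j] p bergman_integral_eq_norm[of p "fs j"]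
      by (simp add: bergman_space_def ennreal_leI)
  qed
  define \<H> where "\<H> = {h. h holomorphic_on unit_disc \<and> bergman_integral p h \<le> ennreal (M powr p)}"
  obtain C where C: "C > 0" "\<And>h w. h \<in> \<H> \<Longrightarrow> norm w < 1 \<Longrightarrow> norm (h w) \<le> C * M * (1 - norm w) powr - (2 / p)"
    using bergman_growth[OF p] M0 unfolding \<H>_def by blast
  have fsh: "fs j holomorphic_on unit_disc" for j using fs by (simp add: bergman_space_def)
  obtain g r where g: "g holomorphic_on unit_disc" and r: "strict_mono (r :: nat \<Rightarrow> nat)"
    and pt: "\<And>x. x \<in> unit_disc \<Longrightarrow> ((\<lambda>n. fs (r n) x) \<longlongrightarrow> g x) sequentially"
    and unif: "\<And>K. compact K \<Longrightarrow> K \<subseteq> unit_disc \<Longrightarrow> uniform_limit K (fs \<circ> r) g sequentially"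
  proof (rule Montel[of unit_disc \<H> fs])
    show "\<exists>B. \<forall>h\<in>\<H>. \<forall>z\<in>K. norm (h z) \<le> B" if K: "compact K" "K \<subseteq> unit_disc" for K
    proof (cases "K = {}")
      case False
      obtain w where w: "w \<in> K" "\<And>z. z \<in> K \<Longrightarrow> norm z \<le> norm w"
        using continuous_attains_sup[OF K(1) False continuous_on_norm_id] by auto
      have w1: "norm w < 1" using w K by auto
      have "norm (h z) \<le> C * M * (1 - norm w) powr - (2 / p)" if "h \<in> \<H>" "z \<in> K" for h z
      proof -
        have "norm (h z) \<le> C * M * (1 - norm z) powr - (2 / p)" using C(2)[OF that(1)] that(2) K by auto
        also have "\<dots> \<le> C * M * (1 - norm w) powr - (2 / p)"
          using w(2)[OF that(2)] w1 C M0 p by (intro mult_left_mono powr_mono2') auto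
        finally show ?thesis .
      qed
      then show ?thesis by blast
    qed simp
  qed (use fsh bd in \<open>auto simp: \<H>_def\<close>)
  have "bergman_integral p g \<le> liminf (\<lambda>j. bergman_integral p (fs (r j)))"
    by (rule bergman_integral_liminf[OF fsh p pt])
  also have "\<dots> \<le> ennreal (M powr p)"
    by (rule Liminf_le) (simp_all add: bd)
  finally have gM: "bergman_integral p g \<le> ennreal (M powr p)" .
  have gp: "g \<in> bergman_space p" using g gM by (auto simp: bergman_space_def intro: le_less_trans)
  have "null_seq p (\<lambda>j z. fs (r j) z - g z)"
    unfolding null_seq_def
  proof (intro conjI allI impI exI[of _ "2 powr p * (M powr p + M powr p)"])
    fix j
    show "(\<lambda>z. fs (r j) z - g z) holomorphic_on unit_disc" by (intro holomorphic_on_diff fsh g)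
    have "bergman_integral p (\<lambda>z. fs (r j) z - g z) \<le> ennreal (2 powr p) * (bergman_integral p (fs (r j)) + bergman_integral p g)"
      by (intro bergman_integral_diff_le fsh g p)
    also have "\<dots> \<le> ennreal (2 powr p) * (ennreal (M powr p) + ennreal (M powr p))"
      by (intro mult_left_mono add_mono bd gM) auto
    finally show "bergman_integral p (\<lambda>z. fs (r j) z - g z) \<le> ennreal (2 powr p * (M powr p + M powr p))"
      by (simp only: ennreal_mult ennreal_plus powr_ge_zero add_nonneg_nonneg)
  next
    fix s :: real assume "s < 1"
    then have "uniform_limit (cball 0 s) (fs \<circ> r) g sequentially" by (intro unif) auto
    then show "uniform_limit (cball 0 s) (\<lambda>j z. fs (r j) z - g z) (\<lambda>_. 0) sequentially"
      by (simp add: uniform_limit_iff dist_norm)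
  qed
  then have lim: "(\<lambda>j. bergman_integral q (L (\<lambda>z. fs (r j) z - g z))) \<longlonglongrightarrow> 0" by (rule null)
  have "bergman_integral q (L (\<lambda>z. fs (r j) z - g z)) = bergman_integral q (\<lambda>z. L (fs (r j)) z - L g z)" for j
    by (intro bergman_integral_cong L_diff fsh g)
  then have lim': "(\<lambda>j. bergman_integral q (\<lambda>z. L (fs (r j)) z - L g z)) \<longlonglongrightarrow> 0" using lim by simp
  have "bergman_integral q (\<lambda>z. L (fs (r j)) z - L g z) < \<infinity>" for j
    using bergman_space_diff[OF maps[OF fs(1)] maps[OF gp] q] by (simp add: bergman_space_def)
  then have "(\<lambda>j. bergman_norm q (\<lambda>z. L (fs (r j)) z - L g z)) \<longlonglongrightarrow> 0"
    using lim' q by (subst bergman_norm_tendsto_0_iff) auto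
  then show "\<exists>r g. strict_mono r \<and> g \<in> bergman_space q \<and> (\<lambda>j. bergman_norm q (\<lambda>z. L (fs (r j)) z - g z)) \<longlonglongrightarrow> 0"
    using r maps[OF gp] by blast
qed

end

section \<open>Atoms and local means\<close>

text \<open>A power of the kernel normalised so that its modulus is at most 1 on the disc and
  comparable to 1 near \<open>a\<close>. The exponent is the only parameter that varies between test
  functions at one point.\<close>

definition atom :: "nat \<Rightarrow> complex \<Rightarrow> complex \<Rightarrow> complex" where
  "atom m a z = of_real ((1 - norm a) ^ m) * inverse (1 - cnj a * z) ^ m"

lemma kernel_nonzero: "norm a < 1 \<Longrightarrow> z \<in> unit_disc \<Longrightarrow> 1 - cnj a * z \<noteq> 0"
  using kernel_pos[of a z] by force

lemma atom_holomorphic: "norm a < 1 \<Longrightarrow> atom m a holomorphic_on unit_disc"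
  unfolding atom_def using kernel_nonzero by (intro holomorphic_intros) auto

lemma norm_atom:
  assumes "norm a \<le> 1"
  shows "norm (atom m a z) = ((1 - norm a) / norm (1 - cnj a * z)) ^ m"
  using assms
  by (simp add: atom_def norm_mult norm_power norm_inverse power_mult_distrib power_inverse divide_inverse
      del: of_real_power of_real_diff)

lemma norm_atom_le:
  assumes "norm a < 1" "z \<in> unit_disc" "N \<le> m"
  shows "norm (atom m a z) \<le> ((1 - norm a) / norm (1 - cnj a * z)) ^ N"
proof -
  have "(1 - norm a) / norm (1 - cnj a * z) \<le> 1"
    using assms one_minus_norm_le_kernel(1)[of a z] kernel_pos[of a z] by simp
  then show ?thesis using assms by (simp add: norm_atom power_decreasing)
qed

text \<open>Each differentiation contributes the current exponent, and these build up the rising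
  factorial. The point \<open>z\<close> is generalised in the induction because the next derivative
  needs the formula in a neighbourhood.\<close>

lemma higher_deriv_inverse_power:
  assumes z: "b * z \<noteq> (1 :: complex)"
  shows "(deriv ^^ k) (\<lambda>z. inverse (1 - b * z) ^ m) z = pochhammer (of_nat m) k * b ^ k * inverse (1 - b * z) ^ (m + k)"
  using z
proof (induction k arbitrary: z)
  case 0
  then show ?case by simp
next
  case (Suc k)
  have "open {z. b * z \<noteq> 1}" by (intro open_Collect_neq continuous_intros)
  then have "eventually (\<lambda>w. b * w \<noteq> 1) (nhds z)" using Suc.prems by (simp add: eventually_nhds_in_open[of "{z. b * z \<noteq> 1}", simplified])
  then have "eventually (\<lambda>w. (deriv ^^ k) (\<lambda>z. inverse (1 - b * z) ^ m) w
      = pochhammer (of_nat m) k * b ^ k * inverse (1 - b * w) ^ (m + k)) (nhds z)"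
    by eventually_elim (rule Suc.IH)
  then have "deriv ((deriv ^^ k) (\<lambda>z. inverse (1 - b * z) ^ m)) z
      = deriv (\<lambda>w. pochhammer (of_nat m) k * b ^ k * inverse (1 - b * w) ^ (m + k)) z"
    by (rule deriv_cong_ev) simp
  also have "\<dots> = pochhammer (of_nat m) k * b ^ k * (of_nat (m + k) * inverse (1 - b * z) ^ (m + k + 1) * b)"
  proof (rule DERIV_imp_deriv)
    have "1 - b * z \<noteq> 0" using Suc.prems by simp
    then have "((\<lambda>w. inverse (1 - b * w) ^ (m + k)) has_field_derivative
        of_nat (m + k) * inverse (1 - b * z) ^ (m + k + 1) * b) (at z)"
    proof -
      assume nz: "1 - b * z \<noteq> 0"
      have "((\<lambda>w. inverse (1 - b * w)) has_field_derivative inverse (1 - b * z) * b * inverse (1 - b * z)) (at z)"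
        using nz by (auto intro!: derivative_eq_intros)
      from DERIV_power[OF this, of "m + k"] show ?thesis
        by (cases "m + k") (auto simp: mult_ac)
    qed
    then show "((\<lambda>w. pochhammer (of_nat m) k * b ^ k * inverse (1 - b * w) ^ (m + k)) has_field_derivative
        pochhammer (of_nat m) k * b ^ k * (of_nat (m + k) * inverse (1 - b * z) ^ (m + k + 1) * b)) (at z)"
      by (rule DERIV_cmult)
  qed
  finally show ?case by (simp add: pochhammer_Suc algebra_simps)
qed

text \<open>The crucial structure: apart from the common factor \<open>atom m a z\<close>, the
  exponent \<open>m\<close> enters only through the Pochhammer symbol, and the remaining k-th power
  does not depend on \<open>m\<close>.\<close>

lemma higher_deriv_atom:
  assumes a: "norm a < 1" and z: "z \<in> unit_disc"
  shows "(deriv ^^ k) (atom m a) z = pochhammer (of_nat m) k * (cnj a / (1 - cnj a * z)) ^ k * atom m a z"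
proof -
  have nz: "cnj a * w \<noteq> 1" if "w \<in> unit_disc" for w using kernel_nonzero[OF a that] by auto
  have "(\<lambda>z. inverse (1 - cnj a * z) ^ m) holomorphic_on unit_disc"
    using kernel_nonzero[OF a] by (intro holomorphic_intros) auto
  then have "(deriv ^^ k) (atom m a) z = of_real ((1 - norm a) ^ m) * (deriv ^^ k) (\<lambda>z. inverse (1 - cnj a * z) ^ m) z"
    unfolding atom_def by (rule higher_deriv_cmult[OF _ z open_ball])
  then show ?thesis
    by (simp add: higher_deriv_inverse_power[OF nz[OF z]] atom_def power_add divide_inverse power_mult_distrib)
qed

text \<open>The coefficient of the atom at \<open>a\<close>; the normalisation by (1 - |a|)^2
  instead of the area changes it by a constant factor only. The radius (1 - |a|) / 2 leaves a margin
  of (1 - |a|) / 6 around points of the covering ball of radius (1 - |a|) / 3.\<close>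

definition local_mean :: "real \<Rightarrow> (complex \<Rightarrow> complex) \<Rightarrow> complex \<Rightarrow> real" where
  "local_mean p f a = (enn2real (powr_integral (ball a ((1 - norm a) / 2)) p f)
     / (1 - norm a)\<^sup>2) powr (1 / p)"

lemma local_mean_nonneg: "local_mean p f a \<ge> 0"
  by (simp add: local_mean_def)

lemma half_ball_subset:
  assumes "norm a < 1"
  shows "ball a ((1 - norm a) / 2) \<subseteq> unit_disc" "z \<in> ball a ((1 - norm a) / 2) \<Longrightarrow> norm z \<le> (1 + norm a) / 2"
proof -
  show *: "norm z \<le> (1 + norm a) / 2" if "z \<in> ball a ((1 - norm a) / 2)" for z
    using that norm_triangle_sub[of z a] by (simp add: dist_norm norm_minus_commute)
  show "ball a ((1 - norm a) / 2) \<subseteq> unit_disc" using * assms by fastforce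
qed

lemma local_mean_integral:
  assumes p: "p > 0" and a: "norm a < 1" and fin: "bergman_integral p f < \<infinity>"
  shows "(powr_integral (ball a ((1 - norm a) / 2)) p f)
     = ennreal (local_mean p f a powr p * (1 - norm a)\<^sup>2)" (is "?J = _")
proof -
  have "?J \<le> powr_integral unit_disc p f"
    using half_ball_subset(1)[OF a] by (intro nn_integral_mono) (auto simp: indicator_def)
  also have "\<dots> < \<infinity>" unfolding disc_integral_eq_bergman_integral using fin by (simp add: ennreal_mult_less_top)
  finally have "?J < \<infinity>" .
  then have "?J = ennreal (enn2real ?J)" by simp
  moreover have "local_mean p f a powr p * (1 - norm a)\<^sup>2 = enn2real ?J"
    using p a by (simp add: local_mean_def powr_powr)
  ultimately show ?thesis by simp
qed

lemma local_mean_le: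
  assumes p: "p > 0" and a: "norm a < 1" and M: "M \<ge> 0" "bergman_integral p f \<le> ennreal (M powr p)"
  shows "local_mean p f a \<le> pi powr (1 / p) * M * (1 - norm a) powr - (2 / p)"
proof -
  have fin: "bergman_integral p f < \<infinity>" using M(2) by (auto intro: le_less_trans)
  have "ennreal (local_mean p f a powr p * (1 - norm a)\<^sup>2)
      \<le> powr_integral unit_disc p f"
    unfolding local_mean_integral[OF p a fin, symmetric]
    using half_ball_subset(1)[OF a] by (intro nn_integral_mono) (auto simp: indicator_def)
  also have "\<dots> \<le> ennreal pi * ennreal (M powr p)"
    unfolding disc_integral_eq_bergman_integral by (intro mult_left_mono M) simp
  also have "\<dots> = ennreal (pi * M powr p)" by (simp add: ennreal_mult)
  finally have "local_mean p f a powr p * (1 - norm a)\<^sup>2 \<le> pi * M powr p" by simp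
  then have "local_mean p f a powr p \<le> pi * M powr p * (1 - norm a) powr - 2"
    using a by (simp add: powr_minus field_simps)
  then have "(local_mean p f a powr p) powr (1 / p) \<le> (pi * M powr p * (1 - norm a) powr - 2) powr (1 / p)"
    using p by (intro powr_mono2) auto
  also have "\<dots> = pi powr (1 / p) * (M powr p) powr (1 / p) * ((1 - norm a) powr - 2) powr (1 / p)"
    by (simp only: powr_mult)
  also have "\<dots> = pi powr (1 / p) * M * (1 - norm a) powr - (2 / p)" using M p by (simp add: powr_powr)
  finally show ?thesis using p local_mean_nonneg[of p f a] by (simp add: powr_powr)
qed

lemma local_mean_le_bound:
  assumes p: "p > 0" and a: "norm a < 1" and fin: "bergman_integral p f < \<infinity>"
    and B: "B \<ge> 0" "\<And>z. norm z \<le> (1 + norm a) / 2 \<Longrightarrow> norm (f z) \<le> B"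
  shows "local_mean p f a \<le> B"
proof -
  have "ennreal (local_mean p f a powr p * (1 - norm a)\<^sup>2)
      \<le> (\<integral>\<^sup>+z. ennreal (B powr p) * indicator (ball a ((1 - norm a) / 2)) z \<partial>lborel)"
    unfolding local_mean_integral[OF p a fin, symmetric]
  proof (rule nn_integral_mono)
    fix z
    show "indicator (ball a ((1 - norm a) / 2)) z * ennreal (norm (f z) powr p)
        \<le> ennreal (B powr p) * indicator (ball a ((1 - norm a) / 2)) z"
    proof (cases "z \<in> ball a ((1 - norm a) / 2)")
      case True
      then have "norm (f z) powr p \<le> B powr p" using B(2)[OF half_ball_subset(2)[OF a True]] p by (intro powr_mono2) auto
      then show ?thesis using True by (simp add: ennreal_leI)
    qed simp
  qed
  also have "\<dots> = ennreal (B powr p * (pi * ((1 - norm a) / 2)\<^sup>2))"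
    using a by (simp add: nn_integral_cmult_indicator emeasure_ball_complex ennreal_mult)
  finally have "local_mean p f a powr p * (1 - norm a)\<^sup>2 \<le> B powr p * (pi * ((1 - norm a) / 2)\<^sup>2)"
    by simp
  then have "local_mean p f a powr p \<le> B powr p * (pi / 4)" using a by (simp add: power_divide)
  \<comment> \<open>The ball has area pi / 4 times (1 - |a|)^2, so the mean is bounded by
    \<open>B\<close> without an extra constant.\<close>
  also have "\<dots> \<le> B powr p * 1" using pi_less_4 by (intro mult_left_mono) auto
  finally have "local_mean p f a powr p \<le> B powr p" by simp
  from powr_mono2[OF _ powr_ge_zero this, of "1 / p"]
  have "(local_mean p f a powr p) powr (1 / p) \<le> (B powr p) powr (1 / p)" using p by simp
  then show ?thesis using p B(1) local_mean_nonneg[of p f a] by (simp add: powr_powr)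
qed

text \<open>Bounded overlap of the half-size balls: the coefficients, with weights (1 - |a|)^2, have
  an l^p sum controlled by the norm of \<open>f\<close>. This is the right-hand side that occurs in
  the estimate for sums of atoms.\<close>

lemma sum_local_mean_le:
  assumes p: "p > 0" and S: "separated S" and f: "f holomorphic_on unit_disc"
    and M: "bergman_integral p f \<le> ennreal (M powr p)"
  shows "(\<Sum>a\<in>S. local_mean p f a powr p * (1 - norm a)\<^sup>2) \<le> 225 * pi * M powr p"
proof -
  have fin: "bergman_integral p f < \<infinity>" using M by (auto intro: le_less_trans)
  have "ennreal (\<Sum>a\<in>S. local_mean p f a powr p * (1 - norm a)\<^sup>2)
     = (\<Sum>a\<in>S. ennreal (local_mean p f a powr p * (1 - norm a)\<^sup>2))"
    by (simp add: sum_ennreal)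
  also have "\<dots> = (\<Sum>a\<in>S. powr_integral (ball a ((1 - norm a) / 2)) p f)"
    by (intro sum.cong refl local_mean_integral[symmetric] p fin separated_norm_less[OF S])
  also have "\<dots> \<le> 225 * powr_integral unit_disc p f"
    using p half_ball_subset(1)[OF separated_norm_less[OF S]]
    by (intro separated_sum_integral_half_le S borel_measurable_holomorphic_powr[OF f]) auto
  also have "\<dots> \<le> 225 * (ennreal pi * ennreal (M powr p))"
    unfolding disc_integral_eq_bergman_integral by (intro mult_left_mono M) auto
  also have "\<dots> = ennreal (225 * pi * M powr p)"
    by (subst ennreal_numeral[symmetric]) (simp only: ennreal_mult[symmetric] mult.assoc pi_ge_zero powr_ge_zero zero_le_numeral mult_nonneg_nonneg)
  finally show ?thesis by (subst (asm) ennreal_le_iff) auto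
qed

text \<open>The ball of radius (1 - |a|) / 6 about \<open>w\<close> lies in the averaging ball,
  since 1/3 + 1/6 = 1/2. The constants 6^k and 36 come from this radius.\<close>

lemma deriv_le_local_mean:
  assumes p: "p > 0"
  shows "\<exists>C>0. \<forall>f a w. f holomorphic_on unit_disc \<longrightarrow> bergman_integral p f < \<infinity> \<longrightarrow> norm a < 1 \<longrightarrow>
     dist a w \<le> (1 - norm a) / 3 \<longrightarrow> (1 - norm a) ^ k * norm ((deriv ^^ k) f w) \<le> C * local_mean p f a"
proof -
  obtain C where C: "C > 0" "\<And>f w R. f holomorphic_on ball w R \<Longrightarrow> R > 0 \<Longrightarrow>
    ennreal (R\<^sup>2 * (R ^ k * norm ((deriv ^^ k) f w)) powr p)
      \<le> ennreal C * powr_integral (ball w R) p f"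
    using deriv_sub_mean_value[OF p, of k] by blast
  show ?thesis
  proof (intro exI[of _ "6 ^ k * (36 * C) powr (1 / p)"] conjI allI impI)
    show "6 ^ k * (36 * C) powr (1 / p) > 0" using C by simp
    fix f and a w :: complex assume f: "f holomorphic_on unit_disc" and fin: "bergman_integral p f < \<infinity>" and a: "norm a < 1"
      and w: "dist a w \<le> (1 - norm a) / 3"
    define R where "R = (1 - norm a) / 6"
    have R: "R > 0" using a by (simp add: R_def)
    have sub: "ball w R \<subseteq> ball a ((1 - norm a) / 2)"
    proof
      fix z assume "z \<in> ball w R"
      then show "z \<in> ball a ((1 - norm a) / 2)" using w dist_triangle[of a z w] by (simp add: R_def)
    qed
    define D where "D = R ^ k * norm ((deriv ^^ k) f w)"
    have D: "D \<ge> 0" using R by (simp add: D_def)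
    have "ennreal (R\<^sup>2 * D powr p) \<le> ennreal C * powr_integral (ball w R) p f"
      unfolding D_def using sub half_ball_subset(1)[OF a] R by (intro C(2) holomorphic_on_subset[OF f]) auto
    also have "\<dots> \<le> ennreal C * (powr_integral (ball a ((1 - norm a) / 2)) p f)"
      using sub by (intro mult_left_mono nn_integral_mono) (auto simp: indicator_def)
    also have "\<dots> = ennreal (C * (local_mean p f a powr p * (1 - norm a)\<^sup>2))"
      unfolding local_mean_integral[OF p a fin] using C by (simp add: ennreal_mult)
    finally have "R\<^sup>2 * D powr p \<le> C * (local_mean p f a powr p * (1 - norm a)\<^sup>2)" using C by simp
    also have "(1 - norm a)\<^sup>2 = 36 * R\<^sup>2" by (simp add: R_def power_divide)
    finally have "R\<^sup>2 * D powr p \<le> R\<^sup>2 * (36 * C * local_mean p f a powr p)" by (simp add: mult_ac)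
    then have "D powr p \<le> 36 * C * local_mean p f a powr p" using R by simp
    then have "(D powr p) powr (1 / p) \<le> (36 * C * local_mean p f a powr p) powr (1 / p)"
      using p by (intro powr_mono2) auto
    also have "\<dots> = (36 * C) powr (1 / p) * (local_mean p f a powr p) powr (1 / p)" by (simp only: powr_mult)
    finally have "D \<le> (36 * C) powr (1 / p) * local_mean p f a"
      using p D local_mean_nonneg[of p f a] by (simp add: powr_powr)
    then show "(1 - norm a) ^ k * norm ((deriv ^^ k) f w) \<le> 6 ^ k * (36 * C) powr (1 / p) * local_mean p f a"
      by (simp add: D_def R_def power_divide field_simps)
  qed
qed

section \<open>Recovering the coefficients from the values of \<open>L\<close> at atoms\<close>

context weighted_sum
begin

lemma L_atom:
  assumes a: "norm a < 1" and z: "z \<in> unit_disc"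
  shows "L (atom m a) z = atom m a (\<phi> z) * (\<Sum>k\<le>n. pochhammer (of_nat m) k * (us k z * (cnj a / (1 - cnj a * \<phi> z)) ^ k))"
  unfolding L_eq higher_deriv_atom[OF a phi_in[OF z]] by (simp add: sum_distrib_left mult_ac)

text \<open>With the common factor \<open>atom (N + m) a (\<phi> z)\<close> divided out, the values
  of \<open>L\<close> at the atoms are the Pochhammer matrix applied to the vector
  \<open>us j z * (cnj a / (1 - cnj a * \<phi> z)) ^ j\<close>. The interpolation bound inverts it
  uniformly in \<open>a\<close> and \<open>z\<close>.\<close>

lemma coefficient_bound:
  "\<exists>C>0. \<forall>a z. \<forall>k\<le>n. norm a < 1 \<longrightarrow> z \<in> unit_disc \<longrightarrow>
     norm (us k z) * (norm a / norm (1 - cnj a * \<phi> z)) ^ k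
       \<le> C * (\<Sum>m\<le>n. (norm (1 - cnj a * \<phi> z) / (1 - norm a)) ^ (N + m) * norm (L (atom (N + m) a) z))"
proof -
  obtain C where C: "C \<ge> 0" "\<And>y :: nat \<Rightarrow> complex. \<And>k. k \<le> n \<Longrightarrow>
     norm (y k) \<le> C * (\<Sum>m\<le>n. norm (\<Sum>j\<le>n. pochhammer (of_nat (N + m)) j * y j))"
    using pochhammer_interpolation_bound[of n N] by blast
  have "norm (us k z) * (norm a / norm (1 - cnj a * \<phi> z)) ^ k
       \<le> (C + 1) * (\<Sum>m\<le>n. (norm (1 - cnj a * \<phi> z) / (1 - norm a)) ^ (N + m) * norm (L (atom (N + m) a) z))"
    if k: "k \<le> n" and a: "norm a < 1" and z: "z \<in> unit_disc" for a z k
  proof -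
    have pos: "norm (1 - cnj a * \<phi> z) > 0" "1 - norm a > 0" using kernel_pos[of a "\<phi> z"] a phi_in[OF z] by auto
    define y where "y j = us j z * (cnj a / (1 - cnj a * \<phi> z)) ^ j" for j
    have "norm (\<Sum>j\<le>n. pochhammer (of_nat (N + m)) j * y j)
       = (norm (1 - cnj a * \<phi> z) / (1 - norm a)) ^ (N + m) * norm (L (atom (N + m) a) z)" for m
    proof -
      have "norm (L (atom (N + m) a) z) = ((1 - norm a) / norm (1 - cnj a * \<phi> z)) ^ (N + m) * norm (\<Sum>j\<le>n. pochhammer (of_nat (N + m)) j * y j)"
        unfolding L_atom[OF a z] y_def norm_mult using a by (subst norm_atom) auto
      moreover have "(norm (1 - cnj a * \<phi> z) / (1 - norm a)) ^ (N + m) * ((1 - norm a) / norm (1 - cnj a * \<phi> z)) ^ (N + m) = 1"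
        unfolding power_mult_distrib[symmetric] using pos by simp
      ultimately show ?thesis by (simp only: mult.assoc[symmetric] mult_1)
    qed
    then have "norm (y k) \<le> C * (\<Sum>m\<le>n. (norm (1 - cnj a * \<phi> z) / (1 - norm a)) ^ (N + m) * norm (L (atom (N + m) a) z))"
      using C(2)[OF k, of y] by simp
    also have "\<dots> \<le> (C + 1) * (\<Sum>m\<le>n. (norm (1 - cnj a * \<phi> z) / (1 - norm a)) ^ (N + m) * norm (L (atom (N + m) a) z))"
      using pos by (intro mult_right_mono sum_nonneg) auto
    finally show ?thesis by (simp add: y_def norm_mult norm_power norm_divide)
  qed
  then show ?thesis using C(1) by (intro exI[of _ "C + 1"]) auto
qed

text \<open>For a = 1/2 the kernel has modulus between 1/2 and 3/2 on the whole disc, so every power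
  involved is bounded above and below and the estimate holds for all \<open>z\<close> at
  once.\<close>

lemma coefficient_bound_half:
  "\<exists>C>0. \<forall>z\<in>unit_disc. \<forall>k\<le>n. norm (us k z) \<le> C * (\<Sum>m\<le>n. norm (L (atom (N + m) (1 / 2)) z))"
proof -
  obtain C where C: "C > 0" "\<And>a z k. k \<le> n \<Longrightarrow> norm a < 1 \<Longrightarrow> z \<in> unit_disc \<Longrightarrow>
     norm (us k z) * (norm a / norm (1 - cnj a * \<phi> z)) ^ k
       \<le> C * (\<Sum>m\<le>n. (norm (1 - cnj a * \<phi> z) / (1 - norm a)) ^ (N + m) * norm (L (atom (N + m) a) z))"
    using coefficient_bound[of N] by blast
  have "norm (us k z) \<le> 3 ^ n * C * 3 ^ (N + n) * (\<Sum>m\<le>n. norm (L (atom (N + m) (1 / 2)) z))"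
    if z: "z \<in> unit_disc" and k: "k \<le> n" for z k
  proof -
    define d where "d = norm (1 - cnj (1 / 2) * \<phi> z)"
    have d: "d \<ge> 1 / 2" "d \<le> 3 / 2"
    proof -
      show "d \<ge> 1 / 2" using one_minus_norm_le_kernel(1)[of "1/2" "\<phi> z"] phi_in[OF z] by (simp add: d_def)
      have "d \<le> norm (1::complex) + norm (cnj (1 / 2) * \<phi> z)" unfolding d_def by (rule norm_triangle_ineq4)
      then show "d \<le> 3 / 2" using phi_in[OF z] by (simp add: norm_mult)
    qed
    have "(1 / 3 :: real) ^ n \<le> (1 / 3) ^ k" using k by (intro power_decreasing) auto
    also have "\<dots> \<le> (1 / 2 / d) ^ k" using d by (intro power_mono) (auto simp: field_simps)
    finally have low: "(1 / 3 :: real) ^ n \<le> (1 / 2 / d) ^ k" .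
    have "norm (us k z) * (1 / 3) ^ n \<le> norm (us k z) * (1 / 2 / d) ^ k" by (intro mult_left_mono low) auto
    also have "\<dots> \<le> C * (\<Sum>m\<le>n. (d / (1 - 1 / 2)) ^ (N + m) * norm (L (atom (N + m) (1 / 2)) z))"
      using C(2)[OF k _ z, of "1 / 2"] by (simp add: d_def)
    also have "\<dots> \<le> C * (\<Sum>m\<le>n. 3 ^ (N + n) * norm (L (atom (N + m) (1 / 2)) z))"
    proof (intro mult_left_mono sum_mono mult_right_mono)
      fix m assume "m \<in> {..n}"
      have "(d / (1 - 1 / 2)) ^ (N + m) \<le> 3 ^ (N + m)" using d by (intro power_mono) auto
      also have "(3::real) ^ (N + m) \<le> 3 ^ (N + n)" using \<open>m \<in> {..n}\<close> by (intro power_increasing) auto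
      finally show "(d / (1 - 1 / 2)) ^ (N + m) \<le> 3 ^ (N + n)" .
    qed (use C in auto)
    finally have "3 ^ n * (norm (us k z) * (1 / 3) ^ n) \<le> 3 ^ n * (C * (\<Sum>m\<le>n. 3 ^ (N + n) * norm (L (atom (N + m) (1 / 2)) z)))"
      by (rule mult_left_mono) simp
    then show ?thesis by (simp add: sum_distrib_left[symmetric] power_one_over mult_ac)
  qed
  then show ?thesis using C(1) by (intro exI[of _ "3 ^ n * C * 3 ^ (N + n)"]) auto
qed

text \<open>Here 1 - cnj a (phi z) = 1 - |a|^2 + cnj a (a - phi z) has modulus at most 3 (1 - |a|).
  Together with |a| at least 1/2 this gives the lower bound 1 / (6 (1 - |a|)) for the ratio raised
  to the power k, and 3 for the base of the powers on the right.\<close>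

lemma coefficient_bound_near:
  "\<exists>C>0. \<forall>a. \<forall>z\<in>unit_disc. \<forall>k\<le>n. norm a < 1 \<longrightarrow> 1 / 2 \<le> norm a \<longrightarrow> dist a (\<phi> z) \<le> (1 - norm a) / 3 \<longrightarrow>
     norm (us k z) \<le> C * (1 - norm a) ^ k * (\<Sum>m\<le>n. norm (L (atom (N + m) a) z))"
proof -
  obtain C where C: "C > 0" "\<And>a z k. k \<le> n \<Longrightarrow> norm a < 1 \<Longrightarrow> z \<in> unit_disc \<Longrightarrow>
     norm (us k z) * (norm a / norm (1 - cnj a * \<phi> z)) ^ k
       \<le> C * (\<Sum>m\<le>n. (norm (1 - cnj a * \<phi> z) / (1 - norm a)) ^ (N + m) * norm (L (atom (N + m) a) z))"
    using coefficient_bound[of N] by blast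
  have "norm (us k z) \<le> (6 ^ n * C * 3 ^ (N + n)) * (1 - norm a) ^ k * (\<Sum>m\<le>n. norm (L (atom (N + m) a) z))"
    if z: "z \<in> unit_disc" and k: "k \<le> n" and a: "norm a < 1" "1 / 2 \<le> norm a" "dist a (\<phi> z) \<le> (1 - norm a) / 3" for a z k
  proof -
    define e where "e = 1 - norm a"
    have e: "e > 0" using a by (simp add: e_def)
    define d where "d = norm (1 - cnj a * \<phi> z)"
    have d0: "d > 0" using kernel_pos[of a "\<phi> z"] a phi_in[OF z] by (simp add: d_def)
    have d: "d \<le> 3 * e"
    proof -
      have "1 - cnj a * \<phi> z = of_real (1 - (norm a)\<^sup>2) + cnj a * (a - \<phi> z)"
        unfolding of_real_diff complex_norm_square by (simp add: algebra_simps)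
      then have "d \<le> norm (of_real (1 - (norm a)\<^sup>2) :: complex) + norm (cnj a * (a - \<phi> z))"
        unfolding d_def by (metis norm_triangle_ineq)
      also have "norm (of_real (1 - (norm a)\<^sup>2) :: complex) = e * (1 + norm a)"
      proof -
        have "1 - (norm a)\<^sup>2 = e * (1 + norm a)" by (simp add: e_def power2_eq_square algebra_simps)
        moreover have "e * (1 + norm a) \<ge> 0" using e by simp
        ultimately show ?thesis by (simp only: norm_of_real abs_of_nonneg)
      qed
      also have "e * (1 + norm a) \<le> e * 2" using e a by (intro mult_left_mono) auto
      also have "norm (cnj a * (a - \<phi> z)) \<le> 1 * (e / 3)"
        unfolding norm_mult using a by (intro mult_mono) (auto simp: e_def dist_norm)
      finally show ?thesis using e by simp
    qed
    have "(1 / 6 :: real) ^ n * inverse e ^ k \<le> (1 / 6) ^ k * inverse e ^ k"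
      using k e by (intro mult_right_mono power_decreasing) auto
    also have "\<dots> = (1 / 2 / (3 * e)) ^ k"
      unfolding power_mult_distrib[symmetric] by (rule arg_cong[where f="\<lambda>x. x ^ k"]) (simp add: inverse_eq_divide)
    also have "\<dots> \<le> (norm a / d) ^ k" using a d d0 e by (intro power_mono frac_le) auto
    finally have low: "(1 / 6 :: real) ^ n * inverse e ^ k \<le> (norm a / d) ^ k" .
    have "norm (us k z) * ((1 / 6) ^ n * inverse e ^ k) \<le> norm (us k z) * (norm a / d) ^ k" by (intro mult_left_mono low) auto
    also have "\<dots> \<le> C * (\<Sum>m\<le>n. (d / e) ^ (N + m) * norm (L (atom (N + m) a) z))"
      using C(2)[OF k a(1) z] by (simp add: d_def e_def)
    also have "\<dots> \<le> C * (\<Sum>m\<le>n. 3 ^ (N + n) * norm (L (atom (N + m) a) z))"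
    proof (intro mult_left_mono sum_mono mult_right_mono)
      fix m assume "m \<in> {..n}"
      have "(d / e) ^ (N + m) \<le> 3 ^ (N + m)" using d d0 e by (intro power_mono) (auto simp: field_simps)
      also have "(3::real) ^ (N + m) \<le> 3 ^ (N + n)" using \<open>m \<in> {..n}\<close> by (intro power_increasing) auto
      finally show "(d / e) ^ (N + m) \<le> 3 ^ (N + n)" .
    qed (use C in auto)
    finally have le: "(6 ^ n * e ^ k) * (norm (us k z) * ((1 / 6) ^ n * inverse e ^ k))
        \<le> (6 ^ n * e ^ k) * (C * (\<Sum>m\<le>n. 3 ^ (N + n) * norm (L (atom (N + m) a) z)))"
      using e by (intro mult_left_mono) auto
    have eq: "(6 ^ n * e ^ k) * (norm (us k z) * ((1 / 6) ^ n * inverse e ^ k)) = norm (us k z)"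
      using e by (simp add: power_one_over power_inverse field_simps)
    show ?thesis using le unfolding eq by (simp add: sum_distrib_left[symmetric] mult_ac e_def)
  qed
  then show ?thesis using C(1) by (intro exI[of _ "6 ^ n * C * 3 ^ (N + n)"]) auto
qed

end

section \<open>Estimates for the single summands\<close>

lemma finite_has_maximum:
  fixes g :: "'a \<Rightarrow> 'b::linorder"
  assumes "finite X" "X \<noteq> {}"
  shows "\<exists>x\<in>X. \<forall>y\<in>X. g y \<le> g x"
proof -
  have "Max (g ` X) \<in> g ` X" using assms by (intro Max_in) auto
  then obtain x where x: "x \<in> X" "Max (g ` X) = g x" by blast
  moreover have "g y \<le> Max (g ` X)" if "y \<in> X" for y using that assms by (intro Max_ge) auto
  ultimately show ?thesis by auto
qed

text \<open>Here \<open>m\<close> is the full exponent: the sums F of the overview are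
  \<open>atom_sum p f (N + m) A\<close>.\<close>

definition atom_sum :: "real \<Rightarrow> (complex \<Rightarrow> complex) \<Rightarrow> nat \<Rightarrow> complex set \<Rightarrow> complex \<Rightarrow> complex" where
  "atom_sum p f m A z = (\<Sum>a\<in>A. of_real (local_mean p f a) * atom m a z)"

lemma atom_sum_holomorphic:
  assumes "separated A"
  shows "atom_sum p f m A holomorphic_on unit_disc"
  unfolding atom_sum_def using separated_norm_less[OF assms]
  by (intro holomorphic_on_sum holomorphic_on_mult holomorphic_on_const atom_holomorphic)

lemma norm_atom_sum_le:
  assumes A: "separated A" and z: "z \<in> unit_disc" and Nm: "N \<le> m"
  shows "norm (atom_sum p f m A z) \<le> (\<Sum>a\<in>A. local_mean p f a * ((1 - norm a) / norm (1 - cnj a * z)) ^ N)"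
proof -
  have "norm (atom_sum p f m A z) \<le> (\<Sum>a\<in>A. norm (of_real (local_mean p f a) * atom m a z))"
    unfolding atom_sum_def by (rule norm_sum)
  also have "\<dots> = (\<Sum>a\<in>A. local_mean p f a * norm (atom m a z))"
    by (simp add: norm_mult local_mean_nonneg)
  also have "\<dots> \<le> (\<Sum>a\<in>A. local_mean p f a * ((1 - norm a) / norm (1 - cnj a * z)) ^ N)"
    using separated_norm_less[OF A] by (intro sum_mono mult_left_mono norm_atom_le z Nm local_mean_nonneg) auto
  finally show ?thesis .
qed

text \<open>Atom estimate and overlap bound combined. The constant is the same for all exponents
  from \<open>N\<close> on, because an atom is bounded by 1 and larger exponents only decrease it,
  and for all separated \<open>A\<close>.\<close>

lemma atom_sum_bergman_le:
  fixes p :: real and N :: nat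
  assumes p: "p > 0" and N: "N * p > 2" "N \<ge> 2" "p > 1 \<Longrightarrow> N \<ge> 2 + 1 / (2 * (p - 1))"
  shows "\<exists>C>0. \<forall>f M m A. f holomorphic_on unit_disc \<longrightarrow> bergman_integral p f \<le> ennreal (M powr p) \<longrightarrow>
    N \<le> m \<longrightarrow> separated A \<longrightarrow> bergman_integral p (atom_sum p f m A) \<le> ennreal (C * M powr p)"
proof -
  obtain C where C: "C > 0" "\<And>S c. separated S \<Longrightarrow> \<forall>a\<in>S. 0 \<le> c a \<Longrightarrow>
    (\<integral>\<^sup>+z. indicator (ball 0 1) z * ennreal ((\<Sum>a\<in>S. c a * ((1 - norm a) / norm (1 - cnj a * z)) ^ N) powr p) \<partial>lborel)
      \<le> ennreal (C * (\<Sum>a\<in>S. c a powr p * (1 - norm a)\<^sup>2))"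
    using atoms_norm_le[OF p N] by blast
  show ?thesis
  proof (intro exI[of _ "225 * C"] conjI allI impI)
    show "225 * C > 0" using C by simp
    fix f M m A assume f: "f holomorphic_on unit_disc" and M: "bergman_integral p f \<le> ennreal (M powr p)"
      and m: "N \<le> m" and A: "separated A"
    have "powr_integral unit_disc p (atom_sum p f m A)
      \<le> (\<integral>\<^sup>+z. indicator (ball 0 1) z * ennreal ((\<Sum>a\<in>A. local_mean p f a * ((1 - norm a) / norm (1 - cnj a * z)) ^ N) powr p) \<partial>lborel)"
    proof (rule nn_integral_mono)
      fix z
      show "indicator unit_disc z * ennreal (norm (atom_sum p f m A z) powr p)
        \<le> indicator (ball 0 1) z * ennreal ((\<Sum>a\<in>A. local_mean p f a * ((1 - norm a) / norm (1 - cnj a * z)) ^ N) powr p)"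
      proof (cases "z \<in> unit_disc")
        case True
        have "norm (atom_sum p f m A z) powr p
            \<le> (\<Sum>a\<in>A. local_mean p f a * ((1 - norm a) / norm (1 - cnj a * z)) ^ N) powr p"
          using p by (intro powr_mono2 norm_atom_sum_le A True m) auto
        then show ?thesis using True by (simp add: ennreal_leI)
      qed simp
    qed
    also have "\<dots> \<le> ennreal (C * (\<Sum>a\<in>A. local_mean p f a powr p * (1 - norm a)\<^sup>2))"
      using local_mean_nonneg by (intro C(2) A) auto
    also have "\<dots> \<le> ennreal (C * (225 * pi * M powr p))"
      using C(1) by (intro ennreal_leI mult_left_mono sum_local_mean_le[OF p A f M]) auto
    finally have "bergman_integral p (atom_sum p f m A) \<le> ennreal (1 / pi) * ennreal (C * (225 * pi * M powr p))"
      unfolding bergman_integral_def by (rule mult_left_mono) simp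
    also have "\<dots> = ennreal (225 * C * M powr p)" using C(1) by (simp add: ennreal_mult[symmetric])
    finally show "bergman_integral p (atom_sum p f m A) \<le> ennreal (225 * C * M powr p)" .
  qed
qed

text \<open>Atoms with |a| at most t have coefficients at most \<open>B\<close>, since their
  averaging balls lie where \<open>f\<close> is small. The others have coefficients at most a
  multiple of M (1 - |a|)^(-2/p), but the large power of 1 - |a| leaves a factor 1 - t to spare. The
  remaining sum of (1 - |a|)^2 is at most 64 for every \<open>A\<close>, which makes the bound
  uniform.\<close>

lemma atom_sum_growth:
  fixes N :: nat
  assumes p: "p > 0" and N: "N \<ge> 3 + 2 / p" and M: "M \<ge> 0" "bergman_integral p f \<le> ennreal (M powr p)"
    and A: "separated A" and m: "N \<le> m" and t: "0 \<le> t" "t < 1"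
    and B: "0 \<le> B" "\<And>w. norm w \<le> (1 + t) / 2 \<Longrightarrow> norm (f w) \<le> B" and z: "z \<in> unit_disc"
  shows "norm (atom_sum p f m A z) * (1 - norm z) ^ N \<le> 64 * (1 + pi powr (1 / p)) * (B + (1 - t) * M)"
proof -
  define K where "K = pi powr (1 / p)"
  have K: "K \<ge> 0" by (simp add: K_def)
  have fin: "bergman_integral p f < \<infinity>" using M(2) by (auto intro: le_less_trans)
  have "2 / p > 0" using p by simp
  then have N3: "N \<ge> 3" using N by linarith
  have z1: "0 < 1 - norm z" using z by simp
  have "norm (atom_sum p f m A z) * (1 - norm z) ^ N
      \<le> (\<Sum>a\<in>A. local_mean p f a * ((1 - norm a) / norm (1 - cnj a * z)) ^ N) * (1 - norm z) ^ N"
    using z1 by (intro mult_right_mono norm_atom_sum_le A z m) auto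
  also have "\<dots> = (\<Sum>a\<in>A. local_mean p f a * (((1 - norm a) / norm (1 - cnj a * z)) * (1 - norm z)) ^ N)"
    unfolding power_mult_distrib by (simp add: sum_distrib_right mult.assoc)
  also have "\<dots> \<le> (\<Sum>a\<in>A. (B + (1 - t) * (K * M)) * (1 - norm a)\<^sup>2)"
  proof (rule sum_mono)
    fix a assume a: "a \<in> A"
    define d where "d = 1 - norm a"
    have na: "norm a < 1" using separated_norm_less[OF A a] .
    have d: "0 < d" "d \<le> 1" using na by (auto simp: d_def)
    have "d / norm (1 - cnj a * z) * (1 - norm z) = d * ((1 - norm z) / norm (1 - cnj a * z))" by simp
    also have "\<dots> \<le> d * 1"
      using one_minus_norm_le_kernel(2)[of a z] kernel_pos[of a z] na z d by (intro mult_left_mono) auto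
    finally have "(d / norm (1 - cnj a * z) * (1 - norm z)) ^ N \<le> d ^ N"
      using z1 d by (intro power_mono) auto
    then have "local_mean p f a * (d / norm (1 - cnj a * z) * (1 - norm z)) ^ N \<le> local_mean p f a * d ^ N"
      by (intro mult_left_mono local_mean_nonneg)
    also have "\<dots> \<le> (B + (1 - t) * (K * M)) * d\<^sup>2"
    proof (cases "norm a \<le> t")
      case True
      have "local_mean p f a \<le> B"
        using True by (intro local_mean_le_bound[OF p na fin] B) auto
      moreover have "d ^ N \<le> d\<^sup>2" using d N3 by (intro power_decreasing) auto
      ultimately have "local_mean p f a * d ^ N \<le> B * d\<^sup>2" using d local_mean_nonneg B by (intro mult_mono) auto
      also have "\<dots> \<le> (B + (1 - t) * (K * M)) * d\<^sup>2" using K M t by (intro mult_right_mono) auto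
      finally show ?thesis .
    next
      case False
      have "local_mean p f a * d ^ N \<le> K * M * d powr - (2 / p) * d ^ N"
        unfolding K_def d_def using na by (intro mult_right_mono local_mean_le p M) auto
      also have "\<dots> = K * M * d powr (real N - 2 / p)"
        using d by (simp add: powr_realpow[symmetric] powr_add[symmetric])
      \<comment> \<open>The condition N at least 3 + 2/p in use: two powers of d feed the packing
        sum, the third becomes 1 - t.\<close>
      also have "\<dots> \<le> K * M * d powr 3" using d N K M by (intro mult_left_mono powr_mono') auto
      also have "\<dots> = K * M * (d * d\<^sup>2)" using d by (simp add: power3_eq_cube power2_eq_square)
      also have "\<dots> \<le> K * M * ((1 - t) * d\<^sup>2)"
        using False K M d t by (intro mult_left_mono mult_right_mono) (auto simp: d_def)
      also have "\<dots> \<le> (B + (1 - t) * (K * M)) * d\<^sup>2" using B(1) by (simp add: algebra_simps)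
      finally show ?thesis .
    qed
    finally show "local_mean p f a * ((1 - norm a) / norm (1 - cnj a * z) * (1 - norm z)) ^ N
        \<le> (B + (1 - t) * (K * M)) * (1 - norm a)\<^sup>2" unfolding d_def .
  qed
  also have "\<dots> = (B + (1 - t) * (K * M)) * (\<Sum>a\<in>A. (1 - norm a)\<^sup>2)" by (simp add: sum_distrib_left)
  also have "\<dots> \<le> (B + (1 - t) * (K * M)) * 64"
    using B K M t by (intro mult_left_mono separated_sum_square_le A) auto
  also have "\<dots> \<le> ((1 + K) * (B + (1 - t) * M)) * 64"
  proof (rule mult_right_mono)
    have "0 \<le> K * B + (1 - t) * M" using B K M t by simp
    then show "B + (1 - t) * (K * M) \<le> (1 + K) * (B + (1 - t) * M)" by (simp add: algebra_simps)
  qed simp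
  finally show ?thesis by (simp add: K_def mult_ac)
qed

section \<open>Bounds for one summand by the images of sums of atoms\<close>

context weighted_sum
begin

lemma range_set_borel: "closed T \<Longrightarrow> {z \<in> unit_disc. norm (\<phi> z) \<in> T} \<in> sets borel"
proof -
  assume T: "closed T"
  have "continuous_on unit_disc (\<lambda>z. norm (\<phi> z))"
    by (intro continuous_on_norm holomorphic_on_imp_continuous_on phi_hol)
  then have "closedin (top_of_set unit_disc) (unit_disc \<inter> (\<lambda>z. norm (\<phi> z)) -` T)"
    using T by (rule continuous_closedin_preimage)
  then obtain K where "closed K" "unit_disc \<inter> (\<lambda>z. norm (\<phi> z)) -` T = unit_disc \<inter> K"
    unfolding closedin_closed by blast
  moreover have "{z \<in> unit_disc. norm (\<phi> z) \<in> T} = unit_disc \<inter> (\<lambda>z. norm (\<phi> z)) -` T" by auto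
  ultimately show ?thesis by simp
qed

text \<open>For a point \<open>a\<close> of \<open>S\<close> near phi z, the factor (1 - |a|)^k in
  the coefficient bound cancels against the derivative bound, leaving the single term at
  \<open>a\<close> of each sum. The subset average replaces that term by full sums, so that the
  choice of \<open>a\<close>, which depends on z, disappears from the result.\<close>

lemma coefficient_estimate:
  assumes p: "p > 0" and q: "q > 0"
  shows "\<exists>C>0. \<forall>f S \<rho>. \<forall>k\<le>n. f holomorphic_on unit_disc \<longrightarrow> bergman_integral p f < \<infinity> \<longrightarrow> separated S \<longrightarrow>
    (\<forall>w. norm w \<le> \<rho> \<longrightarrow> (\<exists>a\<in>S. dist a w \<le> (1 - norm a) / 3)) \<longrightarrow>
    (\<forall>z\<in>unit_disc. 3 / 4 \<le> norm (\<phi> z) \<longrightarrow> norm (\<phi> z) \<le> \<rho> \<longrightarrow>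
      norm (gen_wcomp (us k) \<phi> k f z) powr q
        \<le> C / 2 ^ card S * (\<Sum>m\<le>n. \<Sum>A\<in>Pow S. norm (L (atom_sum p f (N + m) A) z) powr q))"
proof -
  obtain C where C: "C > 0" "\<And>a z k. z \<in> unit_disc \<Longrightarrow> k \<le> n \<Longrightarrow> norm a < 1 \<Longrightarrow> 1 / 2 \<le> norm a \<Longrightarrow>
      dist a (\<phi> z) \<le> (1 - norm a) / 3 \<Longrightarrow>
      norm (us k z) \<le> C * (1 - norm a) ^ k * (\<Sum>m\<le>n. norm (L (atom (N + m) a) z))"
    using coefficient_bound_near[of N] by blast
  have "\<forall>k. \<exists>C>0. \<forall>f a w. f holomorphic_on unit_disc \<longrightarrow> bergman_integral p f < \<infinity> \<longrightarrow> norm a < 1 \<longrightarrow>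
     dist a w \<le> (1 - norm a) / 3 \<longrightarrow> (1 - norm a) ^ k * norm ((deriv ^^ k) f w) \<le> C * local_mean p f a"
    using deriv_le_local_mean[OF p] by blast
  then obtain Cd where Cd: "\<And>k. Cd k > 0" "\<And>k f a w. f holomorphic_on unit_disc \<Longrightarrow> bergman_integral p f < \<infinity> \<Longrightarrow>
     norm a < 1 \<Longrightarrow> dist a w \<le> (1 - norm a) / 3 \<Longrightarrow> (1 - norm a) ^ k * norm ((deriv ^^ k) f w) \<le> Cd k * local_mean p f a"
    by metis
  define D where "D = (\<Sum>k\<le>n. Cd k)"
  have D: "D > 0" unfolding D_def using Cd(1) by (intro sum_pos) auto
  define E where "E = (C * D) powr q * real (Suc n) powr q * (2 * 2 powr q)"
  have E: "E > 0" using C D by (simp add: E_def)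
  show ?thesis
  proof (intro exI[of _ E] conjI allI impI ballI)
    fix f S \<rho> k z
    assume k: "k \<le> n" and f: "f holomorphic_on unit_disc" and fin: "bergman_integral p f < \<infinity>" and S: "separated S"
      and cover: "\<forall>w::complex. norm w \<le> \<rho> \<longrightarrow> (\<exists>a\<in>S. dist a w \<le> (1 - norm a) / 3)"
      and z: "z \<in> unit_disc" and w: "3 / 4 \<le> norm (\<phi> z)" "norm (\<phi> z) \<le> \<rho>"
    obtain a where a: "a \<in> S" "dist a (\<phi> z) \<le> (1 - norm a) / 3" using cover w by blast
    have na: "norm a < 1" using separated_norm_less[OF S a(1)] .
    have "norm (\<phi> z) \<le> norm a + dist a (\<phi> z)"
      using norm_triangle_sub[of "\<phi> z" a] by (simp add: dist_norm norm_minus_commute)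
    \<comment> \<open>From |phi z| at least 3/4 and a distance of at most (1 - |a|) / 3 one even
      gets |a| at least 5/8.\<close>
    then have "1 / 2 \<le> norm a" using w(1) a(2) by simp
    note u = C(2)[OF z k na this a(2)]
    define X where "X m b = of_real (local_mean p f b) * L (atom (N + m) b) z" for m b
    define Y where "Y = (\<Sum>m\<le>n. norm (L (atom (N + m) a) z))"
    have Y: "Y \<ge> 0" by (simp add: Y_def sum_nonneg)
    have "norm (gen_wcomp (us k) \<phi> k f z) = norm (us k z) * norm ((deriv ^^ k) f (\<phi> z))"
      by (simp add: gen_wcomp_def norm_mult)
    also have "\<dots> \<le> (C * (1 - norm a) ^ k * Y) * norm ((deriv ^^ k) f (\<phi> z))"
      using u unfolding Y_def by (intro mult_right_mono) auto
    also have "\<dots> = C * Y * ((1 - norm a) ^ k * norm ((deriv ^^ k) f (\<phi> z)))" by simp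
    also have "\<dots> \<le> C * Y * (Cd k * local_mean p f a)"
      using C Y by (intro mult_left_mono Cd(2)[OF f fin na a(2)]) auto
    also have "\<dots> \<le> C * Y * (D * local_mean p f a)"
      unfolding D_def using C Y k Cd(1) local_mean_nonneg
      by (intro mult_left_mono mult_right_mono member_le_sum) (auto intro: less_imp_le)
    also have "\<dots> = C * D * (\<Sum>m\<le>n. norm (X m a))"
      unfolding X_def Y_def by (simp add: norm_mult local_mean_nonneg sum_distrib_left mult_ac)
    finally have "norm (gen_wcomp (us k) \<phi> k f z) powr q \<le> (C * D * (\<Sum>m\<le>n. norm (X m a))) powr q"
      using q by (intro powr_mono2) auto
    also have "\<dots> = (C * D) powr q * (\<Sum>m\<le>n. norm (X m a)) powr q" by (rule powr_mult)
    also have "\<dots> \<le> (C * D) powr q * (real (Suc n) powr q * (\<Sum>m\<le>n. norm (X m a) powr q))"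
      using powr_sum_le[of "{..n}" "\<lambda>m. norm (X m a)" q] q by (intro mult_left_mono) auto
    also have "\<dots> \<le> (C * D) powr q * (real (Suc n) powr q * (\<Sum>m\<le>n. 2 * 2 powr q / 2 ^ card S * (\<Sum>A\<in>Pow S. norm (sum (X m) A) powr q)))"
    proof (intro mult_left_mono sum_mono)
      fix m
      show "norm (X m a) powr q \<le> 2 * 2 powr q / 2 ^ card S * (\<Sum>A\<in>Pow S. norm (sum (X m) A) powr q)"
        using powr_le_sum_Pow[OF separated_finite[OF S] a(1) q, of "X m"] by (simp add: field_simps)
    qed auto
    also have "\<dots> = E / 2 ^ card S * (\<Sum>m\<le>n. \<Sum>A\<in>Pow S. norm (sum (X m) A) powr q)"
      unfolding E_def sum_distrib_left[symmetric] by simp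
    also have "(\<Sum>m\<le>n. \<Sum>A\<in>Pow S. norm (sum (X m) A) powr q)
        = (\<Sum>m\<le>n. \<Sum>A\<in>Pow S. norm (L (atom_sum p f (N + m) A) z) powr q)"
    proof (intro sum.cong refl)
      fix m A assume "A \<in> Pow S"
      then have A: "separated A" using S separated_subset by auto
      have "L (atom_sum p f (N + m) A) z = sum (X m) A"
        unfolding atom_sum_def X_def
        by (intro L_sum separated_finite[OF A] atom_holomorphic separated_norm_less[OF A] z)
      then show "norm (sum (X m) A) powr q = norm (L (atom_sum p f (N + m) A) z) powr q" by simp
    qed
    finally show "norm (gen_wcomp (us k) \<phi> k f z) powr q
        \<le> E / 2 ^ card S * (\<Sum>m\<le>n. \<Sum>A\<in>Pow S. norm (L (atom_sum p f (N + m) A) z) powr q)" .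
  qed (rule E)
qed

text \<open>After integration the average over all subsets is at most its largest member, so one
  subset per exponent suffices. The number of subsets cancels, and \<open>C\<close> depends neither
  on \<open>\<rho>\<close> nor on the size of the covering set.\<close>

lemma outer_estimate:
  assumes p: "p > 0" and q: "q > 0"
  shows "\<exists>C>0. \<forall>f \<rho>. \<forall>k\<le>n. f holomorphic_on unit_disc \<longrightarrow> bergman_integral p f < \<infinity> \<longrightarrow> \<rho> < 1 \<longrightarrow>
    (\<exists>A. (\<forall>m. separated (A m)) \<and>
      powr_integral {z \<in> unit_disc. norm (\<phi> z) \<in> {3 / 4..\<rho>}} q (gen_wcomp (us k) \<phi> k f)
        \<le> ennreal C * (\<Sum>m\<le>n. bergman_integral q (L (atom_sum p f (N + m) (A m)))))"
proof -
  obtain C where C: "C > 0" "\<And>f S \<rho> k z. k \<le> n \<Longrightarrow> f holomorphic_on unit_disc \<Longrightarrow> bergman_integral p f < \<infinity> \<Longrightarrow>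
    separated S \<Longrightarrow> \<forall>w. norm w \<le> \<rho> \<longrightarrow> (\<exists>a\<in>S. dist a w \<le> (1 - norm a) / 3) \<Longrightarrow>
    z \<in> unit_disc \<Longrightarrow> 3 / 4 \<le> norm (\<phi> z) \<Longrightarrow> norm (\<phi> z) \<le> \<rho> \<Longrightarrow>
      norm (gen_wcomp (us k) \<phi> k f z) powr q
        \<le> C / 2 ^ card S * (\<Sum>m\<le>n. \<Sum>A\<in>Pow S. norm (L (atom_sum p f (N + m) A) z) powr q)"
    using coefficient_estimate[OF p q, of N] by blast
  show ?thesis
  proof (intro exI[of _ "C * pi"] conjI allI impI)
    show "C * pi > 0" using C by simp
    fix f \<rho> k
    assume k: "k \<le> n" and f: "f holomorphic_on unit_disc" and fin: "bergman_integral p f < \<infinity>" and \<rho>: "\<rho> < (1::real)"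
    obtain S where S: "separated S" and cover: "\<forall>w. norm w \<le> \<rho> \<longrightarrow> (\<exists>a\<in>S. dist a w \<le> (1 - norm a) / 3)"
      using separated_covering[OF \<rho>] by blast
    define T where "T m A = bergman_integral q (L (atom_sum p f (N + m) A))" for m A
    \<comment> \<open>The maximising subset depends on \<open>f\<close> and on the exponent; only
      its separation is used later.\<close>
    have "\<exists>A\<in>Pow S. \<forall>B\<in>Pow S. T m B \<le> T m A" for m
      using separated_finite[OF S] by (intro finite_has_maximum) auto
    then obtain A where A: "\<And>m. A m \<subseteq> S" "\<And>m B. B \<subseteq> S \<Longrightarrow> T m B \<le> T m (A m)"
      by (metis PowD PowI)
    define c where "c = C / 2 ^ card S"
    have c: "c \<ge> 0" using C by (simp add: c_def)
    define V where "V m B z = indicator unit_disc z * ennreal (norm (L (atom_sum p f (N + m) B) z) powr q)" for m B z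
    have V: "V m B \<in> borel_measurable borel" if "B \<in> Pow S" for m B
      unfolding V_def using that S separated_subset
      by (intro measurable_bergman L_holomorphic atom_sum_holomorphic q) auto
    have "powr_integral {z \<in> unit_disc. norm (\<phi> z) \<in> {3 / 4..\<rho>}} q (gen_wcomp (us k) \<phi> k f)
      \<le> (\<integral>\<^sup>+z. ennreal c * (\<Sum>m\<le>n. \<Sum>B\<in>Pow S. V m B z) \<partial>lborel)"
    proof (rule nn_integral_mono)
      fix z
      show "indicator {z \<in> unit_disc. norm (\<phi> z) \<in> {3 / 4..\<rho>}} z * ennreal (norm (gen_wcomp (us k) \<phi> k f z) powr q)
        \<le> ennreal c * (\<Sum>m\<le>n. \<Sum>B\<in>Pow S. V m B z)"
      proof (cases "z \<in> {z \<in> unit_disc. norm (\<phi> z) \<in> {3 / 4..\<rho>}}")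
        case True
        then have z: "z \<in> unit_disc" "3 / 4 \<le> norm (\<phi> z)" "norm (\<phi> z) \<le> \<rho>" by auto
        have "ennreal (norm (gen_wcomp (us k) \<phi> k f z) powr q)
            \<le> ennreal (c * (\<Sum>m\<le>n. \<Sum>B\<in>Pow S. norm (L (atom_sum p f (N + m) B) z) powr q))"
          unfolding c_def by (intro ennreal_leI C(2)[OF k f fin S cover z])
        also have "\<dots> = ennreal c * (\<Sum>m\<le>n. \<Sum>B\<in>Pow S. V m B z)"
          using c z by (simp add: V_def ennreal_mult sum_nonneg sum_ennreal)
        finally show ?thesis using True by simp
      qed simp
    qed
    also have "\<dots> = ennreal c * (\<Sum>m\<le>n. \<Sum>B\<in>Pow S. \<integral>\<^sup>+z. V m B z \<partial>lborel)"
    proof -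
      have VS: "(\<lambda>z. \<Sum>B\<in>Pow S. V m B z) \<in> borel_measurable lborel" for m
        using V by (intro borel_measurable_sum) simp
      have "(\<integral>\<^sup>+z. ennreal c * (\<Sum>m\<le>n. \<Sum>B\<in>Pow S. V m B z) \<partial>lborel)
          = ennreal c * (\<integral>\<^sup>+z. (\<Sum>m\<le>n. \<Sum>B\<in>Pow S. V m B z) \<partial>lborel)"
        by (intro nn_integral_cmult borel_measurable_sum VS)
      also have "(\<integral>\<^sup>+z. (\<Sum>m\<le>n. \<Sum>B\<in>Pow S. V m B z) \<partial>lborel) = (\<Sum>m\<le>n. \<integral>\<^sup>+z. (\<Sum>B\<in>Pow S. V m B z) \<partial>lborel)"
        by (intro nn_integral_sum VS)
      also have "\<dots> = (\<Sum>m\<le>n. \<Sum>B\<in>Pow S. \<integral>\<^sup>+z. V m B z \<partial>lborel)"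
        using V by (intro sum.cong refl nn_integral_sum) simp
      finally show ?thesis .
    qed
    also have "\<dots> = ennreal c * (\<Sum>m\<le>n. \<Sum>B\<in>Pow S. ennreal pi * T m B)"
      unfolding V_def T_def disc_integral_eq_bergman_integral ..
    also have "\<dots> \<le> ennreal c * (\<Sum>m\<le>n. \<Sum>B\<in>Pow S. ennreal pi * T m (A m))"
      by (intro mult_left_mono sum_mono A(2)) auto
    also have "\<dots> = ennreal c * (of_nat (2 ^ card S) * (ennreal pi * (\<Sum>m\<le>n. T m (A m))))"
      using separated_finite[OF S] by (simp add: card_Pow sum_distrib_left)
    also have "\<dots> = (ennreal c * ennreal (2 ^ card S) * ennreal pi) * (\<Sum>m\<le>n. T m (A m))"
      by (simp add: mult.assoc ennreal_power[symmetric])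
    also have "ennreal c * ennreal (2 ^ card S) * ennreal pi = ennreal (C * pi)"
      using C(1) by (simp add: ennreal_mult[symmetric] c_def)
    finally show "\<exists>A. (\<forall>m. separated (A m)) \<and>
      powr_integral {z \<in> unit_disc. norm (\<phi> z) \<in> {3 / 4..\<rho>}} q (gen_wcomp (us k) \<phi> k f)
        \<le> ennreal (C * pi) * (\<Sum>m\<le>n. bergman_integral q (L (atom_sum p f (N + m) (A m))))"
      unfolding T_def by (intro exI[of _ A] conjI allI separated_subset[OF S] A(1))
  qed
qed

text \<open>The atoms at 1/2 are bounded by 1, hence lie in A^p, and finitely many of their images
  dominate the coefficient pointwise. The exponents 0 to \<open>n\<close> are good enough here,
  since interpolation works from any base.\<close>

lemma coefficient_in_bergman_space:
  assumes p: "p > 0" and q: "q > 0" and maps: "\<And>f. f \<in> bergman_space p \<Longrightarrow> L f \<in> bergman_space q" and k: "k \<le> n"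
  shows "bergman_integral q (us k) < \<infinity>"
proof -
  obtain C where C: "C > 0" "\<And>z. z \<in> unit_disc \<Longrightarrow> norm (us k z) \<le> C * (\<Sum>m\<le>n. norm (L (atom (0 + m) (1 / 2)) z))"
    using coefficient_bound_half[of 0] k by blast
  have half: "norm (1 / 2 :: complex) < 1" by simp
  have "L (atom m (1 / 2)) \<in> bergman_space q" for m
  proof (rule maps)
    have "bergman_integral p (atom m (1 / 2)) \<le> bergman_integral p (\<lambda>_. 1)"
      using norm_atom_le[OF half, of _ 0 m] p by (intro bergman_integral_mono) auto
    also have "\<dots> < \<infinity>"
      by (simp add: bergman_integral_def emeasure_ball_complex ennreal_mult_less_top)
    finally show "atom m (1 / 2) \<in> bergman_space p"
      using atom_holomorphic[OF half] by (simp add: bergman_space_def)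
  qed
  then have La: "L (atom m (1 / 2)) holomorphic_on unit_disc" "bergman_integral q (L (atom m (1 / 2))) < \<infinity>" for m
    by (auto simp: bergman_space_def)
  define V where "V m z = indicator unit_disc z * ennreal (norm (L (atom m (1 / 2)) z) powr q)" for m z
  have V: "V m \<in> borel_measurable borel" for m unfolding V_def by (rule measurable_bergman[OF La(1) q])
  define c where "c = C powr q * real (Suc n) powr q"
  have c: "c \<ge> 0" by (simp add: c_def)
  have "powr_integral unit_disc q (us k) \<le> (\<integral>\<^sup>+z. ennreal c * (\<Sum>m\<le>n. V m z) \<partial>lborel)"
  proof (rule nn_integral_mono)
    fix z
    show "indicator unit_disc z * ennreal (norm (us k z) powr q) \<le> ennreal c * (\<Sum>m\<le>n. V m z)"
    proof (cases "z \<in> unit_disc")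
      case True
      have "norm (us k z) powr q \<le> (C * (\<Sum>m\<le>n. norm (L (atom m (1 / 2)) z))) powr q"
        using C(2)[OF True] q by (intro powr_mono2) auto
      also have "\<dots> = C powr q * (\<Sum>m\<le>n. norm (L (atom m (1 / 2)) z)) powr q" by (rule powr_mult)
      also have "\<dots> \<le> C powr q * (real (Suc n) powr q * (\<Sum>m\<le>n. norm (L (atom m (1 / 2)) z) powr q))"
        using powr_sum_le[of "{..n}" "\<lambda>m. norm (L (atom m (1 / 2)) z)" q] q by (intro mult_left_mono) auto
      finally have "ennreal (norm (us k z) powr q) \<le> ennreal (c * (\<Sum>m\<le>n. norm (L (atom m (1 / 2)) z) powr q))"
        by (intro ennreal_leI) (simp add: c_def mult.assoc)
      also have "\<dots> = ennreal c * (\<Sum>m\<le>n. V m z)"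
        using c True by (simp add: V_def ennreal_mult sum_nonneg sum_ennreal)
      finally show ?thesis using True by simp
    qed simp
  qed
  also have "\<dots> = ennreal c * (\<Sum>m\<le>n. \<integral>\<^sup>+z. V m z \<partial>lborel)"
    using V by (simp add: nn_integral_cmult nn_integral_sum)
  also have "\<dots> < \<infinity>"
    unfolding V_def disc_integral_eq_bergman_integral using La(2)
    by (simp add: ennreal_mult_less_top ennreal_sum_less_top)
  finally show ?thesis unfolding bergman_integral_def by (simp add: ennreal_mult_less_top)
qed

text \<open>Where phi z stays in the disc of radius 3/4, Cauchy's estimate with margin 7/8 - 3/4 =
  1/8 bounds the derivative, so only the integral of the coefficient remains.\<close>

lemma inner_estimate:
  assumes q: "q > 0" and k: "k \<le> n"
  shows "\<exists>C>0. \<forall>f B. f holomorphic_on unit_disc \<longrightarrow> 0 \<le> B \<longrightarrow> (\<forall>w. norm w \<le> 7 / 8 \<longrightarrow> norm (f w) \<le> B) \<longrightarrow>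
    powr_integral {z \<in> unit_disc. norm (\<phi> z) \<in> {..3 / 4}} q (gen_wcomp (us k) \<phi> k f)
      \<le> ennreal (C * B powr q) * bergman_integral q (us k)"
proof -
  define c :: real where "c = fact k * 8 ^ k"
  have c: "c > 0" by (simp add: c_def)
  show ?thesis
  proof (intro exI[of _ "c powr q * pi"] conjI allI impI)
    show "c powr q * pi > 0" using c by simp
    fix f B assume f: "f holomorphic_on unit_disc" and B: "0 \<le> B" "\<forall>w. norm w \<le> 7 / 8 \<longrightarrow> norm (f w) \<le> B"
    have "powr_integral {z \<in> unit_disc. norm (\<phi> z) \<in> {..3 / 4}} q (gen_wcomp (us k) \<phi> k f)
      \<le> (\<integral>\<^sup>+z. ennreal (c powr q * B powr q) * (indicator unit_disc z * ennreal (norm (us k z) powr q)) \<partial>lborel)"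
    proof (rule nn_integral_mono)
      fix z
      show "indicator {z \<in> unit_disc. norm (\<phi> z) \<in> {..3 / 4}} z * ennreal (norm (gen_wcomp (us k) \<phi> k f z) powr q)
        \<le> ennreal (c powr q * B powr q) * (indicator unit_disc z * ennreal (norm (us k z) powr q))"
      proof (cases "z \<in> {z \<in> unit_disc. norm (\<phi> z) \<in> {..3 / 4}}")
        case True
        then have z: "z \<in> unit_disc" "norm (\<phi> z) \<le> 3 / 4" by auto
        have "norm ((deriv ^^ k) f (\<phi> z)) \<le> fact k / (7 / 8 - 3 / 4) ^ k * B"
          using z B by (intro Cauchy_bound_unit_disc[OF f]) auto
        also have "\<dots> = c * B" by (simp add: c_def power_one_over)
        finally have "norm (gen_wcomp (us k) \<phi> k f z) \<le> c * B * norm (us k z)"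
          by (simp add: gen_wcomp_def norm_mult mult.commute[of "norm (us k z)"] mult_right_mono)
        then have "norm (gen_wcomp (us k) \<phi> k f z) powr q \<le> (c * B * norm (us k z)) powr q"
          using q by (intro powr_mono2) auto
        also have "\<dots> = c powr q * B powr q * norm (us k z) powr q" by (simp only: powr_mult)
        finally have "ennreal (norm (gen_wcomp (us k) \<phi> k f z) powr q) \<le> ennreal (c powr q * B powr q) * ennreal (norm (us k z) powr q)"
          by (simp add: ennreal_mult[symmetric] ennreal_leI)
        then show ?thesis using True by simp
      qed simp
    qed
    also have "\<dots> = ennreal (c powr q * B powr q) * (ennreal pi * bergman_integral q (us k))"
      unfolding disc_integral_eq_bergman_integral[symmetric]
      using measurable_bergman[OF us_hol[OF k] q] by (intro nn_integral_cmult) simp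
    also have "\<dots> = ennreal (c powr q * pi * B powr q) * bergman_integral q (us k)"
      by (subst mult.assoc[symmetric], subst ennreal_mult[symmetric]) (simp_all add: mult_ac)
    finally show "powr_integral {z \<in> unit_disc. norm (\<phi> z) \<in> {..3 / 4}} q (gen_wcomp (us k) \<phi> k f)
      \<le> ennreal (c powr q * pi * B powr q) * bergman_integral q (us k)" .
  qed
qed

text \<open>Monotone convergence along the radii 1 - 1 / (j + 2), which increase to 1; each \<phi> z
  has modulus below 1 and is eventually reached. The estimates with finite covering sets thereby
  extend to the whole disc.\<close>

lemma exhaustion:
  assumes f: "f holomorphic_on unit_disc" and k: "k \<le> n" and q: "q > 0"
  shows "powr_integral unit_disc q (gen_wcomp (us k) \<phi> k f)
    = (SUP j. powr_integral {z \<in> unit_disc. norm (\<phi> z) \<in> {..1 - 1 / (real j + 2)}} q (gen_wcomp (us k) \<phi> k f))"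
proof -
  define g where "g z = ennreal (norm (gen_wcomp (us k) \<phi> k f z) powr q)" for z
  define E where "E j = {z \<in> unit_disc. norm (\<phi> z) \<in> {..1 - 1 / (real j + 2)}}" for j :: nat
  have meas: "(\<lambda>z. indicator (E j) z * g z) \<in> borel_measurable borel" for j
    unfolding g_def by (rule borel_measurable_holomorphic_powr[OF term_holomorphic[OF f k]])
      (use q range_set_borel[of "{..1 - 1 / (real j + 2)}"] in \<open>auto simp: E_def\<close>)
  have mono: "E i \<subseteq> E j" if "i \<le> j" for i j
  proof -
    have "1 / (real j + 2) \<le> 1 / (real i + 2)" using that by (intro divide_left_mono) auto
    then show ?thesis by (auto simp: E_def)
  qed
  have "indicator unit_disc z * g z = (SUP j. indicator (E j) z * g z)" for z
  proof (rule antisym)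
    show "indicator unit_disc z * g z \<le> (SUP j. indicator (E j) z * g z)"
    proof (cases "z \<in> unit_disc")
      case True
      have "norm (\<phi> z) < 1" using phi_in[OF True] by simp
      then have "1 / (1 - norm (\<phi> z)) > 0" by simp
      obtain j :: nat where j: "1 / (1 - norm (\<phi> z)) < real j" using reals_Archimedean2 by blast
      then have "1 / (real j + 2) \<le> 1 / (1 / (1 - norm (\<phi> z)))"
        using \<open>1 / (1 - norm (\<phi> z)) > 0\<close> by (intro divide_left_mono) auto
      then have "z \<in> E j" using True by (simp add: E_def)
      then have "indicator unit_disc z * g z = indicator (E j) z * g z" using True by simp
      also have "\<dots> \<le> (SUP j. indicator (E j) z * g z)" by (rule SUP_upper) simp
      finally show ?thesis .
    qed simp
    show "(SUP j. indicator (E j) z * g z) \<le> indicator unit_disc z * g z"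
      by (intro SUP_least mult_right_mono) (auto simp: E_def indicator_def)
  qed
  then have "(\<integral>\<^sup>+z. indicator unit_disc z * g z \<partial>lborel) = (\<integral>\<^sup>+z. (SUP j. indicator (E j) z * g z) \<partial>lborel)" by simp
  also have "\<dots> = (SUP j. \<integral>\<^sup>+z. indicator (E j) z * g z \<partial>lborel)"
  proof (rule nn_integral_monotone_convergence_SUP)
    show "incseq (\<lambda>j z. indicator (E j) z * g z)"
      using mono by (auto simp: incseq_def le_fun_def indicator_def)
  qed (use meas in simp)
  finally show ?thesis unfolding g_def E_def .
qed

lemma truncated_estimate:
  assumes p: "p > 0" and q: "q > 0" and k: "k \<le> n"
  shows "\<exists>C>0. \<forall>f \<rho> B. f holomorphic_on unit_disc \<longrightarrow> bergman_integral p f < \<infinity> \<longrightarrow> \<rho> < 1 \<longrightarrow>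
    0 \<le> B \<longrightarrow> (\<forall>w. norm w \<le> 7 / 8 \<longrightarrow> norm (f w) \<le> B) \<longrightarrow>
    (\<exists>A. (\<forall>m. separated (A m)) \<and>
      powr_integral {z \<in> unit_disc. norm (\<phi> z) \<in> {..\<rho>}} q (gen_wcomp (us k) \<phi> k f)
        \<le> ennreal C * (ennreal (B powr q) * bergman_integral q (us k)
              + (\<Sum>m\<le>n. bergman_integral q (L (atom_sum p f (N + m) (A m))))))"
proof -
  obtain C1 where C1: "C1 > 0" "\<And>f \<rho>. f holomorphic_on unit_disc \<Longrightarrow> bergman_integral p f < \<infinity> \<Longrightarrow> \<rho> < 1 \<Longrightarrow>
    (\<exists>A. (\<forall>m. separated (A m)) \<and>
      powr_integral {z \<in> unit_disc. norm (\<phi> z) \<in> {3 / 4..\<rho>}} q (gen_wcomp (us k) \<phi> k f)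
        \<le> ennreal C1 * (\<Sum>m\<le>n. bergman_integral q (L (atom_sum p f (N + m) (A m)))))"
    using outer_estimate[OF p q, of N] k by blast
  obtain C2 where C2: "C2 > 0" "\<And>f B. f holomorphic_on unit_disc \<Longrightarrow> 0 \<le> B \<Longrightarrow> (\<forall>w. norm w \<le> 7 / 8 \<longrightarrow> norm (f w) \<le> B) \<Longrightarrow>
    powr_integral {z \<in> unit_disc. norm (\<phi> z) \<in> {..3 / 4}} q (gen_wcomp (us k) \<phi> k f)
      \<le> ennreal (C2 * B powr q) * bergman_integral q (us k)"
    using inner_estimate[OF q k] by blast
  show ?thesis
  proof (intro exI[of _ "C1 + C2"] conjI allI impI)
    show "C1 + C2 > 0" using C1 C2 by simp
    fix f \<rho> B
    assume f: "f holomorphic_on unit_disc" and fin: "bergman_integral p f < \<infinity>" and \<rho>: "\<rho> < (1::real)"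
      and B: "0 \<le> B" "\<forall>w. norm w \<le> 7 / 8 \<longrightarrow> norm (f w) \<le> B"
    define g where "g z = ennreal (norm (gen_wcomp (us k) \<phi> k f z) powr q)" for z
    define E where "E T = {z \<in> unit_disc. norm (\<phi> z) \<in> T}" for T
    have meas: "(\<lambda>z. indicator (E T) z * g z) \<in> borel_measurable borel" if "closed T" for T
      unfolding g_def by (rule borel_measurable_holomorphic_powr[OF term_holomorphic[OF f k]])
        (use q range_set_borel[OF that] in \<open>auto simp: E_def\<close>)
    obtain A where A: "\<And>m. separated (A m)"
      "(\<integral>\<^sup>+z. indicator (E {3 / 4..\<rho>}) z * g z \<partial>lborel) \<le> ennreal C1 * (\<Sum>m\<le>n. bergman_integral q (L (atom_sum p f (N + m) (A m))))"
      using C1(2)[OF f fin \<rho>] unfolding E_def g_def by blast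
    define T where "T = (\<Sum>m\<le>n. bergman_integral q (L (atom_sum p f (N + m) (A m))))"
    have "(\<integral>\<^sup>+z. indicator (E {..\<rho>}) z * g z \<partial>lborel)
        \<le> (\<integral>\<^sup>+z. indicator (E {..3 / 4}) z * g z + indicator (E {3 / 4..\<rho>}) z * g z \<partial>lborel)"
      by (intro nn_integral_mono) (auto simp: E_def indicator_def)
    also have "\<dots> = (\<integral>\<^sup>+z. indicator (E {..3 / 4}) z * g z \<partial>lborel) + (\<integral>\<^sup>+z. indicator (E {3 / 4..\<rho>}) z * g z \<partial>lborel)"
      using meas by (intro nn_integral_add) auto
    also have "\<dots> \<le> ennreal (C2 * B powr q) * bergman_integral q (us k) + ennreal C1 * T"
      using C2(2)[OF f B] A(2) unfolding T_def E_def g_def by (rule add_mono)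
    also have "ennreal (C2 * B powr q) * bergman_integral q (us k) = ennreal C2 * (ennreal (B powr q) * bergman_integral q (us k))"
      using C2(1) by (simp add: ennreal_mult mult.assoc)
    also have "ennreal C2 * (ennreal (B powr q) * bergman_integral q (us k)) + ennreal C1 * T
        \<le> ennreal (C1 + C2) * (ennreal (B powr q) * bergman_integral q (us k)) + ennreal (C1 + C2) * T"
      using C1(1) C2(1) by (intro add_mono mult_right_mono ennreal_leI) auto
    also have "\<dots> = ennreal (C1 + C2) * (ennreal (B powr q) * bergman_integral q (us k) + T)"
      by (simp only: distrib_left)
    finally show "\<exists>A. (\<forall>m. separated (A m)) \<and>
      powr_integral {z \<in> unit_disc. norm (\<phi> z) \<in> {..\<rho>}} q (gen_wcomp (us k) \<phi> k f)
        \<le> ennreal (C1 + C2) * (ennreal (B powr q) * bergman_integral q (us k)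
              + (\<Sum>m\<le>n. bergman_integral q (L (atom_sum p f (N + m) (A m)))))"
      using A(1) unfolding T_def E_def g_def by blast
  qed
qed

end

section \<open>Boundedness and compactness\<close>

text \<open>Presents a single summand as an instance of the locale with one nonzero coefficient, so
  that the criteria for \<open>L\<close> carry over.\<close>

lemma gen_wcomp_eq_L_op:
  assumes "k \<le> n"
  shows "gen_wcomp u \<phi> k = L_op (\<lambda>j. if j = k then u else (\<lambda>_. 0)) \<phi> n"
proof (intro ext)
  fix f z
  have "L_op (\<lambda>j. if j = k then u else (\<lambda>_. 0)) \<phi> n f z = (\<Sum>j\<le>n. if j = k then gen_wcomp u \<phi> k f z else 0)"
    unfolding L_op_def by (intro sum.cong) (auto simp: gen_wcomp_def)
  then show "gen_wcomp u \<phi> k f z = L_op (\<lambda>j. if j = k then u else (\<lambda>_. 0)) \<phi> n f z" using assms by simp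
qed

lemma uniform_limit_zero_bound:
  fixes F :: "nat \<Rightarrow> complex \<Rightarrow> complex"
  assumes lim: "uniform_limit X F (\<lambda>_. 0) sequentially" and X: "compact X" "X \<noteq> {}"
    and cont: "\<And>i. continuous_on X (F i)"
  shows "\<exists>B. (\<forall>i. 0 \<le> B i \<and> (\<forall>w\<in>X. norm (F i w) \<le> B i)) \<and> B \<longlonglongrightarrow> (0 :: real)"
proof -
  have "\<exists>b. 0 \<le> b \<and> (\<forall>w\<in>X. norm (F i w) \<le> b) \<and> (\<exists>w\<in>X. b = norm (F i w))" for i
    using continuous_attains_sup[OF X continuous_on_norm[OF cont[of i]]] by (metis norm_ge_zero)
  then obtain B where B: "\<And>i. 0 \<le> B i" "\<And>i w. w \<in> X \<Longrightarrow> norm (F i w) \<le> B i" "\<And>i. \<exists>w\<in>X. B i = norm (F i w)"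
    by metis
  have "B \<longlonglongrightarrow> 0"
  proof (rule tendstoI)
    fix e :: real assume "e > 0"
    then have "eventually (\<lambda>i. \<forall>x\<in>X. dist (F i x) 0 < e) sequentially" using lim by (auto simp: uniform_limit_iff)
    then show "eventually (\<lambda>i. dist (B i) 0 < e) sequentially"
    proof eventually_elim
      case (elim i)
      then show ?case using B(3)[of i] by auto
    qed
  qed
  then show ?thesis using B by blast
qed

text \<open>The sets \<open>A i\<close> may vary arbitrarily with \<open>i\<close>. This is
  essential, since they are chosen after \<open>F i\<close> as maximisers; it works because the
  growth estimate does not depend on the set.\<close>

lemma null_seq_atom_sum:
  fixes p :: real and N :: nat
  assumes p: "p > 0" and N: "N \<ge> 3 + 2 / p" "p > 1 \<Longrightarrow> N \<ge> 2 + 1 / (2 * (p - 1))" "N * p > 2" "N \<ge> 2"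
    and F: "null_seq p F" and A: "\<And>i. separated (A i)" and m: "N \<le> m"
  shows "null_seq p (\<lambda>i. atom_sum p (F i) m (A i))"
proof -
  have hol: "F i holomorphic_on unit_disc" for i using F by (simp add: null_seq_def)
  obtain M0 where M0: "\<And>i. bergman_integral p (F i) \<le> ennreal M0" using F by (auto simp: null_seq_def)
  define M where "M = (max M0 1) powr (1 / p)"
  have M: "M > 0" "bergman_integral p (F i) \<le> ennreal (M powr p)" for i
    using M0[of i] p by (auto simp: M_def powr_powr intro: order_trans ennreal_leI)
  obtain C where C: "C > 0" "\<And>f M m A. f holomorphic_on unit_disc \<Longrightarrow> bergman_integral p f \<le> ennreal (M powr p) \<Longrightarrow>
    N \<le> m \<Longrightarrow> separated A \<Longrightarrow> bergman_integral p (atom_sum p f m A) \<le> ennreal (C * M powr p)"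
    using atom_sum_bergman_le[OF p N(3,4,2)] by blast
  show ?thesis
    unfolding null_seq_def
  proof (intro conjI allI impI)
    show "atom_sum p (F i) m (A i) holomorphic_on unit_disc" for i by (rule atom_sum_holomorphic[OF A])
    show "\<exists>M. \<forall>i. bergman_integral p (atom_sum p (F i) m (A i)) \<le> ennreal M"
      using C(2)[OF hol M(2) m A] by blast
    fix r :: real assume r: "r < 1"
    define Q where "Q = 64 * (1 + pi powr (1 / p)) / (1 - r) ^ N"
    have Q: "Q > 0" using r by (simp add: Q_def add_pos_nonneg)
    show "uniform_limit (cball 0 r) (\<lambda>i. atom_sum p (F i) m (A i)) (\<lambda>_. 0) sequentially"
    proof (rule uniform_limitI)
      fix e :: real assume e: "e > 0"
      \<comment> \<open>Close enough to 1 that the atoms beyond radius \<open>t\<close> contribute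
        at most half of the permitted error; with \<open>t\<close> fixed, the atoms inside become
        small for large \<open>i\<close>.\<close>
      define t where "t = 1 - min 1 (e / (4 * Q * M))"
      have t: "0 \<le> t" "t < 1" "(1 - t) * M \<le> e / (4 * Q)"
      proof -
        have "(1 - t) * M \<le> e / (4 * Q * M) * M" using M unfolding t_def by (intro mult_right_mono) auto
        then show "(1 - t) * M \<le> e / (4 * Q)" using M by simp
      qed (use e Q M in \<open>auto simp: t_def\<close>)
      have "uniform_limit (cball 0 ((1 + t) / 2)) F (\<lambda>_. 0) sequentially" using F t by (simp add: null_seq_def)
      moreover have "e / (4 * Q) > 0" using e Q by simp
      ultimately have "eventually (\<lambda>i. \<forall>w\<in>cball 0 ((1 + t) / 2). dist (F i w) 0 < e / (4 * Q)) sequentially"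
        by (auto simp: uniform_limit_iff)
      then show "eventually (\<lambda>i. \<forall>z\<in>cball 0 r. dist (atom_sum p (F i) m (A i) z) 0 < e) sequentially"
      proof eventually_elim
        case (elim i)
        show ?case
        proof
          fix z :: complex assume z: "z \<in> cball 0 r"
          have "norm (atom_sum p (F i) m (A i) z) * (1 - norm z) ^ N
              \<le> 64 * (1 + pi powr (1 / p)) * (e / (4 * Q) + (1 - t) * M)"
            using M(1) elim e Q z r
            by (intro atom_sum_growth[OF p N(1) _ M(2) A m t(1,2)]) (auto intro: less_imp_le)
          also have "\<dots> \<le> 64 * (1 + pi powr (1 / p)) * (e / (4 * Q) + e / (4 * Q))"
            by (intro mult_left_mono add_left_mono t(3)) auto
          also have "64 * (1 + pi powr (1 / p)) = Q * (1 - r) ^ N" using r by (simp add: Q_def)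
          finally have "norm (atom_sum p (F i) m (A i) z) * (1 - norm z) ^ N \<le> Q * (1 - r) ^ N * (e / (2 * Q))"
            by simp
          then have "norm (atom_sum p (F i) m (A i) z) * (1 - norm z) ^ N \<le> (e / 2) * (1 - r) ^ N" using Q by (simp add: mult_ac)
          moreover have "norm (atom_sum p (F i) m (A i) z) * (1 - r) ^ N \<le> norm (atom_sum p (F i) m (A i) z) * (1 - norm z) ^ N"
            using z r by (intro mult_left_mono power_mono) auto
          ultimately have "norm (atom_sum p (F i) m (A i) z) * (1 - r) ^ N \<le> (e / 2) * (1 - r) ^ N" by linarith
          then have "norm (atom_sum p (F i) m (A i) z) \<le> e / 2" using r by simp
          then show "dist (atom_sum p (F i) m (A i) z) 0 < e" using e by simp
        qed
      qed
    qed
  qed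
qed

text \<open>The first condition serves the local uniform decay of the sums, the second the Schur
  weights for p > 1, and \<open>N * p > 2\<close> the convergence of the kernel integral for p at
  most 1.\<close>

lemma exponent_exists:
  fixes p :: real
  assumes "p > 0"
  obtains N :: nat where "N \<ge> 3 + 2 / p" "p > 1 \<Longrightarrow> N \<ge> 2 + 1 / (2 * (p - 1))" "N * p > 2" "N \<ge> 2"
proof -
  obtain N :: nat where N: "max (3 + 2 / p) (2 + 1 / (2 * (p - 1))) < N" using reals_Archimedean2 by blast
  have "(3 + 2 / p) * p \<le> N * p" using N assms by (intro mult_right_mono) auto
  then have Np: "N * p > 2" using assms by (simp add: distrib_right)
  have "2 / p > 0" using assms by simp
  then have "N \<ge> 2" using N by linarith
  then show ?thesis using N Np by (intro that[of N]) auto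
qed

section \<open>Passing between the sum and its summands\<close>

context weighted_sum
begin

lemma term_weighted_sum: "k \<le> n \<Longrightarrow> weighted_sum (\<lambda>j. if j = k then us k else (\<lambda>_. 0)) \<phi> n"
  by unfold_locales (use us_hol phi_hol phi_into in auto)

lemma bounded_term_iff:
  assumes k: "k \<le> n" and p: "p > 0" and q: "q > 0"
  shows "bounded_op p q (gen_wcomp (us k) \<phi> k) \<longleftrightarrow> (\<exists>K>0. \<forall>f M. f holomorphic_on unit_disc \<longrightarrow> M > 0 \<longrightarrow>
    bergman_integral p f \<le> ennreal (M powr p) \<longrightarrow> bergman_integral q (gen_wcomp (us k) \<phi> k f) \<le> ennreal (K * M powr q))"
  unfolding gen_wcomp_eq_L_op[OF k] by (rule weighted_sum.bounded_op_iff[OF term_weighted_sum[OF k] p q])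

text \<open>The sums of atoms have p-integrals bounded by a multiple of that of \<open>f\<close>, so
  boundedness of \<open>L\<close> controls every term of the truncated estimate. The resulting
  constant does not see the truncation radius, and exhaustion finishes.\<close>

lemma bounded_term:
  assumes bd: "bounded_op p q L" and k: "k \<le> n" and p: "p > 0" and q: "q > 0"
  shows "bounded_op p q (gen_wcomp (us k) \<phi> k)"
proof -
  obtain K where K: "K > 0" "\<And>f M. f holomorphic_on unit_disc \<Longrightarrow> M > 0 \<Longrightarrow>
    bergman_integral p f \<le> ennreal (M powr p) \<Longrightarrow> bergman_integral q (L f) \<le> ennreal (K * M powr q)"
    using bd bounded_op_iff[OF p q] by blast
  obtain N :: nat where N: "N \<ge> 3 + 2 / p" "p > 1 \<Longrightarrow> N \<ge> 2 + 1 / (2 * (p - 1))" "N * p > 2" "N \<ge> 2"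
    using exponent_exists[OF p] by blast
  obtain C0 where C0: "C0 > 0" "\<And>f M w. f holomorphic_on unit_disc \<Longrightarrow> 0 \<le> M \<Longrightarrow> bergman_integral p f \<le> ennreal (M powr p) \<Longrightarrow>
     norm w < 1 \<Longrightarrow> norm (f w) \<le> C0 * M * (1 - norm w) powr - (2 / p)"
    using bergman_growth[OF p] by blast
  obtain C1 where C1: "C1 > 0" "\<And>f \<rho> B. f holomorphic_on unit_disc \<Longrightarrow> bergman_integral p f < \<infinity> \<Longrightarrow> \<rho> < 1 \<Longrightarrow>
    0 \<le> B \<Longrightarrow> (\<forall>w. norm w \<le> 7 / 8 \<longrightarrow> norm (f w) \<le> B) \<Longrightarrow>
    (\<exists>A. (\<forall>m. separated (A m)) \<and>
      powr_integral {z \<in> unit_disc. norm (\<phi> z) \<in> {..\<rho>}} q (gen_wcomp (us k) \<phi> k f)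
        \<le> ennreal C1 * (ennreal (B powr q) * bergman_integral q (us k)
              + (\<Sum>m\<le>n. bergman_integral q (L (atom_sum p f (N + m) (A m))))))"
    using truncated_estimate[OF p q k, of N] by blast
  obtain C2 where C2: "C2 > 0" "\<And>f M m A. f holomorphic_on unit_disc \<Longrightarrow> bergman_integral p f \<le> ennreal (M powr p) \<Longrightarrow>
    N \<le> m \<Longrightarrow> separated A \<Longrightarrow> bergman_integral p (atom_sum p f m A) \<le> ennreal (C2 * M powr p)"
    using atom_sum_bergman_le[OF p N(3,4,2)] by blast
  have "bergman_integral q (us k) < \<infinity>"
    using bd by (intro coefficient_in_bergman_space[OF p q _ k]) (auto simp: bounded_op_def)
  then obtain b where b: "b \<ge> 0" "bergman_integral q (us k) = ennreal b"
    by (cases "bergman_integral q (us k)") auto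
  \<comment> \<open>The growth bound on the disc of radius 7/8, where 1 - |w| is at least
    1/8.\<close>
  define c0 where "c0 = C0 * (1 / 8) powr - (2 / p)"
  have c0: "c0 > 0" using C0 by (simp add: c0_def)
  define K' where "K' = C1 * (c0 powr q * b + (\<Sum>m\<le>n. K * (C2 powr (1 / p)) powr q))"
  have K': "K' > 0" unfolding K'_def using C1(1) C2(1) K(1) b(1) c0
    by (intro mult_pos_pos add_nonneg_pos sum_pos) auto
  have "bergman_integral q (gen_wcomp (us k) \<phi> k f) \<le> ennreal (1 / pi * K' * M powr q)"
    if f: "f holomorphic_on unit_disc" and M: "M > 0" "bergman_integral p f \<le> ennreal (M powr p)" for f M
  proof -
    have fin: "bergman_integral p f < \<infinity>" using M(2) by (auto intro: le_less_trans)
    have B: "norm (f w) \<le> c0 * M" if "norm w \<le> 7 / 8" for w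
    proof -
      have "norm (f w) \<le> C0 * M * (1 - norm w) powr - (2 / p)" using that M by (intro C0(2) f) auto
      also have "\<dots> \<le> C0 * M * (1 / 8) powr - (2 / p)" using that C0(1) M(1) p by (intro mult_left_mono powr_mono2') auto
      finally show ?thesis by (simp add: c0_def mult_ac)
    qed
    have "powr_integral {z \<in> unit_disc. norm (\<phi> z) \<in> {..1 - 1 / (real j + 2)}} q (gen_wcomp (us k) \<phi> k f)
       \<le> ennreal (K' * M powr q)" (is "?I j \<le> _") for j
    proof -
      have \<rho>: "1 - 1 / (real j + 2) < 1" by simp
      obtain A where A: "\<And>m. separated (A m)"
        "?I j \<le> ennreal C1 * (ennreal ((c0 * M) powr q) * bergman_integral q (us k)
              + (\<Sum>m\<le>n. bergman_integral q (L (atom_sum p f (N + m) (A m)))))"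
        using C1(2)[OF f fin \<rho>, of "c0 * M"] B c0 M(1) by auto
      have "bergman_integral q (L (atom_sum p f (N + m) (A m))) \<le> ennreal (K * (C2 powr (1 / p)) powr q * M powr q)" for m
      proof -
        have "bergman_integral p (atom_sum p f (N + m) (A m)) \<le> ennreal (C2 * M powr p)"
          by (intro C2(2) f M A) simp
        also have "C2 * M powr p = (C2 powr (1 / p) * M) powr p" using C2(1) p by (simp add: powr_mult powr_powr)
        finally have "bergman_integral q (L (atom_sum p f (N + m) (A m))) \<le> ennreal (K * (C2 powr (1 / p) * M) powr q)"
          using C2(1) M(1) by (intro K(2) atom_sum_holomorphic A) auto
        then show ?thesis by (simp add: powr_mult mult.assoc)
      qed
      then have "?I j \<le> ennreal C1 * (ennreal ((c0 * M) powr q) * ennreal b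
              + (\<Sum>m\<le>n. ennreal (K * (C2 powr (1 / p)) powr q * M powr q)))"
        using b(2) by (intro order_trans[OF A(2)] mult_left_mono add_mono sum_mono) auto
      also have "\<dots> = ennreal (C1 * ((c0 * M) powr q * b + (\<Sum>m\<le>n. K * (C2 powr (1 / p)) powr q * M powr q)))"
        using C1(1) b(1) K(1) by (subst sum_ennreal) (auto simp: ennreal_mult[symmetric] ennreal_plus[symmetric] sum_nonneg simp del: ennreal_plus sum_constant)
      also have "C1 * ((c0 * M) powr q * b + (\<Sum>m\<le>n. K * (C2 powr (1 / p)) powr q * M powr q)) = K' * M powr q"
        unfolding K'_def powr_mult by (simp add: algebra_simps)
      finally show ?thesis .
    qed
    then have "powr_integral unit_disc q (gen_wcomp (us k) \<phi> k f) \<le> ennreal (K' * M powr q)"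
      unfolding exhaustion[OF f k q] by (rule SUP_least)
    then have "bergman_integral q (gen_wcomp (us k) \<phi> k f) \<le> ennreal (1 / pi) * ennreal (K' * M powr q)"
      unfolding bergman_integral_def by (rule mult_left_mono) simp
    also have "\<dots> = ennreal (1 / pi * K' * M powr q)" using K' by (simp add: ennreal_mult[symmetric])
    finally show ?thesis .
  qed
  moreover have "1 / pi * K' > 0" using K' by simp
  ultimately show ?thesis unfolding bounded_term_iff[OF k p q] by blast
qed

lemma bounded_sum:
  assumes bd: "\<And>k. k \<le> n \<Longrightarrow> bounded_op p q (gen_wcomp (us k) \<phi> k)" and p: "p > 0" and q: "q > 0"
  shows "bounded_op p q L"
proof -
  have "\<forall>k. \<exists>K. k \<le> n \<longrightarrow> (K > 0 \<and> (\<forall>f M. f holomorphic_on unit_disc \<longrightarrow> M > 0 \<longrightarrow>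
    bergman_integral p f \<le> ennreal (M powr p) \<longrightarrow> bergman_integral q (gen_wcomp (us k) \<phi> k f) \<le> ennreal (K * M powr q)))"
    using bd bounded_term_iff[OF _ p q] by blast
  then obtain K where K: "\<And>k. k \<le> n \<Longrightarrow> K k > 0" "\<And>k f M. k \<le> n \<Longrightarrow> f holomorphic_on unit_disc \<Longrightarrow> M > 0 \<Longrightarrow>
    bergman_integral p f \<le> ennreal (M powr p) \<Longrightarrow> bergman_integral q (gen_wcomp (us k) \<phi> k f) \<le> ennreal (K k * M powr q)"
    by metis
  define c where "c = real (card {..n}) powr q"
  have c: "c > 0" by (simp add: c_def)
  have "bergman_integral q (L f) \<le> ennreal ((c * (\<Sum>k\<le>n. K k)) * M powr q)"
    if f: "f holomorphic_on unit_disc" and M: "M > 0" "bergman_integral p f \<le> ennreal (M powr p)" for f M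
  proof -
    have "bergman_integral q (L f) \<le> ennreal c * (\<Sum>k\<le>n. bergman_integral q (gen_wcomp (us k) \<phi> k f))"
      unfolding L_op_def c_def by (intro bergman_integral_sum_le term_holomorphic f q) auto
    also have "\<dots> \<le> ennreal c * (\<Sum>k\<le>n. ennreal (K k * M powr q))"
      by (intro mult_left_mono sum_mono K(2) f M) auto
    also have "\<dots> = ennreal c * ennreal (\<Sum>k\<le>n. K k * M powr q)"
      using K(1) by (subst sum_ennreal) (auto intro!: mult_nonneg_nonneg intro: less_imp_le)
    also have "\<dots> = ennreal ((c * (\<Sum>k\<le>n. K k)) * M powr q)"
      using c by (simp add: ennreal_mult'[symmetric] sum_distrib_right mult.assoc)
    finally show ?thesis .
  qed
  moreover have "c * (\<Sum>k\<le>n. K k) > 0" using c K(1) by (intro mult_pos_pos sum_pos) auto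
  ultimately show ?thesis unfolding bounded_op_iff[OF p q] by blast
qed

text \<open>For a null sequence both parts of the truncated estimate tend to 0: the inner one
  because the functions tend to 0 uniformly on the disc of radius 7/8, the outer one because the
  sums of atoms form null sequences again and \<open>L\<close> is compact.\<close>

lemma compact_term:
  assumes cpt: "compact_op p q L" and k: "k \<le> n" and p: "p > 0" and q: "q > 0"
  shows "compact_op p q (gen_wcomp (us k) \<phi> k)"
proof -
  have bd: "bounded_op p q L" by (rule compact_op_imp_bounded_op[OF cpt p q])
  have maps: "gen_wcomp (us k) \<phi> k f \<in> bergman_space q" if "f \<in> bergman_space p" for f
    using bounded_term[OF bd k p q] that by (simp add: bounded_op_def)
  obtain N :: nat where N: "N \<ge> 3 + 2 / p" "p > 1 \<Longrightarrow> N \<ge> 2 + 1 / (2 * (p - 1))" "N * p > 2" "N \<ge> 2"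
    using exponent_exists[OF p] by blast
  obtain C where C: "C > 0" "\<And>f \<rho> B. f holomorphic_on unit_disc \<Longrightarrow> bergman_integral p f < \<infinity> \<Longrightarrow> \<rho> < 1 \<Longrightarrow>
    0 \<le> B \<Longrightarrow> (\<forall>w. norm w \<le> 7 / 8 \<longrightarrow> norm (f w) \<le> B) \<Longrightarrow>
    (\<exists>A. (\<forall>m. separated (A m)) \<and>
      powr_integral {z \<in> unit_disc. norm (\<phi> z) \<in> {..\<rho>}} q (gen_wcomp (us k) \<phi> k f)
        \<le> ennreal C * (ennreal (B powr q) * bergman_integral q (us k)
              + (\<Sum>m\<le>n. bergman_integral q (L (atom_sum p f (N + m) (A m))))))"
    using truncated_estimate[OF p q k, of N] by blast
  have "bergman_integral q (us k) < \<infinity>"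
    using bd by (intro coefficient_in_bergman_space[OF p q _ k]) (auto simp: bounded_op_def)
  then obtain b where b: "b \<ge> 0" "bergman_integral q (us k) = ennreal b"
    by (cases "bergman_integral q (us k)") auto
  have null: "(\<lambda>i. bergman_integral q (gen_wcomp (us k) \<phi> k (F i))) \<longlonglongrightarrow> 0" if F: "null_seq p F" for F
  proof -
    have hol: "F i holomorphic_on unit_disc" for i using F by (simp add: null_seq_def)
    have Fp: "F i \<in> bergman_space p" for i by (rule null_seq_bergman_space[OF F])
    then have fin: "bergman_integral p (F i) < \<infinity>" for i by (simp add: bergman_space_def)
    have "uniform_limit (cball 0 (7 / 8)) F (\<lambda>_. 0) sequentially" using F by (simp add: null_seq_def)
    then have "\<exists>B. (\<forall>i. 0 \<le> B i \<and> (\<forall>w\<in>cball 0 (7 / 8). norm (F i w) \<le> B i)) \<and> B \<longlonglongrightarrow> (0 :: real)"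
      by (rule uniform_limit_zero_bound)
        (auto intro!: holomorphic_on_imp_continuous_on holomorphic_on_subset[OF hol])
    then obtain B where B0: "\<And>i. 0 \<le> B i \<and> (\<forall>w\<in>cball 0 (7 / 8). norm (F i w) \<le> B i)" and B_lim: "B \<longlonglongrightarrow> (0 :: real)"
      by blast
    have B: "0 \<le> B i" "norm w \<le> 7 / 8 \<Longrightarrow> norm (F i w) \<le> B i" for i w using B0[of i] by auto
    define X where "X i = (powr_integral unit_disc q (gen_wcomp (us k) \<phi> k (F i)))" for i
    define I where "I \<rho> i = (powr_integral {z \<in> unit_disc. norm (\<phi> z) \<in> {..\<rho>}} q (gen_wcomp (us k) \<phi> k (F i)))" for \<rho> i
    \<comment> \<open>A radius depending on \<open>i\<close> that already captures half of the full
      integral. It avoids interchanging the limit in \<open>i\<close> with the exhaustion, and it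
      exists because the integral is finite, which is why boundedness of the summand is established
      beforehand.\<close>
    have "\<exists>\<rho><1. X i \<le> 2 * I \<rho> i" for i
    proof (cases "X i = 0")
      case True
      then show ?thesis by (intro exI[of _ 0]) simp
    next
      case False
      have "X i = ennreal pi * bergman_integral q (gen_wcomp (us k) \<phi> k (F i))"
        unfolding X_def by (rule disc_integral_eq_bergman_integral)
      then have "X i < \<infinity>" using maps[OF Fp[of i]] by (simp add: bergman_space_def ennreal_mult_less_top)
      then obtain x where x: "X i = ennreal x" "x > 0" using False by (cases "X i") auto
      have "ennreal (x / 2) < X i" using x by (simp add: ennreal_less_iff)
      also have "X i = (SUP j. I (1 - 1 / (real j + 2)) i)" unfolding X_def I_def by (rule exhaustion[OF hol k q])
      finally obtain j where j: "ennreal (x / 2) < I (1 - 1 / (real j + 2)) i" unfolding less_SUP_iff by blast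
      have "X i = 2 * ennreal (x / 2)"
        unfolding x(1) using x(2) by (subst ennreal_numeral[symmetric], subst ennreal_mult[symmetric]) auto
      also have "\<dots> \<le> 2 * I (1 - 1 / (real j + 2)) i" using j by (intro mult_left_mono) auto
      finally show ?thesis by (intro exI[of _ "1 - 1 / (real j + 2)"]) simp
    qed
    then obtain \<rho> where \<rho>: "\<And>i. \<rho> i < 1" "\<And>i. X i \<le> 2 * I (\<rho> i) i" by metis
    have "\<exists>A. (\<forall>m. separated (A m)) \<and> I (\<rho> i) i
        \<le> ennreal C * (ennreal (B i powr q) * bergman_integral q (us k)
              + (\<Sum>m\<le>n. bergman_integral q (L (atom_sum p (F i) (N + m) (A m)))))" for i
      unfolding I_def using B(2) by (intro C(2) hol fin \<rho>(1) B(1)) auto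
    then obtain A where A: "\<And>i m. separated (A i m)" "\<And>i. I (\<rho> i) i
        \<le> ennreal C * (ennreal (B i powr q) * bergman_integral q (us k)
              + (\<Sum>m\<le>n. bergman_integral q (L (atom_sum p (F i) (N + m) (A i m)))))" by metis
    define Y where "Y i = ennreal C * (ennreal (B i powr q) * ennreal b
              + (\<Sum>m\<le>n. bergman_integral q (L (atom_sum p (F i) (N + m) (A i m)))))" for i
    have "(\<lambda>i. bergman_integral q (L (atom_sum p (F i) (N + m) (A i m)))) \<longlonglongrightarrow> 0" for m
      by (intro compact_op_null[OF cpt _ p q] null_seq_atom_sum[OF p N F] A(1)) simp_all
    then have "(\<lambda>i. \<Sum>m\<le>n. bergman_integral q (L (atom_sum p (F i) (N + m) (A i m)))) \<longlonglongrightarrow> (\<Sum>m\<le>n. 0)"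
      by (intro tendsto_sum)
    moreover have "(\<lambda>i. ennreal (B i powr q) * ennreal b) \<longlonglongrightarrow> 0"
    proof -
      have "(\<lambda>i. B i powr q * b) \<longlonglongrightarrow> 0 powr q * b"
        using q B(1) by (intro tendsto_mult tendsto_powr2 B_lim tendsto_const) auto
      then have "(\<lambda>i. ennreal (B i powr q * b)) \<longlonglongrightarrow> ennreal 0" using q by (intro tendsto_ennrealI) simp
      then show ?thesis using b(1) by (simp add: ennreal_mult)
    qed
    ultimately have "(\<lambda>i. ennreal (B i powr q) * ennreal b
        + (\<Sum>m\<le>n. bergman_integral q (L (atom_sum p (F i) (N + m) (A i m))))) \<longlonglongrightarrow> 0 + (\<Sum>m\<le>n. 0)"
      by (intro tendsto_add)
    then have "Y \<longlonglongrightarrow> ennreal C * (0 + (\<Sum>m\<le>n. 0))" unfolding Y_def by (intro ennreal_tendsto_cmult) auto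
    then have "(\<lambda>i. ennreal (1 / pi) * (2 * Y i)) \<longlonglongrightarrow> ennreal (1 / pi) * (2 * (ennreal C * (0 + (\<Sum>m\<le>n. 0))))"
      by (intro ennreal_tendsto_cmult) auto
    then have lim: "(\<lambda>i. ennreal (1 / pi) * (2 * Y i)) \<longlonglongrightarrow> 0" by simp
    have "bergman_integral q (gen_wcomp (us k) \<phi> k (F i)) \<le> ennreal (1 / pi) * (2 * Y i)" for i
    proof -
      have "X i \<le> 2 * Y i"
        using \<rho>(2)[of i] A(2)[of i] unfolding Y_def b(2) by (meson mult_left_mono order_trans zero_le)
      then show ?thesis unfolding bergman_integral_def X_def by (intro mult_left_mono) auto
    qed
    then show ?thesis by (intro tendsto_sandwich[OF _ _ tendsto_const lim]) auto
  qed
  show ?thesis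
    unfolding gen_wcomp_eq_L_op[OF k]
    by (rule weighted_sum.compact_opI_null[OF term_weighted_sum[OF k] _ _ p q])
      (use maps null in \<open>simp_all add: gen_wcomp_eq_L_op[OF k]\<close>)
qed

text \<open>The null sequence criterion makes this additive at once, with no successive extraction
  of subsequences for the individual summands.\<close>

lemma compact_sum:
  assumes cpt: "\<And>k. k \<le> n \<Longrightarrow> compact_op p q (gen_wcomp (us k) \<phi> k)" and p: "p > 0" and q: "q > 0"
  shows "compact_op p q L"
proof (rule compact_opI_null[OF _ _ p q])
  define c where "c = real (card {..n}) powr q"
  have le: "bergman_integral q (L f) \<le> ennreal c * (\<Sum>k\<le>n. bergman_integral q (gen_wcomp (us k) \<phi> k f))"
    if "f holomorphic_on unit_disc" for f
    unfolding L_op_def c_def by (intro bergman_integral_sum_le term_holomorphic that q) auto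
  show "L f \<in> bergman_space q" if f: "f \<in> bergman_space p" for f
  proof -
    have fh: "f holomorphic_on unit_disc" using f by (simp add: bergman_space_def)
    have "gen_wcomp (us k) \<phi> k f \<in> bergman_space q" if "k \<le> n" for k
      using cpt[OF that] f by (simp add: compact_op_def)
    then have "ennreal c * (\<Sum>k\<le>n. bergman_integral q (gen_wcomp (us k) \<phi> k f)) < \<infinity>"
      by (auto simp: ennreal_mult_less_top bergman_space_def)
    then show ?thesis using le[OF fh] L_holomorphic[OF fh] by (auto simp: bergman_space_def intro: le_less_trans)
  qed
  show "(\<lambda>i. bergman_integral q (L (F i))) \<longlonglongrightarrow> 0" if F: "null_seq p F" for F
  proof -
    have hol: "F i holomorphic_on unit_disc" for i using F by (simp add: null_seq_def)
    have "(\<lambda>i. bergman_integral q (gen_wcomp (us k) \<phi> k (F i))) \<longlonglongrightarrow> 0" if k: "k \<le> n" for k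
      using weighted_sum.compact_op_null[OF term_weighted_sum[OF k] _ F p q] cpt[OF k]
      unfolding gen_wcomp_eq_L_op[OF k] by blast
    then have "(\<lambda>i. \<Sum>k\<le>n. bergman_integral q (gen_wcomp (us k) \<phi> k (F i))) \<longlonglongrightarrow> (\<Sum>k\<le>n. 0)"
      by (intro tendsto_sum) auto
    then have "(\<lambda>i. ennreal c * (\<Sum>k\<le>n. bergman_integral q (gen_wcomp (us k) \<phi> k (F i)))) \<longlonglongrightarrow> ennreal c * (\<Sum>k\<le>n. 0)"
      by (intro ennreal_tendsto_cmult) auto
    then have lim: "(\<lambda>i. ennreal c * (\<Sum>k\<le>n. bergman_integral q (gen_wcomp (us k) \<phi> k (F i)))) \<longlonglongrightarrow> 0" by simp
    show ?thesis using le[OF hol] by (intro tendsto_sandwich[OF _ _ tendsto_const lim]) auto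
  qed
qed

end

theorem theorem1p8:
  fixes p q :: real and n :: nat
    and us :: "nat \<Rightarrow> complex \<Rightarrow> complex" and \<phi> :: "complex \<Rightarrow> complex"
  assumes "0 < p" and "0 < q" and "0 < n"
    and "\<forall>k\<le>n. us k holomorphic_on unit_disc"
    and "\<phi> holomorphic_on unit_disc" and "\<phi> ` unit_disc \<subseteq> unit_disc"
  shows "(bounded_op p q (L_op us \<phi> n) \<longleftrightarrow> (\<forall>k\<le>n. bounded_op p q (gen_wcomp (us k) \<phi> k)))
       \<and> (compact_op p q (L_op us \<phi> n) \<longleftrightarrow> (\<forall>k\<le>n. compact_op p q (gen_wcomp (us k) \<phi> k)))"
proof -
  interpret weighted_sum us \<phi> n by unfold_locales (use assms in auto)
  show ?thesis
    using bounded_term[of p q] bounded_sum[of p q] compact_term[of p q] compact_sum[of p q] assms(1,2) by blast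
qed

end
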